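(* Let $C$ be an infinite cyclic group acting on $\mathbb{Z}[C]$ by multiplication, and let $$G=\mathbb{Z}[C]\rtimes C=\mathbb{Z}\wr\mathbb{Z}=\langle a,b\mid [a,a^{b^i}]=1,\ i\in\mathbb{Z}\rangle .$$ Then $H\mathbb{Z}\text{-length}(G)\geq\omega+2$.
   Context: Homology is with integral coefficients. An $H\mathbb{Z}$-map is a group homomorphism inducing an isomorphism on $H_1$ and an epimorphism on $H_2$. A group $\Gamma$ is $H\mathbb{Z}$-local if every $H\mathbb{Z}$-map $G\to H$ induces a bijection $\mathrm{Hom}(H,\Gamma)\to\mathrm{Hom}(G,\Gamma)$. The $H\mathbb{Z}$-localization $\eta:G\to EG$ of a group $G$ is the (unique up to isomorphism) $H\mathbb{Z}$-map with $EG$ an $H\mathbb{Z}$-local group; it exists for every $G$ (Bousfield). The transfinite lower central series is $\gamma_1(G)=G$, $\gamma_{\tau+1}(G)=[\gamma_\tau(G),G]$, $\gamma_\alpha(G)=\bigcap_{\tau<\alpha}\gamma_\tau(G)$ for limit ordinals $\alpha$. $H\mathbb{Z}\text{-length}(G)$ is the least ordinal $\tau$ with $\gamma_\tau(EG)=1$ (it exists since $EG$ is transfinitely nilpotent). *)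

theory Defs
  imports
    "HOL-Library.FuncSet"
    "HOL-Algebra.Free_Abelian_Groups"
    "HOL-Algebra.Generated_Groups"
begin

section \<open>Integral group homology\<close>

text \<open>
  Homology with trivial integral coefficients, computed by the inhomogeneous bar complex: the
  chains of degree \<open>n\<close> form the free abelian group on the \<open>n\<close>-tuples \<open>[g\<^sub>1|\<dots>|g\<^sub>n]\<close> of group
  elements (written as lists), with
  \<open>d[g\<^sub>1|\<dots>|g\<^sub>n] = [g\<^sub>2|\<dots>|g\<^sub>n] + (\<Sum>i=1..<n. (-1)\<^sup>i [g\<^sub>1|\<dots>|g\<^sub>i g\<^sub>i\<^sub>+\<^sub>1|\<dots>|g\<^sub>n]) + (-1)\<^sup>n [g\<^sub>1|\<dots>|g\<^sub>n\<^sub>-\<^sub>1]\<close>.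
\<close>

definition bar_cells :: "('a, 'b) monoid_scheme \<Rightarrow> nat \<Rightarrow> 'a list set" where
  "bar_cells G n = {xs. length xs = n \<and> set xs \<subseteq> carrier G}"

definition bar_chains :: "('a, 'b) monoid_scheme \<Rightarrow> nat \<Rightarrow> ('a list \<Rightarrow>\<^sub>0 int) monoid" where
  "bar_chains G n = free_Abelian_group (bar_cells G n)"

text \<open>List positions are counted from 0, so \<open>g\<^sub>i\<close> is \<open>xs ! (i - 1)\<close>.\<close>

definition bar_boundary_cell :: "('a, 'b) monoid_scheme \<Rightarrow> 'a list \<Rightarrow> ('a list \<Rightarrow>\<^sub>0 int)" where
  "bar_boundary_cell G xs =
     (if xs = [] then 0
      else frag_of (tl xs)
         + (\<Sum>i = 1..<length xs.
              frag_cmul ((-1) ^ i)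
                (frag_of (take (i - 1) xs @ [xs ! (i - 1) \<otimes>\<^bsub>G\<^esub> xs ! i] @ drop (i + 1) xs)))
         + frag_cmul ((-1) ^ length xs) (frag_of (butlast xs)))"

definition bar_boundary ::
    "('a, 'b) monoid_scheme \<Rightarrow> ('a list \<Rightarrow>\<^sub>0 int) \<Rightarrow> ('a list \<Rightarrow>\<^sub>0 int)" where
  "bar_boundary G = frag_extend (bar_boundary_cell G)"

definition bar_cycles :: "('a, 'b) monoid_scheme \<Rightarrow> nat \<Rightarrow> ('a list \<Rightarrow>\<^sub>0 int) set" where
  "bar_cycles G n = {c \<in> carrier (bar_chains G n). bar_boundary G c = 0}"

definition bar_boundaries :: "('a, 'b) monoid_scheme \<Rightarrow> nat \<Rightarrow> ('a list \<Rightarrow>\<^sub>0 int) set" where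
  "bar_boundaries G n = bar_boundary G ` carrier (bar_chains G (Suc n))"

definition group_homology ::
    "nat \<Rightarrow> ('a, 'b) monoid_scheme \<Rightarrow> ('a list \<Rightarrow>\<^sub>0 int) set monoid" where
  "group_homology n G = (bar_chains G n)\<lparr>carrier := bar_cycles G n\<rparr> Mod bar_boundaries G n"

text \<open>
  The map induced by \<open>f\<close> sends the coset \<open>K = B\<^sub>n(G) + c\<close> to \<open>B\<^sub>n(H) + f\<^sub>#(K)\<close>, which is the coset
  \<open>B\<^sub>n(H) + f\<^sub>#(c)\<close> since \<open>f\<^sub>#\<close> maps \<open>B\<^sub>n(G)\<close> into \<open>B\<^sub>n(H)\<close>.
\<close>

definition hom_induced_homology ::
    "nat \<Rightarrow> ('c, 'd) monoid_scheme \<Rightarrow> ('a \<Rightarrow> 'c) \<Rightarrow> ('a list \<Rightarrow>\<^sub>0 int) set \<Rightarrow> ('c list \<Rightarrow>\<^sub>0 int) set"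
  where
  "hom_induced_homology n H f K =
     bar_boundaries H n <#>\<^bsub>bar_chains H n\<^esub> (frag_extend (\<lambda>xs. frag_of (map f xs)) ` K)"


section \<open>HZ-localization\<close>

definition HZ_map ::
    "('a, 'b) monoid_scheme \<Rightarrow> ('c, 'd) monoid_scheme \<Rightarrow> ('a \<Rightarrow> 'c) \<Rightarrow> bool" where
  "HZ_map G H f \<longleftrightarrow>
     group G \<and> group H \<and> f \<in> hom G H \<and>
     hom_induced_homology 1 H f \<in> iso (group_homology 1 G) (group_homology 1 H) \<and>
     hom_induced_homology 2 H f \<in> epi (group_homology 2 G) (group_homology 2 H)"

text \<open>
  HOL has no quantification over types inside a formula, so the test maps \<open>G \<rightarrow> H\<close> run over the
  groups living in the same type as \<open>\<Gamma>\<close>; this type plays the role of the universe of groups.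
  As soon as it is infinite this is locality with respect to all groups whatsoever: homology
  commutes with directed unions, so every HZ-map is an \<open>\<aleph>\<^sub>1\<close>-directed union of HZ-maps between
  countable groups, and locality need only be tested on those.

  Functions are total in HOL; \<open>extensional\<close> makes homomorphisms that agree on the
  carrier equal.
\<close>

definition Hom_set :: "('a, 'b) monoid_scheme \<Rightarrow> ('c, 'd) monoid_scheme \<Rightarrow> ('a \<Rightarrow> 'c) set" where
  "Hom_set G H = hom G H \<inter> extensional (carrier G)"

definition HZ_local :: "'u monoid \<Rightarrow> bool" where
  "HZ_local \<Gamma> \<longleftrightarrow>
     group \<Gamma> \<and>
     (\<forall>(G :: 'u monoid) (H :: 'u monoid) f. HZ_map G H f \<longrightarrow>
        bij_betw (\<lambda>\<phi>. compose (carrier G) \<phi> f) (Hom_set H \<Gamma>) (Hom_set G \<Gamma>))"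

definition HZ_localization ::
    "('a, 'b) monoid_scheme \<Rightarrow> 'u monoid \<Rightarrow> ('a \<Rightarrow> 'u) \<Rightarrow> bool" where
  "HZ_localization G E \<eta> \<longleftrightarrow> HZ_map G E \<eta> \<and> HZ_local E"


section \<open>The transfinite lower central series\<close>

text \<open>
  An ordinal is represented, as in the library, by a well-order relation, and ordinals are compared
  by \<open>\<le>o\<close>. An element \<open>i\<close> of a well-order \<open>r\<close> stands for the order type of its set of strict
  predecessors \<open>underS r i\<close>.
\<close>

definition ord_succ :: "'i rel \<Rightarrow> 'i option rel" where
  "ord_succ r = {(Some x, Some y) | x y. (x, y) \<in> r} \<union> {(x, None) | x. x \<in> insert None (Some ` Field r)}"

abbreviation omega_plus_2 :: "nat option option rel" where
  "omega_plus_2 \<equiv> ord_succ (ord_succ natLeq)"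

definition commutator_subgroup :: "('a, 'b) monoid_scheme \<Rightarrow> 'a set \<Rightarrow> 'a set \<Rightarrow> 'a set" where
  "commutator_subgroup G H K =
     generate G {h \<otimes>\<^bsub>G\<^esub> k \<otimes>\<^bsub>G\<^esub> inv\<^bsub>G\<^esub> h \<otimes>\<^bsub>G\<^esub> inv\<^bsub>G\<^esub> k | h k. h \<in> H \<and> k \<in> K}"

text \<open>
  The term \<open>\<gamma>\<^sub>\<tau>(G)\<close>, where \<open>\<tau>\<close> is the order type of the initial segment \<open>A\<close> of \<open>r\<close> and \<open>g i\<close> is the
  term belonging to \<open>i \<in> A\<close>. The series starts with \<open>\<gamma>\<^sub>1(G) = G\<close>; the value at \<open>0\<close> is a dummy, which is
  also taken to be \<open>G\<close>. If \<open>A\<close> has at least two elements and a greatest element \<open>m\<close>, then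
  \<open>\<tau> = \<sigma> + 1\<close> with \<open>\<sigma> \<ge> 1\<close> the ordinal represented by \<open>m\<close>.
\<close>

definition lcs_step ::
    "('a, 'b) monoid_scheme \<Rightarrow> 'i rel \<Rightarrow> 'i set \<Rightarrow> ('i \<Rightarrow> 'a set) \<Rightarrow> 'a set" where
  "lcs_step G r A g =
     (if \<exists>x. A \<subseteq> {x} then carrier G
      else if \<exists>m\<in>A. \<forall>j\<in>A. (j, m) \<in> r
           then commutator_subgroup G (g (THE m. m \<in> A \<and> (\<forall>j\<in>A. (j, m) \<in> r))) (carrier G)
      else (\<Inter>j\<in>A. g j))"

definition lcs_below :: "('a, 'b) monoid_scheme \<Rightarrow> 'i rel \<Rightarrow> 'i \<Rightarrow> 'a set" where
  "lcs_below G r = wo_rel.worec r (\<lambda>g i. lcs_step G r (underS r i) g)"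

definition transfinite_lcs :: "('a, 'b) monoid_scheme \<Rightarrow> 'i rel \<Rightarrow> 'a set" where
  "transfinite_lcs G \<tau> = lcs_step G \<tau> (Field \<tau>) (lcs_below G \<tau>)"

text \<open>
  \<open>\<tau>\<close> is the least ordinal \<open>\<ge> 1\<close> with \<open>\<gamma>\<^sub>\<tau>(E) = 1\<close>. Competitors in the type of \<open>\<tau>\<close> suffice, since
  every ordinal smaller than \<open>\<tau>\<close> is represented there.
\<close>

definition is_nilpotency_length :: "('a, 'b) monoid_scheme \<Rightarrow> 'i rel \<Rightarrow> bool" where
  "is_nilpotency_length E \<tau> \<longleftrightarrow>
     Well_order \<tau> \<and> \<tau> \<noteq> {} \<and> transfinite_lcs E \<tau> = {\<one>\<^bsub>E\<^esub>} \<and>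
     (\<forall>\<tau>' :: 'i rel. Well_order \<tau>' \<and> \<tau>' \<noteq> {} \<and> transfinite_lcs E \<tau>' = {\<one>\<^bsub>E\<^esub>} \<longrightarrow> \<tau> \<le>o \<tau>')"

text \<open>
  \<open>\<tau>\<close> is the HZ-length of \<open>G\<close>, read off from a localization \<open>\<eta> : G \<rightarrow> E\<close>, which is unique up to
  isomorphism.
\<close>

definition is_HZ_length ::
    "('a, 'b) monoid_scheme \<Rightarrow> 'u monoid \<Rightarrow> ('a \<Rightarrow> 'u) \<Rightarrow> 'i rel \<Rightarrow> bool" where
  "is_HZ_length G E \<eta> \<tau> \<longleftrightarrow> HZ_localization G E \<eta> \<and> is_nilpotency_length E \<tau>"


section \<open>The wreath product\<close>

text \<open>
  With \<open>C\<close> the additive group \<open>int\<close>, the group ring \<open>\<int>[C]\<close> is the ring \<open>int \<Rightarrow>\<^sub>0 int\<close> under convolution,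
  and \<open>Poly_Mapping.single m 1\<close> is the element of \<open>C\<close> given by the \<open>m\<close>-th power of the generator.
\<close>

definition wreath_Z_Z :: "((int \<Rightarrow>\<^sub>0 int) \<times> int) monoid" where
  "wreath_Z_Z =
     \<lparr>carrier = UNIV,
      monoid.mult = (\<lambda>(p, m) (q, n). (p + Poly_Mapping.single m 1 * q, m + n)),
      one = (0, 0)\<rparr>"

lemma group_wreath_Z_Z: "group wreath_Z_Z"
proof (rule groupI)
  fix x assume "x \<in> carrier wreath_Z_Z"
  obtain p m where x: "x = (p, m)" by (cases x)
  have "(- (Poly_Mapping.single (- m) 1 * p), - m) \<otimes>\<^bsub>wreath_Z_Z\<^esub> x = \<one>\<^bsub>wreath_Z_Z\<^esub>"
    by (simp add: x wreath_Z_Z_def)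
  then show "\<exists>y\<in>carrier wreath_Z_Z. y \<otimes>\<^bsub>wreath_Z_Z\<^esub> x = \<one>\<^bsub>wreath_Z_Z\<^esub>"
    by (rule bexI) (simp add: wreath_Z_Z_def)
qed (auto simp: wreath_Z_Z_def distrib_left mult_single simp flip: mult.assoc)

end

theory Submission
  imports
    Defs
    "HOL-Algebra.Elementary_Groups"
    "HOL-Computational_Algebra.Formal_Power_Series"
    "HOL-Library.Function_Algebras"
begin

text \<open>
  Write \<open>G = M \<rtimes> C\<close> with \<open>M = \<int>[C] = \<int>[t, t\<^sup>-\<^sup>1]\<close>, let \<open>a = 1 \<in> M\<close> and \<open>b = t \<in> C\<close> be the generators, and
  let \<open>\<eta> : G \<rightarrow> E\<close> be the localization.  It is enough to find a nontrivial element of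
  \<open>\<gamma>\<^bsub>\<omega>+1\<^esub>(E)\<close>: if \<open>\<omega> + 2 \<le> \<tau>\<close> fails, then \<open>\<tau>\<close> is a proper initial segment of \<open>\<omega> + 2\<close>, and
  \<open>\<gamma>\<^bsub>\<omega>+1\<^esub>(E) \<subseteq> \<gamma>\<^sub>\<tau>(E)\<close> (\<open>transfinite_lcs_lower_bound\<close>).

  The element.  The endomorphism \<open>a \<mapsto> a a b a\<^sup>-\<^sup>1 b\<^sup>-\<^sup>1\<close>, \<open>b \<mapsto> b\<close> of the free group of rank two is an
  HZ-map, because it is the identity on \<open>H\<^sub>1\<close> and \<open>H\<^sub>2\<close> of a free group vanishes.  Locality of \<open>E\<close>
  therefore gives \<open>y \<in> E\<close> with \<open>y y b y\<^sup>-\<^sup>1 b\<^sup>-\<^sup>1 = a\<close>, that is, \<open>y\<close> plays the role of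
  \<open>1/(2 - t)\<close>.  An HZ-map is surjective modulo every \<open>\<gamma>\<^sub>n\<close> with \<open>n\<close> finite, so modulo \<open>\<gamma>\<^sub>n(E)\<close> the
  element \<open>y\<close> comes from the abelian group \<open>M\<close> and commutes with \<open>a\<close>.  Hence \<open>w = [y, a]\<close> lies in
  \<open>\<gamma>\<^sub>\<omega>(E)\<close> and \<open>v = [w, b]\<close> lies in \<open>\<gamma>\<^bsub>\<omega>+1\<^esub>(E)\<close>.

  Why \<open>v \<noteq> 1\<close>.  The elements of \<open>E\<close> receive coordinates \<open>(\<chi>, p, \<alpha>, \<beta>)\<close> which amount to a
  homomorphism from \<open>E\<close> to a group \<open>\<Gamma>\<close>.  Embed \<open>M\<close> into \<open>\<rat>[[u]]\<close> by \<open>t \<mapsto> e\<^sup>u\<close>.  On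
  \<open>\<rat>[[u]]\<close> there are the pairings \<open>\<langle>f, g\<rangle> = f(u) g(-u)\<close>, which is invariant under
  multiplication of both arguments by \<open>e\<^sup>u\<close>, and \<open>\<langle>f, g'\<rangle>\<close>, which under this operation changes by
  \<open>\<langle>f, g\<rangle>\<close>.  Composed with a linear functional \<open>L\<close>, they define a nilpotent group of class two on
  \<open>\<rat>\<^sup>2 \<times> \<rat>[[u]]\<close>, on which \<open>t\<close> acts by \<open>e\<^sup>u\<close> on \<open>\<rat>[[u]]\<close> and by the unipotent map
  \<open>(\<alpha>, \<beta>) \<mapsto> (\<alpha>, \<beta> + \<alpha>)\<close> on the central subgroup \<open>\<rat>\<^sup>2\<close>.  These actions extend to rational powers
  of \<open>t\<close>, and \<open>\<Gamma>\<close> is the semidirect product with \<open>\<rat>\<close>, whose coordinate is \<open>\<chi>\<close>.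
  The functional \<open>L\<close> is chosen to kill all Laurent polynomials in \<open>e\<^sup>u\<close>, so that \<open>G\<close> maps to
  \<open>\<Gamma>\<close> with \<open>\<alpha> = \<beta> = 0\<close>.  Then \<open>\<alpha>(w) = L(Y(u) - Y(-u))\<close> for \<open>Y = 1/(2 - e\<^sup>u)\<close>, and
  \<open>\<beta>(v) = - \<alpha>(w)\<close>.  Since \<open>Y(u) - Y(-u)\<close>, as a function of \<open>t\<close>, has a pole at \<open>t = 2\<close>, it is not a
  Laurent polynomial, and \<open>L\<close> can be chosen with \<open>\<alpha>(w) = 1\<close>.

  The coordinates are first given on \<open>G\<close> and extended to \<open>E\<close> one at a time, the power series
  \<open>p\<close> coefficient by coefficient.  Each of them solves an equation
  \<open>s(g h) = s(g) + s(h) + z(g, h)\<close>, where the cocycle \<open>z\<close> depends on the previous coordinates.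
  As \<open>\<eta>\<close> is an HZ-map, a solution on \<open>G\<close> extends to \<open>E\<close>
  (\<open>HZ_map_extends_cocycle_splitting\<close>).
\<close>

section \<open>Homology of the bar complex\<close>

abbreviation chain_map :: "('a \<Rightarrow> 'c) \<Rightarrow> ('a list \<Rightarrow>\<^sub>0 int) \<Rightarrow> ('c list \<Rightarrow>\<^sub>0 int)" where
  "chain_map f \<equiv> frag_extend (\<lambda>xs. frag_of (map f xs))"

lemma carrier_bar_chains: "carrier (bar_chains G n) = {c. Poly_Mapping.keys c \<subseteq> bar_cells G n}"
  by (auto simp: bar_chains_def)

lemma bar_chains_simps [simp]:
  "\<one>\<^bsub>bar_chains G n\<^esub> = 0" "x \<otimes>\<^bsub>bar_chains G n\<^esub> y = x + y"
  by (simp_all add: bar_chains_def)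

lemma comm_group_bar_chains: "comm_group (bar_chains G n)"
  by (simp add: bar_chains_def abelian_free_Abelian_group)

lemma bar_chains_closed:
  "0 \<in> carrier (bar_chains G n)"
  "c \<in> carrier (bar_chains G n) \<Longrightarrow> d \<in> carrier (bar_chains G n) \<Longrightarrow> c + d \<in> carrier (bar_chains G n)"
  "c \<in> carrier (bar_chains G n) \<Longrightarrow> d \<in> carrier (bar_chains G n) \<Longrightarrow> c - d \<in> carrier (bar_chains G n)"
  "c \<in> carrier (bar_chains G n) \<Longrightarrow> - c \<in> carrier (bar_chains G n)"
  "c \<in> carrier (bar_chains G n) \<Longrightarrow> frag_cmul k c \<in> carrier (bar_chains G n)"
  "frag_of xs \<in> carrier (bar_chains G n) \<longleftrightarrow> xs \<in> bar_cells G n"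
  by (auto simp: carrier_bar_chains dest!: subsetD[OF keys_add] subsetD[OF keys_diff] subsetD[OF keys_cmul])

lemma bar_chains_induct [consumes 1, case_names zero cell diff]:
  assumes "c \<in> carrier (bar_chains G n)"
    and "P 0" and "\<And>xs. xs \<in> bar_cells G n \<Longrightarrow> P (frag_of xs)"
    and "\<And>a b. a \<in> carrier (bar_chains G n) \<Longrightarrow> b \<in> carrier (bar_chains G n) \<Longrightarrow> P a \<Longrightarrow> P b \<Longrightarrow> P (a - b)"
  shows "P c"
  using assms by (intro free_Abelian_group_induct[of c "bar_cells G n" P]) (auto simp: carrier_bar_chains)

lemma frag_extend_in_bar_chains:
  assumes "c \<in> carrier (bar_chains G n)"
    and "\<And>xs. xs \<in> bar_cells G n \<Longrightarrow> f xs \<in> carrier (bar_chains H m)"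
  shows "frag_extend f c \<in> carrier (bar_chains H m)"
  using assms
  by (induction rule: bar_chains_induct) (auto simp: frag_extend_diff bar_chains_closed)

lemma bar_boundary_simps [simp]:
  "bar_boundary G 0 = 0"
  "bar_boundary G (c + d) = bar_boundary G c + bar_boundary G d"
  "bar_boundary G (c - d) = bar_boundary G c - bar_boundary G d"
  "bar_boundary G (- c) = - bar_boundary G c"
  "bar_boundary G (frag_cmul k c) = frag_cmul k (bar_boundary G c)"
  "bar_boundary G (frag_of xs) = bar_boundary_cell G xs"
  by (simp_all add: bar_boundary_def frag_extend_add frag_extend_diff frag_extend_minus frag_extend_cmul)

lemma bar_boundary_cell_1: "bar_boundary_cell G [g] = 0"
  by (simp add: bar_boundary_cell_def)

lemma bar_boundary_cell_2:
  "bar_boundary_cell G [g, h] = frag_of [h] - frag_of [g \<otimes>\<^bsub>G\<^esub> h] + frag_of [g]"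
  by (simp add: bar_boundary_cell_def)

lemma bar_boundary_cell_3:
  "bar_boundary_cell G [g, h, k] =
     frag_of [h, k] - frag_of [g \<otimes>\<^bsub>G\<^esub> h, k] + frag_of [g, h \<otimes>\<^bsub>G\<^esub> k] - frag_of [g, h]"
proof -
  have "{1..<3::nat} = {1, 2}" by auto
  then show ?thesis
    by (simp add: bar_boundary_cell_def)
qed

lemma bar_cells_1: "bar_cells G 1 = {[g] | g. g \<in> carrier G}"
  by (auto simp: bar_cells_def length_Suc_conv)

lemma bar_cells_2: "bar_cells G 2 = {[g, h] | g h. g \<in> carrier G \<and> h \<in> carrier G}"
  by (auto simp: bar_cells_def length_Suc_conv numeral_2_eq_2)

lemma bar_cells_3:
  "bar_cells G 3 = {[g, h, k] | g h k. g \<in> carrier G \<and> h \<in> carrier G \<and> k \<in> carrier G}"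
  by (auto simp: bar_cells_def length_Suc_conv numeral_3_eq_3)

lemma bar_boundary_in_bar_chains:
  assumes "group G" "c \<in> carrier (bar_chains G (Suc n))"
  shows "bar_boundary G c \<in> carrier (bar_chains G n)"
  unfolding bar_boundary_def
proof (rule frag_extend_in_bar_chains[OF assms(2)])
  interpret group G by fact
  fix xs assume xs: "xs \<in> bar_cells G (Suc n)"
  then have len: "length xs = Suc n" and sub: "set xs \<subseteq> carrier G"
    by (auto simp: bar_cells_def)
  let ?C = "carrier (bar_chains G n)"
  have "tl xs \<in> bar_cells G n" "butlast xs \<in> bar_cells G n"
    using len sub by (auto simp: bar_cells_def dest: in_set_butlastD list.set_sel(2)[rotated])
  have "xs \<noteq> []" using len by auto
  have "take (i - 1) xs @ [xs ! (i - 1) \<otimes>\<^bsub>G\<^esub> xs ! i] @ drop (i + 1) xs \<in> bar_cells G n"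
    if "i \<in> {1..<length xs}" for i
  proof -
    have "xs ! (i - 1) \<in> carrier G" "xs ! i \<in> carrier G"
      using that by (auto intro!: subsetD[OF sub] nth_mem)
    then show ?thesis
      using that len sub by (auto simp: bar_cells_def dest: in_set_takeD in_set_dropD)
  qed
  then have "frag_of (take (i - 1) xs @ [xs ! (i - 1) \<otimes>\<^bsub>G\<^esub> xs ! i] @ drop (i + 1) xs) \<in> ?C"
    if "i \<in> {1..<length xs}" for i
    using that unfolding bar_chains_closed by blast
  then show "bar_boundary_cell G xs \<in> ?C"
    unfolding bar_boundary_cell_def if_not_P[OF \<open>xs \<noteq> []\<close>]
    using \<open>tl xs \<in> _\<close> \<open>butlast xs \<in> _\<close>
    by (intro bar_chains_closed(2,5) sum_closed_free_Abelian_group[of _ _ "bar_cells G n", folded bar_chains_def])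
       (blast intro: iffD2[OF bar_chains_closed(6)])+
qed

lemma chain_map_in_bar_chains:
  assumes "f \<in> hom G H" "c \<in> carrier (bar_chains G n)"
  shows "chain_map f c \<in> carrier (bar_chains H n)"
  by (rule frag_extend_in_bar_chains[OF assms(2)])
     (use hom_carrier[OF assms(1)] in \<open>auto simp: bar_chains_closed bar_cells_def\<close>)

text \<open>
  Multiplying two adjacent entries of a cell commutes with applying a homomorphism to all entries.
\<close>

lemma chain_map_bar_boundary:
  assumes f: "f \<in> hom G H" and c: "c \<in> carrier (bar_chains G n)"
  shows "bar_boundary H (chain_map f c) = chain_map f (bar_boundary G c)"
  using c
proof (induction rule: bar_chains_induct)
  case (cell xs)
  then have sub: "set xs \<subseteq> carrier G" by (auto simp: bar_cells_def)
  have m: "f (xs ! (i - Suc 0) \<otimes>\<^bsub>G\<^esub> xs ! i) = f (xs ! (i - Suc 0)) \<otimes>\<^bsub>H\<^esub> f (xs ! i)"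
    if "i \<in> {Suc 0..<length xs}" for i
    using that by (intro hom_mult[OF f]) (auto intro!: subsetD[OF sub] nth_mem)
  have "chain_map f (\<Sum>i = 1..<length xs. frag_cmul ((-1) ^ i)
          (frag_of (take (i - 1) xs @ [xs ! (i - 1) \<otimes>\<^bsub>G\<^esub> xs ! i] @ drop (i + 1) xs)))
      = (\<Sum>i = 1..<length (map f xs). frag_cmul ((-1) ^ i)
          (frag_of (take (i - 1) (map f xs) @ [map f xs ! (i - 1) \<otimes>\<^bsub>H\<^esub> map f xs ! i] @ drop (i + 1) (map f xs))))"
    (is "chain_map f (sum ?t _) = sum ?t' _")
  proof -
    have "chain_map f (?t i) = ?t' i" if "i \<in> {1..<length xs}" for i
      using that m[of i] by (auto simp: frag_extend_cmul take_map drop_map)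
    then show ?thesis
      unfolding frag_extend_sum[OF finite_atLeastLessThan] length_map by (intro sum.cong) simp_all
  qed
  then show ?case
    by (simp only: bar_boundary_simps frag_extend_of bar_boundary_cell_def map_is_Nil_conv map_tl map_butlast
        frag_extend_add frag_extend_cmul length_map frag_extend_0 if_distrib[of "chain_map f"])
qed (simp_all add: frag_extend_diff)

lemma bar_boundaries_closed:
  "0 \<in> bar_boundaries G n"
  "c \<in> bar_boundaries G n \<Longrightarrow> d \<in> bar_boundaries G n \<Longrightarrow> c + d \<in> bar_boundaries G n"
  "c \<in> bar_boundaries G n \<Longrightarrow> d \<in> bar_boundaries G n \<Longrightarrow> c - d \<in> bar_boundaries G n"
  "c \<in> bar_boundaries G n \<Longrightarrow> - c \<in> bar_boundaries G n"
proof -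
  let ?C = "carrier (bar_chains G (Suc n))"
  have zero: "0 \<in> bar_boundaries G n"
    unfolding bar_boundaries_def using bar_chains_closed(1) by (intro image_eqI[where x=0]) simp_all
  have diff: "c - d \<in> bar_boundaries G n" if "c \<in> bar_boundaries G n" "d \<in> bar_boundaries G n" for c d
  proof -
    obtain c' d' where "c' \<in> ?C" "d' \<in> ?C" "c = bar_boundary G c'" "d = bar_boundary G d'"
      using \<open>c \<in> bar_boundaries G n\<close> \<open>d \<in> bar_boundaries G n\<close> unfolding bar_boundaries_def by blast
    then show ?thesis
      unfolding bar_boundaries_def by (intro image_eqI[where x="c' - d'"] bar_chains_closed) simp_all
  qed
  show "0 \<in> bar_boundaries G n" by (rule zero)
  show minus: "- c \<in> bar_boundaries G n" if "c \<in> bar_boundaries G n" for c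
    using diff[OF zero that] by simp
  show "c + d \<in> bar_boundaries G n" if "c \<in> bar_boundaries G n" "d \<in> bar_boundaries G n"
    using diff[OF that(1) minus[OF that(2)]] by simp
  show "c - d \<in> bar_boundaries G n" if "c \<in> bar_boundaries G n" "d \<in> bar_boundaries G n"
    using that by (rule diff)
qed

lemma bar_boundaries_in_bar_chains:
  "group G \<Longrightarrow> c \<in> bar_boundaries G n \<Longrightarrow> c \<in> carrier (bar_chains G n)"
  unfolding bar_boundaries_def by (elim imageE) (simp add: bar_boundary_in_bar_chains)

lemma chain_map_bar_boundaries:
  assumes "f \<in> hom G H" "b \<in> bar_boundaries G n"
  shows "chain_map f b \<in> bar_boundaries H n"
proof -
  obtain c where c: "c \<in> carrier (bar_chains G (Suc n))" "b = bar_boundary G c"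
    using assms(2) unfolding bar_boundaries_def by blast
  then have "chain_map f b = bar_boundary H (chain_map f c)"
    by (simp add: chain_map_bar_boundary[OF assms(1)])
  then show ?thesis
    unfolding bar_boundaries_def using chain_map_in_bar_chains[OF assms(1) c(1)] by (rule image_eqI)
qed

lemma bar_cycles_1: "bar_cycles G 1 = carrier (bar_chains G 1)"
proof -
  have "bar_boundary G c = 0" if "c \<in> carrier (bar_chains G 1)" for c
    using that by (induction rule: bar_chains_induct) (auto simp: bar_cells_1[unfolded One_nat_def] bar_boundary_cell_1)
  then show ?thesis by (auto simp: bar_cycles_def)
qed

text \<open>
  The coset of \<open>c\<close>.  It is defined for every chain, not only for cycles, so that the rules for
  cosets need no side conditions.
\<close>

definition hclass :: "('a, 'b) monoid_scheme \<Rightarrow> nat \<Rightarrow> ('a list \<Rightarrow>\<^sub>0 int) \<Rightarrow> ('a list \<Rightarrow>\<^sub>0 int) set" where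
  "hclass G n c = (\<lambda>b. b + c) ` bar_boundaries G n"

lemma mem_hclass_iff: "x \<in> hclass G n c \<longleftrightarrow> x - c \<in> bar_boundaries G n"
proof
  assume "x - c \<in> bar_boundaries G n"
  then show "x \<in> hclass G n c"
    unfolding hclass_def by (rule image_eqI[rotated]) simp
qed (auto simp: hclass_def)

lemma hclass_eq_iff: "hclass G n c = hclass G n d \<longleftrightarrow> c - d \<in> bar_boundaries G n"
proof
  assume "hclass G n c = hclass G n d"
  moreover have "c \<in> hclass G n c"
    by (simp add: mem_hclass_iff bar_boundaries_closed)
  ultimately show "c - d \<in> bar_boundaries G n" by (simp add: mem_hclass_iff)
next
  assume cd: "c - d \<in> bar_boundaries G n"
  have "x - c \<in> bar_boundaries G n \<longleftrightarrow> x - d \<in> bar_boundaries G n" for x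
    using bar_boundaries_closed(2)[of "x - c" G n "c - d"] bar_boundaries_closed(3)[of "x - d" G n "c - d"] cd
    by auto
  then show "hclass G n c = hclass G n d" by (simp add: set_eq_iff mem_hclass_iff)
qed

lemma carrier_group_homology: "carrier (group_homology n G) = hclass G n ` bar_cycles G n"
  by (auto simp: group_homology_def carrier_FactGroup hclass_def r_coset_def)

lemma mult_group_homology:
  "hclass G n c \<otimes>\<^bsub>group_homology n G\<^esub> hclass G n d = hclass G n (c + d)"
proof -
  have *: "hclass G n c \<otimes>\<^bsub>group_homology n G\<^esub> hclass G n d = {x + y |x y. x \<in> hclass G n c \<and> y \<in> hclass G n d}"
    by (auto simp: group_homology_def set_mult_def)
  show ?thesis
  proof (rule Set.set_eqI)
    fix z
    have "\<exists>x y. z = x + y \<and> x \<in> hclass G n c \<and> y \<in> hclass G n d"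
      if "z - (c + d) \<in> bar_boundaries G n"
      using that by (intro exI[of _ "z - d"] exI[of _ d])
        (simp add: mem_hclass_iff bar_boundaries_closed algebra_simps)
    moreover have "x + y - (c + d) \<in> bar_boundaries G n" if "x \<in> hclass G n c" "y \<in> hclass G n d" for x y
      using bar_boundaries_closed(2)[OF that[unfolded mem_hclass_iff]] by (simp add: algebra_simps)
    ultimately show "z \<in> hclass G n c \<otimes>\<^bsub>group_homology n G\<^esub> hclass G n d \<longleftrightarrow> z \<in> hclass G n (c + d)"
      unfolding * mem_hclass_iff[of z] by blast
  qed
qed

lemma hom_induced_homology_hclass:
  assumes f: "f \<in> hom G H"
  shows "hom_induced_homology n H f (hclass G n c) = hclass H n (chain_map f c)"
proof -
  have *: "hom_induced_homology n H f (hclass G n c)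
      = {b + chain_map f x |b x. b \<in> bar_boundaries H n \<and> x \<in> hclass G n c}"
    by (auto simp: hom_induced_homology_def set_mult_def)
  show ?thesis
  proof (rule Set.set_eqI)
    fix z
    have "\<exists>b x. z = b + chain_map f x \<and> b \<in> bar_boundaries H n \<and> x \<in> hclass G n c"
      if "z - chain_map f c \<in> bar_boundaries H n"
      using that by (intro exI[of _ "z - chain_map f c"] exI[of _ c])
        (simp add: mem_hclass_iff bar_boundaries_closed)
    moreover have "b + chain_map f x - chain_map f c \<in> bar_boundaries H n"
      if "b \<in> bar_boundaries H n" "x \<in> hclass G n c" for b x
      using bar_boundaries_closed(2)[OF that(1) chain_map_bar_boundaries[OF f that(2)[unfolded mem_hclass_iff]]]
      by (simp add: frag_extend_diff algebra_simps)
    ultimately show "z \<in> hom_induced_homology n H f (hclass G n c) \<longleftrightarrow> z \<in> hclass H n (chain_map f c)"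
      unfolding * mem_hclass_iff[of z] by blast
  qed
qed

lemma zero_in_bar_cycles: "0 \<in> bar_cycles G n"
  by (simp add: bar_cycles_def bar_chains_closed)

lemma HZ_mapD:
  assumes "HZ_map G H f"
  shows "group G" "group H" "f \<in> hom G H"
    and "inj_on (hom_induced_homology 1 H f) (carrier (group_homology 1 G))"
    and "hom_induced_homology 1 H f ` carrier (group_homology 1 G) = carrier (group_homology 1 H)"
    and "hom_induced_homology 2 H f ` carrier (group_homology 2 G) = carrier (group_homology 2 H)"
proof -
  have iso: "hom_induced_homology 1 H f \<in> iso (group_homology 1 G) (group_homology 1 H)"
    and epi: "hom_induced_homology 2 H f \<in> epi (group_homology 2 G) (group_homology 2 H)"
    using assms unfolding HZ_map_def by blast+
  show "group G" "group H" "f \<in> hom G H" using assms unfolding HZ_map_def by blast+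
  show "inj_on (hom_induced_homology 1 H f) (carrier (group_homology 1 G))"
    "hom_induced_homology 1 H f ` carrier (group_homology 1 G) = carrier (group_homology 1 H)"
    using iso unfolding iso_iff by (rule conjunct2[OF conjunct2], rule conjunct1[OF conjunct2])
  show "hom_induced_homology 2 H f ` carrier (group_homology 2 G) = carrier (group_homology 2 H)"
    using epi unfolding epi_def by blast
qed

text \<open>
  The following three lemmas are the form in which HZ-maps are used: statements about chains, without
  cosets.  All 1-chains are cycles, since \<open>d[g] = 0\<close>.
\<close>

lemma HZ_map_H1_inj:
  assumes "HZ_map G H f" "d \<in> carrier (bar_chains G 1)" "chain_map f d \<in> bar_boundaries H 1"
  shows "d \<in> bar_boundaries G 1"
proof -
  note f = HZ_mapD(3)[OF assms(1)]
  have "hclass G 1 d = hclass G 1 0"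
    using HZ_mapD(4)[OF assms(1)]
  proof (rule inj_onD)
    show "hom_induced_homology 1 H f (hclass G 1 d) = hom_induced_homology 1 H f (hclass G 1 0)"
      using assms(3) by (simp only: hom_induced_homology_hclass[OF f] hclass_eq_iff) simp
    show "hclass G 1 d \<in> carrier (group_homology 1 G)" "hclass G 1 0 \<in> carrier (group_homology 1 G)"
      unfolding carrier_group_homology bar_cycles_1
      using assms(2) bar_chains_closed(1) by (blast intro: imageI)+
  qed
  then show ?thesis by (simp only: hclass_eq_iff diff_zero)
qed

lemma HZ_map_H1_surj:
  assumes "HZ_map G H f" "c \<in> carrier (bar_chains H 1)"
  obtains d where "d \<in> carrier (bar_chains G 1)" "c - chain_map f d \<in> bar_boundaries H 1"
proof -
  note f = HZ_mapD(3)[OF assms(1)]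
  have "hclass H 1 c \<in> carrier (group_homology 1 H)"
    unfolding carrier_group_homology bar_cycles_1 using assms(2) by (rule imageI)
  then have "hclass H 1 c \<in> hom_induced_homology 1 H f ` (hclass G 1 ` carrier (bar_chains G 1))"
    by (simp only: HZ_mapD(5)[OF assms(1), symmetric] carrier_group_homology[of 1 G] bar_cycles_1)
  then obtain d where "d \<in> carrier (bar_chains G 1)"
    and "hclass H 1 c = hom_induced_homology 1 H f (hclass G 1 d)"
    by (elim imageE) blast
  then show thesis
    using that unfolding hom_induced_homology_hclass[OF f] hclass_eq_iff by blast
qed

lemma HZ_map_H2_surj:
  assumes "HZ_map G H f" "c \<in> bar_cycles H 2"
  obtains d where "d \<in> bar_cycles G 2" "c - chain_map f d \<in> bar_boundaries H 2"
proof -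
  note f = HZ_mapD(3)[OF assms(1)]
  have "hclass H 2 c \<in> carrier (group_homology 2 H)"
    unfolding carrier_group_homology using assms(2) by (rule imageI)
  then have "hclass H 2 c \<in> hom_induced_homology 2 H f ` (hclass G 2 ` bar_cycles G 2)"
    by (simp only: HZ_mapD(6)[OF assms(1), symmetric] carrier_group_homology[of 2 G])
  then obtain d where "d \<in> bar_cycles G 2"
    and "hclass H 2 c = hom_induced_homology 2 H f (hclass G 2 d)"
    by (elim imageE) blast
  then show thesis
    using that unfolding hom_induced_homology_hclass[OF f] hclass_eq_iff by blast
qed

lemma hom_induced_homology_hom:
  assumes f: "f \<in> hom G H"
  shows "hom_induced_homology n H f \<in> hom (group_homology n G) (group_homology n H)"
proof (rule homI)
  show "hom_induced_homology n H f x \<in> carrier (group_homology n H)"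
    if "x \<in> carrier (group_homology n G)" for x
    using that chain_map_in_bar_chains[OF f] chain_map_bar_boundary[OF f]
    by (auto simp: carrier_group_homology hom_induced_homology_hclass[OF f] bar_cycles_def)
qed (auto simp: carrier_group_homology hom_induced_homology_hclass[OF f] mult_group_homology frag_extend_add)

lemma HZ_mapI:
  assumes "group G" "group H" and f: "f \<in> hom G H"
    and inj1: "\<And>d. d \<in> carrier (bar_chains G 1) \<Longrightarrow> chain_map f d \<in> bar_boundaries H 1 \<Longrightarrow> d \<in> bar_boundaries G 1"
    and surj1: "\<And>c. c \<in> carrier (bar_chains H 1) \<Longrightarrow>
      \<exists>d\<in>carrier (bar_chains G 1). c - chain_map f d \<in> bar_boundaries H 1"
    and surj2: "\<And>c. c \<in> bar_cycles H 2 \<Longrightarrow> \<exists>d\<in>bar_cycles G 2. c - chain_map f d \<in> bar_boundaries H 2"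
  shows "HZ_map G H f"
proof -
  have surj: "carrier (group_homology n H) \<subseteq> hom_induced_homology n H f ` carrier (group_homology n G)"
    if *: "\<And>c. c \<in> bar_cycles H n \<Longrightarrow> \<exists>d\<in>bar_cycles G n. c - chain_map f d \<in> bar_boundaries H n" for n
  proof
    fix x assume "x \<in> carrier (group_homology n H)"
    then obtain c where c: "c \<in> bar_cycles H n" "x = hclass H n c"
      unfolding carrier_group_homology by blast
    then obtain d where "d \<in> bar_cycles G n" "c - chain_map f d \<in> bar_boundaries H n"
      using * by blast
    then show "x \<in> hom_induced_homology n H f ` carrier (group_homology n G)"
      unfolding carrier_group_homology image_image hom_induced_homology_hclass[OF f]
      using c(2) hclass_eq_iff by (intro image_eqI[where x=d]) blast+
  qed
  have "inj_on (hom_induced_homology 1 H f) (carrier (group_homology 1 G))"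
  proof (rule inj_onI)
    fix x y assume "x \<in> carrier (group_homology 1 G)" "y \<in> carrier (group_homology 1 G)"
      and eq: "hom_induced_homology 1 H f x = hom_induced_homology 1 H f y"
    then obtain c d where cd: "c \<in> carrier (bar_chains G 1)" "d \<in> carrier (bar_chains G 1)"
      and xy: "x = hclass G 1 c" "y = hclass G 1 d"
      unfolding carrier_group_homology bar_cycles_1 by blast
    have "chain_map f (c - d) \<in> bar_boundaries H 1"
      using eq by (simp only: xy hom_induced_homology_hclass[OF f] hclass_eq_iff frag_extend_diff)
    then show "x = y"
      unfolding xy hclass_eq_iff using inj1 cd bar_chains_closed(3) by blast
  qed
  moreover have "hom_induced_homology 1 H f ` carrier (group_homology 1 G) = carrier (group_homology 1 H)"
    using surj[of 1] surj1 hom_induced_homology_hom[OF f, of 1] unfolding bar_cycles_1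
    by (intro equalityI) (blast dest: hom_carrier)+
  ultimately have "hom_induced_homology 1 H f \<in> iso (group_homology 1 G) (group_homology 1 H)"
    unfolding iso_iff using hom_induced_homology_hom[OF f, of 1] by blast
  moreover have "hom_induced_homology 2 H f \<in> epi (group_homology 2 G) (group_homology 2 H)"
    unfolding epi_iff_subset using surj[OF surj2] hom_induced_homology_hom[OF f, of 2] by blast
  ultimately show ?thesis unfolding HZ_map_def using assms(1-3) by blast
qed

section \<open>Extending solutions of cocycle equations along an HZ-map\<close>

text \<open>
  Extend a basis of \<open>S\<close> by \<open>v\<close> and prescribe the values on the larger independent set.
\<close>

lemma separating_functional:
  fixes scale :: "rat \<Rightarrow> 'v::ab_group_add \<Rightarrow> 'v"
  assumes vs: "vector_space scale"
    and S: "0 \<in> S" "\<And>x y. x \<in> S \<Longrightarrow> y \<in> S \<Longrightarrow> x + y \<in> S" "\<And>c x. x \<in> S \<Longrightarrow> scale c x \<in> S"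
    and v: "v \<notin> S"
  obtains \<phi> :: "'v \<Rightarrow> rat"
  where "\<And>x y. \<phi> (x + y) = \<phi> x + \<phi> y" "\<And>c x. \<phi> (scale c x) = c * \<phi> x"
    "\<And>x. x \<in> S \<Longrightarrow> \<phi> x = 0" "\<phi> v = 1"
proof -
  interpret V: vector_space scale by (fact vs)
  interpret Q: vector_space "(*) :: rat \<Rightarrow> rat \<Rightarrow> rat"
    by unfold_locales (simp_all add: algebra_simps)
  interpret P: vector_space_pair scale "(*) :: rat \<Rightarrow> rat \<Rightarrow> rat" ..
  obtain B where B: "B \<subseteq> S" "V.independent B" "S \<subseteq> V.span B"
    using V.maximal_independent_subset by blast
  have span: "V.span B = S"
    using B(1,3) V.span_minimal[OF B(1) V.subspaceI[OF S]] by blast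
  then have "V.independent (insert v B)" "v \<notin> B"
    using V.independent_insertI[OF _ B(2)] v B(1) by auto
  then obtain \<phi> where lin: "Vector_Spaces.linear scale (*) \<phi>" and \<phi>: "\<And>x. x \<in> insert v B \<Longrightarrow> \<phi> x = (if x = v then 1 else 0)"
    using P.linear_independent_extend[of "insert v B" "\<lambda>x. if x = v then 1 else 0"] by blast
  interpret L: Vector_Spaces.linear scale "(*)" \<phi> by (fact lin)
  have "\<phi> x = 0" if "x \<in> S" for x
  proof (rule P.linear_eq_0_on_span[OF lin])
    show "x \<in> V.span B" using that span by simp
    show "\<phi> b = 0" if "b \<in> B" for b using that \<phi>[of b] \<open>v \<notin> B\<close> by auto
  qed
  then show thesis using \<phi>[of v] by (intro that[of \<phi>]) (simp_all add: L.add L.scale)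
qed

definition cochain_eval :: "('b \<Rightarrow> rat) \<Rightarrow> ('b \<Rightarrow>\<^sub>0 int) \<Rightarrow> rat" where
  "cochain_eval w c = (\<Sum>x\<in>Poly_Mapping.keys c. of_int (Poly_Mapping.lookup c x) * w x)"

lemma cochain_eval_superset:
  assumes "finite A" "Poly_Mapping.keys c \<subseteq> A"
  shows "cochain_eval w c = (\<Sum>x\<in>A. of_int (Poly_Mapping.lookup c x) * w x)"
  unfolding cochain_eval_def using assms by (intro sum.mono_neutral_left) (auto simp: in_keys_iff)

lemma cochain_eval_simps [simp]:
  "cochain_eval w 0 = 0"
  "cochain_eval w (frag_of x) = w x"
  "cochain_eval w (c + d) = cochain_eval w c + cochain_eval w d"
  "cochain_eval w (c - d) = cochain_eval w c - cochain_eval w d"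
  "cochain_eval w (frag_cmul k c) = of_int k * cochain_eval w c"
proof -
  show "cochain_eval w 0 = 0" "cochain_eval w (frag_of x) = w x"
    by (simp_all add: cochain_eval_def)
  let ?A = "Poly_Mapping.keys c \<union> Poly_Mapping.keys d"
  have "Poly_Mapping.keys (c + d) \<subseteq> ?A" "Poly_Mapping.keys (c - d) \<subseteq> ?A"
    by (rule keys_add keys_diff)+
  then show "cochain_eval w (c + d) = cochain_eval w c + cochain_eval w d"
    "cochain_eval w (c - d) = cochain_eval w c - cochain_eval w d"
    by (simp_all add: cochain_eval_superset[of ?A] lookup_add lookup_minus algebra_simps sum.distrib sum_subtractf)
  show "cochain_eval w (frag_cmul k c) = of_int k * cochain_eval w c"
    by (subst cochain_eval_superset[of "Poly_Mapping.keys c"])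
       (simp_all add: keys_cmul cochain_eval_def sum_distrib_left mult.assoc)
qed

text \<open>
  The unknown \<open>s\<close> is subject to the linear equations \<open>s(g h) - s(g) - s(h) = z(g, h)\<close> and
  \<open>s(f x) = s\<^sub>0(x)\<close>, and over \<open>\<rat>\<close> a linear system is solvable as soon as each linear relation between
  the left-hand sides also holds between the right-hand sides.  After clearing denominators, such a
  relation consists of a 2-chain \<open>c\<close> of \<open>H\<close> and a 1-chain \<open>d\<close> of \<open>G\<close> with \<open>f\<^sub># d = \<partial> c\<close>, and
  \<open>s\<^sub>0(d) + z(c) = 0\<close> is needed.  Injectivity on \<open>H\<^sub>1\<close> gives \<open>d = \<partial> e\<close>, and surjectivity on \<open>H\<^sub>2\<close>, applied
  to the cycle \<open>c - f\<^sub># e\<close>, allows to choose \<open>e\<close> such that \<open>c\<close> and \<open>f\<^sub># e\<close> differ by a boundary.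
  Since \<open>z\<close> is a cocycle, \<open>z(c) = z(f\<^sub># e)\<close>, which is \<open>- s\<^sub>0(\<partial> e) = - s\<^sub>0(d)\<close> because \<open>s\<^sub>0\<close> splits the
  pullback of \<open>z\<close> to \<open>G\<close>.
\<close>

lemma HZ_map_extends_cocycle_splitting:
  fixes z :: "'c \<Rightarrow> 'c \<Rightarrow> rat" and s\<^sub>0 :: "'a \<Rightarrow> rat"
  assumes HZ: "HZ_map G H f"
    and cocycle: "\<And>g h k. g \<in> carrier H \<Longrightarrow> h \<in> carrier H \<Longrightarrow> k \<in> carrier H \<Longrightarrow>
      z h k + z g (h \<otimes>\<^bsub>H\<^esub> k) = z (g \<otimes>\<^bsub>H\<^esub> h) k + z g h"
    and s\<^sub>0: "\<And>x y. x \<in> carrier G \<Longrightarrow> y \<in> carrier G \<Longrightarrow> s\<^sub>0 (x \<otimes>\<^bsub>G\<^esub> y) = s\<^sub>0 x + s\<^sub>0 y + z (f x) (f y)"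
  obtains s where "\<And>g h. g \<in> carrier H \<Longrightarrow> h \<in> carrier H \<Longrightarrow> s (g \<otimes>\<^bsub>H\<^esub> h) = s g + s h + z g h"
    and "\<And>x. x \<in> carrier G \<Longrightarrow> s (f x) = s\<^sub>0 x"
proof -
  note f = HZ_mapD(3)[OF HZ]
  interpret G: group G by (rule HZ_mapD(1)[OF HZ])
  interpret H: group H by (rule HZ_mapD(2)[OF HZ])
  define z' where "z' = cochain_eval (\<lambda>xs. z (xs ! 0) (xs ! 1))"
  define s' where "s' = cochain_eval (\<lambda>xs. s\<^sub>0 (xs ! 0))"
  note ev = z'_def s'_def
  have z'_boundary: "z' b = 0" if "b \<in> bar_boundaries H 2" for b
  proof -
    have "z' (bar_boundary H c) = 0" if "c \<in> carrier (bar_chains H 3)" for c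
      using that
    proof (induction rule: bar_chains_induct)
      case (cell xs)
      then obtain g h k where "xs = [g, h, k]" "g \<in> carrier H" "h \<in> carrier H" "k \<in> carrier H"
        unfolding bar_cells_3 by blast
      then show ?case using cocycle[of g h k] by (simp add: ev bar_boundary_cell_3)
    qed (simp_all add: ev)
    moreover have "Suc 2 = 3" by simp
    ultimately show ?thesis using that unfolding bar_boundaries_def by auto
  qed
  have z'_f: "z' (chain_map f c) = - s' (bar_boundary G c)" if "c \<in> carrier (bar_chains G 2)" for c
    using that
  proof (induction rule: bar_chains_induct)
    case (cell xs)
    then obtain x y where "xs = [x, y]" "x \<in> carrier G" "y \<in> carrier G"
      unfolding bar_cells_2 by blast
    then show ?case using s\<^sub>0[of x y] by (simp add: ev bar_boundary_cell_2)
  qed (simp_all add: ev frag_extend_diff)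
  have Suc1: "Suc 1 = 2" by simp
  have consistent: "s' d + z' c = 0"
    if d: "d \<in> carrier (bar_chains G 1)" and c: "c \<in> carrier (bar_chains H 2)"
      and eq: "chain_map f d = bar_boundary H c" for c d
  proof -
    have "chain_map f d \<in> bar_boundaries H 1"
      unfolding bar_boundaries_def eq Suc1 using c by (rule imageI)
    then have "d \<in> bar_boundaries G 1" by (rule HZ_map_H1_inj[OF HZ d])
    then obtain e where e: "e \<in> carrier (bar_chains G 2)" "d = bar_boundary G e"
      unfolding bar_boundaries_def Suc1 by blast
    have "c - chain_map f e \<in> bar_cycles H 2"
      using c e eq chain_map_in_bar_chains[OF f e(1)]
      by (simp add: bar_cycles_def bar_chains_closed chain_map_bar_boundary[OF f e(1)])
    then obtain e' where e': "e' \<in> bar_cycles G 2" "c - chain_map f e - chain_map f e' \<in> bar_boundaries H 2"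
      using HZ_map_H2_surj[OF HZ] by blast
    have "z' c = z' (chain_map f e) + z' (chain_map f e')"
      using z'_boundary[OF e'(2)] by (simp add: ev)
    also have "\<dots> = - s' d"
      using z'_f[OF e(1)] z'_f[of e'] e'(1) e(2) by (simp add: bar_cycles_def ev)
    finally show ?thesis by simp
  qed
  \<comment> \<open>A vector has a coordinate for each unknown \<open>s y\<close> and, at \<open>None\<close>, one for the right-hand side.\<close>
  define vec :: "('c list \<Rightarrow>\<^sub>0 int) \<Rightarrow> rat \<Rightarrow> 'c option \<Rightarrow> rat" where
    "vec e q = (\<lambda>x. case x of None \<Rightarrow> q | Some y \<Rightarrow> of_int (Poly_Mapping.lookup e [y]))" for e q
  define scale :: "rat \<Rightarrow> ('c option \<Rightarrow> rat) \<Rightarrow> 'c option \<Rightarrow> rat" where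
    "scale r v = (\<lambda>x. r * v x)" for r v
  interpret V: vector_space scale
    by unfold_locales (simp_all add: scale_def fun_eq_iff algebra_simps)
  have vec_simps: "vec (e + e') (q + q') = vec e q + vec e' q'" "vec (e - e') (q - q') = vec e q - vec e' q'"
    "vec (frag_cmul k e) (of_int k * q) = scale (of_int k) (vec e q)" "vec 0 0 = 0" for e e' q q' k
    by (auto simp: vec_def scale_def fun_eq_iff lookup_add lookup_minus split: option.splits)
  define rel where "rel c d = vec (chain_map f d - bar_boundary H c) (s' d + z' c)" for c d
  have cmul_diff: "frag_cmul k (a - b) = frag_cmul k a - frag_cmul k b" for k and a b :: "'c list \<Rightarrow>\<^sub>0 int"
    by (rule poly_mapping_eqI) (simp add: lookup_minus algebra_simps)
  have rel_simps: "rel (c + c') (d + d') = rel c d + rel c' d'" "rel 0 0 = 0"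
    "rel (frag_cmul k c) (frag_cmul k d) = scale (of_int k) (rel c d)" for c c' d d' k
    unfolding rel_def by (simp_all add: ev vec_simps flip: vec_simps(1) vec_simps(3))
       (simp_all add: frag_extend_add frag_extend_cmul algebra_simps cmul_diff)
  \<comment> \<open>The relations with integral coefficients; \<open>S\<close> is their rational span.\<close>
  define T where "T = {rel c d |c d. c \<in> carrier (bar_chains H 2) \<and> d \<in> carrier (bar_chains G 1)}"
  define S where "S = {v. \<exists>N::int. N > 0 \<and> scale (of_int N) v \<in> T}"
  have T_add: "v + w \<in> T" if "v \<in> T" "w \<in> T" for v w
  proof -
    obtain c d where "v = rel c d" "c \<in> carrier (bar_chains H 2)" "d \<in> carrier (bar_chains G 1)"
      using \<open>v \<in> T\<close> unfolding T_def by blast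
    moreover obtain c' d' where "w = rel c' d'" "c' \<in> carrier (bar_chains H 2)" "d' \<in> carrier (bar_chains G 1)"
      using \<open>w \<in> T\<close> unfolding T_def by blast
    ultimately show ?thesis
      unfolding T_def by (intro CollectI exI[of _ "c + c'"] exI[of _ "d + d'"])
        (simp add: rel_simps bar_chains_closed del: One_nat_def)
  qed
  have T_scale: "scale (of_int k) v \<in> T" if "v \<in> T" for v k
  proof -
    obtain c d where "v = rel c d" "c \<in> carrier (bar_chains H 2)" "d \<in> carrier (bar_chains G 1)"
      using \<open>v \<in> T\<close> unfolding T_def by blast
    then show ?thesis
      unfolding T_def by (intro CollectI exI[of _ "frag_cmul k c"] exI[of _ "frag_cmul k d"])
        (simp add: rel_simps bar_chains_closed del: One_nat_def)
  qed
  have T_S: "v \<in> S" if "v \<in> T" for v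
    unfolding S_def using that by (intro CollectI exI[of _ 1]) simp
  have S_zero: "0 \<in> S"
  proof -
    have "rel 0 0 \<in> T"
      unfolding T_def by (intro CollectI exI[of _ 0] conjI refl bar_chains_closed(1))
    then show ?thesis
      using T_S by (simp add: rel_simps)
  qed
  have S_add: "v + w \<in> S" if "v \<in> S" "w \<in> S" for v w
  proof -
    from that obtain N M where "N > 0" "M > 0" and NM: "scale (of_int N) v \<in> T" "scale (of_int M) w \<in> T"
      unfolding S_def by blast
    have "scale (of_int M) (scale (of_int N) v) + scale (of_int N) (scale (of_int M) w) \<in> T"
      by (rule T_add[OF T_scale[OF NM(1)] T_scale[OF NM(2)]])
    also have "scale (of_int M) (scale (of_int N) v) + scale (of_int N) (scale (of_int M) w)
        = scale (of_int (M * N)) (v + w)"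
      by (simp add: V.scale_right_distrib mult.commute)
    finally show ?thesis
      unfolding S_def using \<open>N > 0\<close> \<open>M > 0\<close> by (intro CollectI exI[of _ "M * N"]) simp
  qed
  have S_scale: "scale r v \<in> S" if "v \<in> S" for r v
  proof -
    from that obtain N where N: "N > 0" "scale (of_int N) v \<in> T" unfolding S_def by blast
    obtain a b where r: "r = of_int a / of_int b" and b: "b > 0"
      using quotient_of_div[of r] quotient_of_denom_pos[of r] by (metis prod.exhaust_sel)
    have "scale (of_int (N * b)) (scale r v) = scale (of_int a) (scale (of_int N) v)"
      using b by (simp add: r)
    then have "scale (of_int (N * b)) (scale r v) \<in> T"
      using T_scale[OF N(2), of a] by (simp only:)
    moreover have "N * b > 0" using N(1) b by simp
    ultimately show ?thesis unfolding S_def by blast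
  qed
  \<comment> \<open>The equation \<open>0 = 1\<close> is not a consequence of the system, so some functional kills \<open>S\<close> but not this vector.\<close>
  have "vec 0 1 \<notin> S"
  proof
    assume "vec 0 1 \<in> S"
    then obtain N c d where N: "N > 0" and eq: "scale (of_int N) (vec 0 1) = rel c d"
      and c: "c \<in> carrier (bar_chains H 2)" and d: "d \<in> carrier (bar_chains G 1)"
      unfolding S_def T_def by blast
    let ?e = "chain_map f d - bar_boundary H c"
    have e_in: "?e \<in> carrier (bar_chains H 1)"
      using chain_map_in_bar_chains[OF f d] bar_boundary_in_bar_chains[OF H.is_group, of c 1] c
      unfolding Suc1 by (intro bar_chains_closed)
    have "Poly_Mapping.lookup ?e [y] = 0" for y
      using fun_cong[OF eq, of "Some y"] by (simp add: rel_def vec_def scale_def)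
    moreover have "Poly_Mapping.keys ?e \<subseteq> {[y] |y. y \<in> carrier H}"
      using e_in unfolding carrier_bar_chains bar_cells_1 by blast
    ultimately have "Poly_Mapping.keys ?e = {}"
      unfolding in_keys_iff[of _ ?e, symmetric] not_in_keys_iff_lookup_eq_zero[symmetric] by blast
    then have "chain_map f d = bar_boundary H c" by simp
    then have "s' d + z' c = 0" by (rule consistent[OF d c])
    then show False
      using fun_cong[OF eq, of None] N by (simp add: rel_def vec_def scale_def)
  qed
  then obtain \<phi> where \<phi>: "\<And>v w. \<phi> (v + w) = \<phi> v + \<phi> w" "\<And>r v. \<phi> (scale r v) = r * \<phi> v"
      "\<And>v. v \<in> S \<Longrightarrow> \<phi> v = 0" "\<phi> (vec 0 1) = 1"
    using separating_functional[OF V.vector_space_axioms S_zero S_add S_scale] by blast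
  have \<phi>_vec: "\<phi> (vec (e - e') q) = \<phi> (vec e 0) - \<phi> (vec e' 0) + q" for e e' q
  proof -
    have "vec (e - e') q + vec e' 0 = vec e 0 + scale q (vec 0 1)"
      by (auto simp: vec_def scale_def fun_eq_iff lookup_minus split: option.splits)
    then have "\<phi> (vec (e - e') q) + \<phi> (vec e' 0) = \<phi> (vec e 0) + q * \<phi> (vec 0 1)"
      unfolding \<phi>(1,2)[symmetric] by simp
    then show ?thesis using \<phi>(4) by simp
  qed
  have \<phi>_zero: "\<phi> (vec 0 0) = 0" using \<phi>(1)[of "vec 0 0" "vec 0 0"] by (simp add: vec_simps)
  have rel0: "\<phi> (rel c d) = 0" if "c \<in> carrier (bar_chains H 2)" "d \<in> carrier (bar_chains G 1)" for c d
    using that by (intro \<phi>(3) T_S) (auto simp: T_def simp del: One_nat_def)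
  define s where "s y = - \<phi> (vec (frag_of [y]) 0)" for y
  show thesis
  proof (rule that[of s])
    fix g h assume gh: "g \<in> carrier H" "h \<in> carrier H"
    have "\<phi> (rel (frag_of [g, h]) 0) = 0"
      using gh by (intro rel0 bar_chains_closed(1)) (simp add: bar_chains_closed bar_cells_def)
    moreover have "rel (frag_of [g, h]) 0
        = vec (frag_of [g \<otimes>\<^bsub>H\<^esub> h] - frag_of [g] - frag_of [h]) (z g h)"
      by (simp add: rel_def ev bar_boundary_cell_2 algebra_simps)
    moreover have "\<phi> (vec (frag_of [g \<otimes>\<^bsub>H\<^esub> h] - frag_of [g] - frag_of [h]) (z g h))
        = \<phi> (vec (frag_of [g \<otimes>\<^bsub>H\<^esub> h]) 0) - \<phi> (vec (frag_of [g]) 0) - \<phi> (vec (frag_of [h]) 0) + z g h"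
      by (subst \<phi>_vec, subst \<phi>_vec) simp
    ultimately show "s (g \<otimes>\<^bsub>H\<^esub> h) = s g + s h + z g h"
      by (simp add: s_def)
  next
    fix x assume "x \<in> carrier G"
    then have "\<phi> (rel 0 (frag_of [x])) = 0"
      by (intro rel0 bar_chains_closed(1)) (simp add: bar_chains_closed bar_cells_def)
    moreover have "rel 0 (frag_of [x]) = vec (frag_of [f x] - 0) (s\<^sub>0 x)"
      by (simp add: rel_def ev)
    ultimately show "s (f x) = s\<^sub>0 x"
      using \<phi>_vec[of "frag_of [f x]" 0 "s\<^sub>0 x"] \<phi>_zero by (simp add: s_def)
  qed
qed

unbundle fps_syntax

lemma fps_exp_mult_nth_lowest:
  fixes d :: "rat fps"
  assumes "\<And>i. i < n \<Longrightarrow> d $ i = 0"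
  shows "(fps_exp c * d) $ n = d $ n"
proof -
  have "(fps_exp c * d) $ n = (\<Sum>i=0..n. fps_exp c $ i * d $ (n - i))" by (rule fps_mult_nth)
  also have "\<dots> = (\<Sum>i\<in>{0}. fps_exp c $ i * d $ (n - i))"
    using assms by (intro sum.mono_neutral_right) auto
  finally show ?thesis by simp
qed

text \<open>
  A crossed homomorphism with values in power series on which \<open>g\<close> acts by multiplication by
  \<open>e\<^bsup>\<chi>(g) u\<^esup>\<close>.  This action is unipotent, so the coefficient of \<open>u\<^sup>n\<close> in the defining equation is a
  cocycle equation for the \<open>n\<close>-th coefficient of \<open>p\<close>, with a cocycle depending only on the lower
  coefficients.
\<close>

lemma HZ_map_extends_crossed_hom:
  fixes e :: "'a \<Rightarrow> rat fps"
  assumes HZ: "HZ_map G E f"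
    and \<chi>: "\<And>g h. g \<in> carrier E \<Longrightarrow> h \<in> carrier E \<Longrightarrow> \<chi> (g \<otimes>\<^bsub>E\<^esub> h) = \<chi> g + \<chi> h"
    and e: "\<And>x y. x \<in> carrier G \<Longrightarrow> y \<in> carrier G \<Longrightarrow> e (x \<otimes>\<^bsub>G\<^esub> y) = e x + fps_exp (\<chi> (f x)) * e y"
  obtains p :: "'c \<Rightarrow> rat fps" where
    "\<And>g h. g \<in> carrier E \<Longrightarrow> h \<in> carrier E \<Longrightarrow> p (g \<otimes>\<^bsub>E\<^esub> h) = p g + fps_exp (\<chi> g) * p h"
    "\<And>x. x \<in> carrier G \<Longrightarrow> p (f x) = e x"
proof -
  note f = HZ_mapD(3)[OF HZ]
  interpret E: group E by (rule HZ_mapD(2)[OF HZ])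
  have fc: "f x \<in> carrier E" if "x \<in> carrier G" for x using hom_in_carrier[OF f that] .
  \<comment> \<open>The defect of the crossed homomorphism property.\<close>
  define \<delta> where "\<delta> P g h = P g + fps_exp (\<chi> g) * P h - P (g \<otimes>\<^bsub>E\<^esub> h)" for P :: "'c \<Rightarrow> rat fps" and g h
  define good where "good n P \<longleftrightarrow>
      (\<forall>g\<in>carrier E. \<forall>h\<in>carrier E. \<forall>i<n. \<delta> P g h $ i = 0) \<and>
      (\<forall>x\<in>carrier G. \<forall>i<n. (e x - P (f x)) $ i = 0)" for n P
  have step: "\<exists>P'. good (Suc n) P' \<and> (\<forall>g. \<forall>i<n. P' g $ i = P g $ i)" if P: "good n P" for n P
  proof -
    have \<delta>_low: "\<delta> P g h $ i = 0" if "g \<in> carrier E" "h \<in> carrier E" "i < n" for g h i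
      using P that by (simp add: good_def)
    define r where "r x = e x - P (f x)" for x
    have r_low: "r x $ i = 0" if "x \<in> carrier G" "i < n" for x i
      using P that by (simp add: good_def r_def)
    obtain s where s: "\<And>g h. g \<in> carrier E \<Longrightarrow> h \<in> carrier E \<Longrightarrow> s (g \<otimes>\<^bsub>E\<^esub> h) = s g + s h + \<delta> P g h $ n"
      and s_f: "\<And>x. x \<in> carrier G \<Longrightarrow> s (f x) = r x $ n"
    proof (rule HZ_map_extends_cocycle_splitting[OF HZ, of "\<lambda>g h. \<delta> P g h $ n" "\<lambda>x. r x $ n"])
      fix g h k assume g: "g \<in> carrier E" and h: "h \<in> carrier E" and k: "k \<in> carrier E"
      have "fps_exp (\<chi> g) * \<delta> P h k + \<delta> P g (h \<otimes>\<^bsub>E\<^esub> k) = \<delta> P (g \<otimes>\<^bsub>E\<^esub> h) k + \<delta> P g h"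
        using g h k by (simp add: \<delta>_def E.m_assoc \<chi> fps_exp_add_mult algebra_simps)
      then have "(fps_exp (\<chi> g) * \<delta> P h k) $ n + \<delta> P g (h \<otimes>\<^bsub>E\<^esub> k) $ n = \<delta> P (g \<otimes>\<^bsub>E\<^esub> h) k $ n + \<delta> P g h $ n"
        by (metis fps_add_nth)
      then show "\<delta> P h k $ n + \<delta> P g (h \<otimes>\<^bsub>E\<^esub> k) $ n = \<delta> P (g \<otimes>\<^bsub>E\<^esub> h) k $ n + \<delta> P g h $ n"
        using fps_exp_mult_nth_lowest[of n "\<delta> P h k"] \<delta>_low h k by simp
    next
      fix x y assume x: "x \<in> carrier G" and y: "y \<in> carrier G"
      have "r (x \<otimes>\<^bsub>G\<^esub> y) = r x + fps_exp (\<chi> (f x)) * r y + \<delta> P (f x) (f y)"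
        using x y by (simp add: r_def \<delta>_def e hom_mult[OF f x y] algebra_simps)
      then show "r (x \<otimes>\<^bsub>G\<^esub> y) $ n = r x $ n + r y $ n + \<delta> P (f x) (f y) $ n"
        using fps_exp_mult_nth_lowest[of n "r y"] r_low y by simp
    qed blast
    \<comment> \<open>Solving the cocycle equation for the \<open>n\<close>-th coefficient corrects it without touching the lower ones.\<close>
    define P' where "P' g = P g + fps_const (s g) * fps_X ^ n" for g
    have P'_nth: "P' g $ i = P g $ i + (if i = n then s g else 0)" for g i
      by (simp add: P'_def)
    have "\<delta> P' g h $ i = 0" if gh: "g \<in> carrier E" "h \<in> carrier E" and i: "i < Suc n" for g h i
    proof -
      have "\<delta> P' g h = \<delta> P g h + (fps_const (s g) * fps_X ^ n + (fps_exp (\<chi> g) * fps_const (s h)) * fps_X ^ n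
          - fps_const (s (g \<otimes>\<^bsub>E\<^esub> h)) * fps_X ^ n)"
        by (simp add: \<delta>_def P'_def algebra_simps)
      then have "\<delta> P' g h $ i = \<delta> P g h $ i + (if i = n then s g + s h - s (g \<otimes>\<^bsub>E\<^esub> h) else 0)"
        using i by (auto simp: fps_X_power_mult_right_nth)
      then show ?thesis using \<delta>_low[OF gh, of i] s[OF gh] i by (auto simp: less_Suc_eq)
    qed
    moreover have "(e x - P' (f x)) $ i = 0" if "x \<in> carrier G" "i < Suc n" for x i
      using r_low[OF that(1), of i] s_f[OF that(1)] that(2) by (auto simp: r_def P'_nth less_Suc_eq)
    ultimately have "good (Suc n) P'" unfolding good_def by blast
    then show ?thesis using P'_nth by (intro exI[of _ P']) auto
  qed
  have "\<exists>F. \<forall>n. good n (F n) \<and> (\<forall>g. \<forall>i<n. F (Suc n) g $ i = F n g $ i)"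
    by (rule dependent_nat_choice) (use step in \<open>auto simp: good_def\<close>)
  then obtain F where F: "\<And>n. good n (F n)" "\<And>n g i. i < n \<Longrightarrow> F (Suc n) g $ i = F n g $ i" by blast
  define p where "p g = Abs_fps (\<lambda>n. F (Suc n) g $ n)" for g
  have p_nth: "p g $ i = F m g $ i" if "i < m" for g i m
    using that
  proof (induction m)
    case (Suc m)
    then show ?case using F(2)[of i m g] by (cases "i = m") (auto simp: p_def)
  qed simp
  show thesis
  proof (rule that[of p])
    fix g h assume gh: "g \<in> carrier E" "h \<in> carrier E"
    have "\<delta> p g h $ i = \<delta> (F (Suc i)) g h $ i" for i
      by (simp add: \<delta>_def fps_mult_nth p_nth[of _ "Suc i"])
    then have "\<delta> p g h $ i = 0" for i using F(1)[of "Suc i"] gh by (simp add: good_def)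
    then have "\<delta> p g h = 0" by (simp add: fps_eq_iff)
    then show "p (g \<otimes>\<^bsub>E\<^esub> h) = p g + fps_exp (\<chi> g) * p h" by (simp add: \<delta>_def)
  next
    fix x assume "x \<in> carrier G"
    then have "(e x - F (Suc i) (f x)) $ i = 0" for i using F(1)[of "Suc i"] by (simp add: good_def)
    then show "p (f x) = e x" by (simp add: fps_eq_iff p_def)
  qed
qed

section \<open>The free group of rank two\<close>

type_synonym word = "(bool \<times> bool) list"

text \<open>
  A letter is a pair of a generator (one of the two truth values) and an exponent (\<open>True\<close> for
  \<open>1\<close>, \<open>False\<close> for \<open>-1\<close>).  The free group is the quotient of the words by this relation; no
  reduced words are involved, as the universal property only needs that evaluation respects
  cancellation.
\<close>

inductive word_eq :: "word \<Rightarrow> word \<Rightarrow> bool" where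
  word_eq_refl: "word_eq w w"
| word_eq_sym: "word_eq u v \<Longrightarrow> word_eq v u"
| word_eq_trans: "word_eq u v \<Longrightarrow> word_eq v w \<Longrightarrow> word_eq u w"
| cancel: "word_eq (u @ (l, s) # (l, \<not> s) # v) (u @ v)"

lemma word_eq_append:
  assumes "word_eq u u'" "word_eq v v'"
  shows "word_eq (u @ v) (u' @ v')"
proof -
  have "word_eq (u @ w) (u' @ w)" for w
    using assms(1)
  proof induction
    case (cancel u l s v)
    then show ?case using word_eq.cancel[of u l s "v @ w"] by simp
  qed (blast intro: word_eq.intros)+
  moreover have "word_eq (w @ v) (w @ v')" for w
    using assms(2)
  proof induction
    case (cancel u l s v)
    then show ?case using word_eq.cancel[of "w @ u" l s v] by simp
  qed (blast intro: word_eq.intros)+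
  ultimately show ?thesis by (blast intro: word_eq_trans)
qed

definition word_inv :: "word \<Rightarrow> word" where
  "word_inv w = rev (map (\<lambda>(l, s). (l, \<not> s)) w)"

lemma word_inv_cancel: "word_eq (word_inv w @ w) []"
proof (induction w)
  case Nil
  then show ?case by (simp add: word_inv_def word_eq_refl)
next
  case (Cons x w)
  obtain l s where x: "x = (l, s)" by (cases x)
  have "word_eq (word_inv (x # w) @ x # w) (word_inv w @ w)"
    using word_eq.cancel[of "word_inv w" l "\<not> s" w] by (simp add: word_inv_def x)
  then show ?case using Cons by (rule word_eq_trans)
qed

definition word_eval :: "('g, 'h) monoid_scheme \<Rightarrow> (bool \<Rightarrow> 'g) \<Rightarrow> word \<Rightarrow> 'g" where
  "word_eval \<Gamma> \<phi> w =
     foldr (\<lambda>(l, s) g. (if s then \<phi> l else inv\<^bsub>\<Gamma>\<^esub> \<phi> l) \<otimes>\<^bsub>\<Gamma>\<^esub> g) w \<one>\<^bsub>\<Gamma>\<^esub>"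

context
  fixes \<Gamma> :: "('g, 'h) monoid_scheme" and \<phi> :: "bool \<Rightarrow> 'g"
  assumes \<Gamma>: "group \<Gamma>" and \<phi>: "\<And>l. \<phi> l \<in> carrier \<Gamma>"
begin

interpretation group \<Gamma> by (rule \<Gamma>)

lemma word_eval_simps:
  "word_eval \<Gamma> \<phi> [] = \<one>\<^bsub>\<Gamma>\<^esub>"
  "word_eval \<Gamma> \<phi> ((l, s) # w) = (if s then \<phi> l else inv\<^bsub>\<Gamma>\<^esub> \<phi> l) \<otimes>\<^bsub>\<Gamma>\<^esub> word_eval \<Gamma> \<phi> w"
  by (simp_all add: word_eval_def)

lemma word_eval_closed: "word_eval \<Gamma> \<phi> w \<in> carrier \<Gamma>"
  by (induction w) (use \<phi> in \<open>auto simp: word_eval_simps\<close>)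

lemma word_eval_append: "word_eval \<Gamma> \<phi> (u @ v) = word_eval \<Gamma> \<phi> u \<otimes>\<^bsub>\<Gamma>\<^esub> word_eval \<Gamma> \<phi> v"
  by (induction u) (use \<phi> word_eval_closed in \<open>auto simp: word_eval_simps m_assoc\<close>)

lemma word_eval_cong: "word_eq u v \<Longrightarrow> word_eval \<Gamma> \<phi> u = word_eval \<Gamma> \<phi> v"
proof (induction rule: word_eq.induct)
  case (cancel u l s v)
  show ?case
    using \<phi>[of l] word_eval_closed[of v]
    by (simp add: word_eval_append word_eval_simps inv_solve_left' flip: m_assoc)
qed auto

end

text \<open>
  The free group is constructed inside a prescribed type \<open>'u\<close>, since locality is tested on groups in
  the type of the local group.  An element is a code of the class of words that represent it.
\<close>

locale free_group_code =
  fixes enc :: "word \<Rightarrow> 'u"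
  assumes enc_eq_iff: "enc u = enc v \<longleftrightarrow> word_eq u v"
begin

definition dec :: "'u \<Rightarrow> word" where "dec x = (SOME w. enc w = x)"

definition F :: "'u monoid" where
  "F = \<lparr>carrier = range enc, monoid.mult = (\<lambda>x y. enc (dec x @ dec y)), one = enc []\<rparr>"

definition gen :: "bool \<Rightarrow> 'u" where "gen l = enc [(l, True)]"

lemma enc_dec: "enc (dec (enc w)) = enc w"
  unfolding dec_def by (rule someI) (rule refl)

lemma F_simps:
  "x \<in> carrier F \<longleftrightarrow> (\<exists>w. x = enc w)" "\<one>\<^bsub>F\<^esub> = enc []" "enc u \<otimes>\<^bsub>F\<^esub> enc v = enc (u @ v)"
proof -
  show "x \<in> carrier F \<longleftrightarrow> (\<exists>w. x = enc w)" "\<one>\<^bsub>F\<^esub> = enc []" by (auto simp: F_def)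
  show "enc u \<otimes>\<^bsub>F\<^esub> enc v = enc (u @ v)"
    using enc_dec[of u] enc_dec[of v] by (simp add: F_def enc_eq_iff word_eq_append)
qed

lemma group_F: "group F"
proof (rule groupI)
  fix x assume "x \<in> carrier F"
  then obtain w where "x = enc w" by (auto simp: F_simps)
  then have "enc (word_inv w) \<otimes>\<^bsub>F\<^esub> x = \<one>\<^bsub>F\<^esub>"
    by (simp add: F_simps enc_eq_iff word_inv_cancel)
  then show "\<exists>y\<in>carrier F. y \<otimes>\<^bsub>F\<^esub> x = \<one>\<^bsub>F\<^esub>" by (rule bexI) (auto simp: F_simps)
qed (auto simp: F_simps)

sublocale F: group F by (rule group_F)

lemma gen_closed: "gen l \<in> carrier F"
  by (auto simp: gen_def F_simps)

lemma enc_singleton: "enc [(l, s)] = (if s then gen l else inv\<^bsub>F\<^esub> gen l)"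
proof -
  have "word_eq [(l, False), (l, True)] []" using word_eq.cancel[of "[]" l False "[]"] by simp
  then have "enc [(l, False)] \<otimes>\<^bsub>F\<^esub> gen l = \<one>\<^bsub>F\<^esub>" by (simp add: gen_def F_simps enc_eq_iff)
  then have "inv\<^bsub>F\<^esub> gen l = enc [(l, False)]"
    by (intro F.inv_equality gen_closed) (auto simp: F_simps)
  then show ?thesis by (simp add: gen_def)
qed

lemma F_induct [consumes 1, case_names one gen inv mult]:
  assumes "x \<in> carrier F" and "P \<one>\<^bsub>F\<^esub>" and "\<And>l. P (gen l)" "\<And>l. P (inv\<^bsub>F\<^esub> gen l)"
    and "\<And>x y. x \<in> carrier F \<Longrightarrow> y \<in> carrier F \<Longrightarrow> P x \<Longrightarrow> P y \<Longrightarrow> P (x \<otimes>\<^bsub>F\<^esub> y)"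
  shows "P x"
proof -
  have "P (enc w)" for w
  proof (induction w)
    case Nil
    then show ?case using assms(2) by (simp add: F_simps)
  next
    case (Cons x w)
    obtain l s where x: "x = (l, s)" by (cases x)
    have "enc [x] \<in> carrier F" "enc w \<in> carrier F" by (auto simp: F_simps)
    moreover have "P (enc [x])" using assms(3,4)[of l] by (simp add: x enc_singleton)
    ultimately have "P (enc [x] \<otimes>\<^bsub>F\<^esub> enc w)" using Cons by (rule assms(5))
    then show ?case by (simp add: F_simps)
  qed
  then show ?thesis using assms(1) by (auto simp: F_simps)
qed

definition lift :: "('g, 'h) monoid_scheme \<Rightarrow> (bool \<Rightarrow> 'g) \<Rightarrow> 'u \<Rightarrow> 'g" where
  "lift \<Gamma> \<phi> x = word_eval \<Gamma> \<phi> (dec x)"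

lemma lift_enc:
  assumes "group \<Gamma>" "\<And>l. \<phi> l \<in> carrier \<Gamma>"
  shows "lift \<Gamma> \<phi> (enc w) = word_eval \<Gamma> \<phi> w"
  unfolding lift_def using enc_dec[of w] by (intro word_eval_cong assms) (simp add: enc_eq_iff)

lemma lift_hom:
  assumes "group \<Gamma>" "\<And>l. \<phi> l \<in> carrier \<Gamma>"
  shows "lift \<Gamma> \<phi> \<in> hom F \<Gamma>"
  by (rule homI) (auto simp: F_simps lift_enc[OF assms] word_eval_closed[OF assms] word_eval_append[OF assms])

lemma lift_gen:
  assumes "group \<Gamma>" "\<And>l. \<phi> l \<in> carrier \<Gamma>"
  shows "lift \<Gamma> \<phi> (gen l) = \<phi> l"
  unfolding gen_def lift_enc[OF assms]
  by (simp add: word_eval_simps[OF assms] monoid.r_one[OF group.is_monoid[OF assms(1)]] assms(2))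

lemma hom_F_eqI:
  assumes \<Gamma>: "group \<Gamma>" and h: "h \<in> hom F \<Gamma>" and k: "k \<in> hom F \<Gamma>"
    and eq: "\<And>l. h (gen l) = k (gen l)" and x: "x \<in> carrier F"
  shows "h x = k x"
proof -
  interpret h: group_hom F \<Gamma> h using \<Gamma> h by (simp add: group_hom_def group_hom_axioms_def group_F)
  interpret k: group_hom F \<Gamma> k using \<Gamma> k by (simp add: group_hom_def group_hom_axioms_def group_F)
  show ?thesis
    using x by (induction rule: F_induct) (simp_all add: eq gen_closed)
qed

end

text \<open>
  There are countably many words; a class is coded by the number of a chosen representative.
\<close>

lemma exists_free_group_code:
  assumes "infinite (UNIV :: 'u set)"
  obtains enc :: "word \<Rightarrow> 'u" where "free_group_code enc"
proof -
  obtain i :: "nat \<Rightarrow> 'u" where i: "inj i"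
    using infinite_countable_subset[OF assms] by blast
  define nf where "nf u = (SOME v. word_eq u v)" for u
  have nf: "word_eq u (nf u)" for u unfolding nf_def by (rule someI) (rule word_eq_refl)
  have "nf u = nf v \<longleftrightarrow> word_eq u v" for u v
  proof
    assume "nf u = nf v"
    then show "word_eq u v" using nf[of u] nf[of v] by (metis word_eq_sym word_eq_trans)
  next
    assume "word_eq u v"
    then have "word_eq u = word_eq v" by (intro ext) (blast intro: word_eq_sym word_eq_trans)
    then show "nf u = nf v" by (simp add: nf_def)
  qed
  then have "free_group_code (\<lambda>u. i (to_nat (nf u)))"
    by unfold_locales (simp add: inj_eq[OF i])
  then show thesis by (rule that)
qed

section \<open>Free groups have no second homology\<close>

text \<open>
  The neutral element compensates for \<open>\<kappa>(1, 1)\<close>, which is not neutral in \<open>A\<close> for a cocycle that is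
  not normalized.
\<close>

definition cocycle_extension ::
    "('k, 'l) monoid_scheme \<Rightarrow> ('a, 'b) monoid_scheme \<Rightarrow> ('a \<Rightarrow> 'a \<Rightarrow> 'k) \<Rightarrow> ('k \<times> 'a) monoid" where
  "cocycle_extension A G \<kappa> =
     \<lparr>carrier = carrier A \<times> carrier G,
      monoid.mult = (\<lambda>(a, g) (b, h). (a \<otimes>\<^bsub>A\<^esub> b \<otimes>\<^bsub>A\<^esub> \<kappa> g h, g \<otimes>\<^bsub>G\<^esub> h)),
      one = (inv\<^bsub>A\<^esub> \<kappa> \<one>\<^bsub>G\<^esub> \<one>\<^bsub>G\<^esub>, \<one>\<^bsub>G\<^esub>)\<rparr>"

lemma group_cocycle_extension:
  assumes "comm_group A" "group G"
    and \<kappa>: "\<And>g h. g \<in> carrier G \<Longrightarrow> h \<in> carrier G \<Longrightarrow> \<kappa> g h \<in> carrier A"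
    and cocycle: "\<And>g h k. g \<in> carrier G \<Longrightarrow> h \<in> carrier G \<Longrightarrow> k \<in> carrier G \<Longrightarrow>
      \<kappa> h k \<otimes>\<^bsub>A\<^esub> \<kappa> g (h \<otimes>\<^bsub>G\<^esub> k) = \<kappa> (g \<otimes>\<^bsub>G\<^esub> h) k \<otimes>\<^bsub>A\<^esub> \<kappa> g h"
  shows "group (cocycle_extension A G \<kappa>)"
proof -
  interpret A: comm_group A by fact
  interpret G: group G by fact
  let ?E = "cocycle_extension A G \<kappa>"
  have \<kappa>_one: "\<kappa> \<one>\<^bsub>G\<^esub> g = \<kappa> \<one>\<^bsub>G\<^esub> \<one>\<^bsub>G\<^esub>" if "g \<in> carrier G" for g
    using cocycle[of "\<one>\<^bsub>G\<^esub>" "\<one>\<^bsub>G\<^esub>" g] that \<kappa>[of "\<one>\<^bsub>G\<^esub>" g] \<kappa>[of "\<one>\<^bsub>G\<^esub>" "\<one>\<^bsub>G\<^esub>"] by simp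
  show ?thesis
  proof (rule groupI)
    fix x assume "x \<in> carrier ?E"
    then obtain a g where x: "x = (a, g)" "a \<in> carrier A" "g \<in> carrier G"
      by (auto simp: cocycle_extension_def)
    define b where "b = inv\<^bsub>A\<^esub> \<kappa> \<one>\<^bsub>G\<^esub> \<one>\<^bsub>G\<^esub> \<otimes>\<^bsub>A\<^esub> inv\<^bsub>A\<^esub> (\<kappa> (inv\<^bsub>G\<^esub> g) g) \<otimes>\<^bsub>A\<^esub> inv\<^bsub>A\<^esub> a"
    have k: "\<kappa> (inv\<^bsub>G\<^esub> g) g \<in> carrier A" "\<kappa> \<one>\<^bsub>G\<^esub> \<one>\<^bsub>G\<^esub> \<in> carrier A" using x \<kappa> by simp_all
    then have "b \<in> carrier A" using x(2) by (simp add: b_def)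
    moreover have "b \<otimes>\<^bsub>A\<^esub> a \<otimes>\<^bsub>A\<^esub> \<kappa> (inv\<^bsub>G\<^esub> g) g = inv\<^bsub>A\<^esub> \<kappa> \<one>\<^bsub>G\<^esub> \<one>\<^bsub>G\<^esub>"
      using k x(2) by (simp add: b_def A.m_assoc)
    ultimately have "(b, inv\<^bsub>G\<^esub> g) \<in> carrier ?E" "(b, inv\<^bsub>G\<^esub> g) \<otimes>\<^bsub>?E\<^esub> x = \<one>\<^bsub>?E\<^esub>"
      using x by (auto simp: cocycle_extension_def)
    then show "\<exists>y\<in>carrier ?E. y \<otimes>\<^bsub>?E\<^esub> x = \<one>\<^bsub>?E\<^esub>" by blast
  next
    fix x y w assume "x \<in> carrier ?E" "y \<in> carrier ?E" "w \<in> carrier ?E"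
    then obtain a g b h c k where x: "x = (a, g)" "a \<in> carrier A" "g \<in> carrier G"
        and y: "y = (b, h)" "b \<in> carrier A" "h \<in> carrier G"
        and w: "w = (c, k)" "c \<in> carrier A" "k \<in> carrier G"
      by (auto simp: cocycle_extension_def)
    have "a \<otimes>\<^bsub>A\<^esub> b \<otimes>\<^bsub>A\<^esub> \<kappa> g h \<otimes>\<^bsub>A\<^esub> c \<otimes>\<^bsub>A\<^esub> \<kappa> (g \<otimes>\<^bsub>G\<^esub> h) k
        = a \<otimes>\<^bsub>A\<^esub> b \<otimes>\<^bsub>A\<^esub> c \<otimes>\<^bsub>A\<^esub> (\<kappa> (g \<otimes>\<^bsub>G\<^esub> h) k \<otimes>\<^bsub>A\<^esub> \<kappa> g h)"
      using x y w \<kappa> by (simp add: A.m_ac)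
    also have "\<dots> = a \<otimes>\<^bsub>A\<^esub> (b \<otimes>\<^bsub>A\<^esub> c \<otimes>\<^bsub>A\<^esub> \<kappa> h k) \<otimes>\<^bsub>A\<^esub> \<kappa> g (h \<otimes>\<^bsub>G\<^esub> k)"
      using x y w \<kappa> by (subst cocycle[symmetric]) (simp_all add: A.m_ac)
    finally show "x \<otimes>\<^bsub>?E\<^esub> y \<otimes>\<^bsub>?E\<^esub> w = x \<otimes>\<^bsub>?E\<^esub> (y \<otimes>\<^bsub>?E\<^esub> w)"
      using x y w by (simp add: cocycle_extension_def G.m_assoc)
  next
    fix x assume "x \<in> carrier ?E"
    then obtain a g where x: "x = (a, g)" "a \<in> carrier A" "g \<in> carrier G"
      by (auto simp: cocycle_extension_def)
    then have "inv\<^bsub>A\<^esub> \<kappa> \<one>\<^bsub>G\<^esub> \<one>\<^bsub>G\<^esub> \<otimes>\<^bsub>A\<^esub> a \<otimes>\<^bsub>A\<^esub> \<kappa> \<one>\<^bsub>G\<^esub> g = a"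
      unfolding \<kappa>_one[OF x(3)] using \<kappa>[of "\<one>\<^bsub>G\<^esub>" "\<one>\<^bsub>G\<^esub>"] by (simp add: A.m_ac)
    then show "\<one>\<^bsub>?E\<^esub> \<otimes>\<^bsub>?E\<^esub> x = x" using x by (simp add: cocycle_extension_def)
  qed (use \<kappa> in \<open>auto simp: cocycle_extension_def\<close>)
qed

lemma subgroup_bar_boundaries:
  assumes "group G"
  shows "subgroup (bar_boundaries G n) (bar_chains G n)"
proof (rule group.subgroupI)
  show "group (bar_chains G n)" by (rule comm_group.axioms(2)[OF comm_group_bar_chains])
  show "bar_boundaries G n \<subseteq> carrier (bar_chains G n)"
    using bar_boundaries_in_bar_chains[OF assms] by blast
  show "bar_boundaries G n \<noteq> {}" using bar_boundaries_closed(1)[of G n] by blast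
  fix a b assume a: "a \<in> bar_boundaries G n"
  then have "inv\<^bsub>bar_chains G n\<^esub> a = - a"
    using bar_boundaries_in_bar_chains[OF assms a] by (simp add: bar_chains_def)
  then show "inv\<^bsub>bar_chains G n\<^esub> a \<in> bar_boundaries G n" using a by (simp add: bar_boundaries_closed)
  assume "b \<in> bar_boundaries G n"
  then show "a \<otimes>\<^bsub>bar_chains G n\<^esub> b \<in> bar_boundaries G n" using a by (simp add: bar_boundaries_closed)
qed

lemma hom_bar_chains_diff:
  assumes "group A" "h \<in> hom (bar_chains G n) A"
    and a: "a \<in> carrier (bar_chains G n)" and b: "b \<in> carrier (bar_chains G n)"
  shows "h (a - b) = h a \<otimes>\<^bsub>A\<^esub> inv\<^bsub>A\<^esub> h b"
proof -
  interpret group_hom "bar_chains G n" A h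
    using assms(1,2) comm_group.axioms(2)[OF comm_group_bar_chains] by (simp add: group_hom_def group_hom_axioms_def)
  have "h (a - b) \<otimes>\<^bsub>A\<^esub> h b = h a"
    using hom_mult[of "a - b" b] a b by (simp add: bar_chains_closed)
  then show ?thesis
    using hom_closed a b bar_chains_closed(3)[OF a b] by (simp add: H.inv_solve_right)
qed

context free_group_code
begin

text \<open>
  Modulo boundaries, \<open>(g, h) \<mapsto> [g|h]\<close> is the universal 2-cocycle, with values in \<open>A = C\<^sub>2/B\<^sub>2\<close>.  The
  corresponding central extension of a free group splits, and a splitting is a map \<open>\<sigma>\<close> to \<open>A\<close> with
  \<open>\<sigma>(g h) = \<sigma>(g) + \<sigma>(h) + [g|h]\<close>.  Extending \<open>\<sigma>\<close> linearly to 1-chains gives \<open>\<sigma>(\<partial> c) = - c\<close> modulo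
  boundaries for all 2-chains \<open>c\<close>, so every cycle is a boundary.
\<close>

lemma H2_trivial:
  assumes c: "c \<in> bar_cycles F 2"
  shows "c \<in> bar_boundaries F 2"
proof -
  let ?B = "bar_boundaries F 2"
  define A where "A = bar_chains F 2 Mod ?B"
  define \<pi> where "\<pi> = (\<lambda>c. ?B #>\<^bsub>bar_chains F 2\<^esub> c)"
  interpret C2: comm_group "bar_chains F 2" by (rule comm_group_bar_chains)
  have sub: "subgroup ?B (bar_chains F 2)" by (rule subgroup_bar_boundaries[OF group_F])
  interpret B: normal ?B "bar_chains F 2" by (rule C2.subgroup_imp_normal[OF sub])
  interpret A: comm_group A unfolding A_def by (rule C2.abelian_FactGroup[OF sub])
  have \<pi>: "\<pi> \<in> hom (bar_chains F 2) A" unfolding \<pi>_def A_def by (rule B.r_coset_hom_Mod)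
  have \<pi>_one: "\<pi> c = \<one>\<^bsub>A\<^esub> \<longleftrightarrow> c \<in> ?B" if "c \<in> carrier (bar_chains F 2)" for c
    unfolding \<pi>_def A_def one_FactGroup using that sub C2.coset_join1 C2.coset_join2 B.subset by metis
  note \<pi>_diff = hom_bar_chains_diff[OF A.is_group \<pi>]
  define \<kappa> where "\<kappa> g h = \<pi> (frag_of [g, h])" for g h
  have cell: "frag_of [g, h] \<in> carrier (bar_chains F 2)" if "g \<in> carrier F" "h \<in> carrier F" for g h
    using that unfolding bar_chains_closed bar_cells_2 by blast
  have \<kappa>: "\<kappa> g h \<in> carrier A" if "g \<in> carrier F" "h \<in> carrier F" for g h
    unfolding \<kappa>_def using cell[OF that] by (rule hom_in_carrier[OF \<pi>])
  have cocycle: "\<kappa> h k \<otimes>\<^bsub>A\<^esub> \<kappa> g (h \<otimes>\<^bsub>F\<^esub> k) = \<kappa> (g \<otimes>\<^bsub>F\<^esub> h) k \<otimes>\<^bsub>A\<^esub> \<kappa> g h"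
    if g: "g \<in> carrier F" and h: "h \<in> carrier F" and k: "k \<in> carrier F" for g h k
  proof -
    let ?l = "frag_of [h, k] + frag_of [g, h \<otimes>\<^bsub>F\<^esub> k]" and ?r = "frag_of [g \<otimes>\<^bsub>F\<^esub> h, k] + frag_of [g, h]"
    have in_C: "?l \<in> carrier (bar_chains F 2)" "?r \<in> carrier (bar_chains F 2)"
      by (intro bar_chains_closed(2) cell g h k F.m_closed)+
    have "[g, h, k] \<in> bar_cells F (Suc 2)" using g h k by (simp add: bar_cells_def)
    then have "bar_boundary F (frag_of [g, h, k]) \<in> ?B"
      unfolding bar_boundaries_def by (intro imageI) (simp only: bar_chains_closed)
    then have "?l - ?r \<in> ?B" by (simp add: bar_boundary_cell_3 algebra_simps)
    then have "\<pi> (?l - ?r) = \<one>\<^bsub>A\<^esub>" using \<pi>_one[OF bar_chains_closed(3)[OF in_C]] by blast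
    then have "\<pi> ?l = \<pi> ?r"
      unfolding \<pi>_diff[OF in_C] using hom_in_carrier[OF \<pi>] in_C
      by (metis A.inv_equality A.inv_closed A.inv_inv)
    moreover have "\<pi> (frag_of [h, k] + frag_of [g, h \<otimes>\<^bsub>F\<^esub> k]) = \<kappa> h k \<otimes>\<^bsub>A\<^esub> \<kappa> g (h \<otimes>\<^bsub>F\<^esub> k)"
      using hom_mult[OF \<pi> cell[OF h k] cell[OF g F.m_closed[OF h k]]] by (simp add: \<kappa>_def)
    moreover have "\<pi> ?r = \<kappa> (g \<otimes>\<^bsub>F\<^esub> h) k \<otimes>\<^bsub>A\<^esub> \<kappa> g h"
      using hom_mult[OF \<pi> cell[OF F.m_closed[OF g h] k] cell[OF g h]] by (simp add: \<kappa>_def)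
    ultimately show ?thesis by simp
  qed
  define E where "E = cocycle_extension A F \<kappa>"
  have E: "group E" unfolding E_def by (rule group_cocycle_extension[OF A.comm_group_axioms group_F \<kappa> cocycle])
  \<comment> \<open>The freeness of the group provides the splitting.\<close>
  define s where "s = lift E (\<lambda>l. (\<one>\<^bsub>A\<^esub>, gen l))"
  have gen_E: "(\<one>\<^bsub>A\<^esub>, gen l) \<in> carrier E" for l
    using gen_closed by (simp add: E_def cocycle_extension_def)
  have s: "s \<in> hom F E" unfolding s_def by (rule lift_hom[OF E gen_E])
  have snd_hom: "snd \<in> hom E F" by (rule homI) (auto simp: E_def cocycle_extension_def)
  have snd_s: "snd (s g) = g" if "g \<in> carrier F" for g
  proof -
    have "(snd \<circ> s) g = id g"
    proof (rule hom_F_eqI[OF group_F _ _ _ that])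
      show "snd \<circ> s \<in> hom F F" using hom_compose[OF s snd_hom] .
      show "id \<in> hom F F" by (rule homI) simp_all
      show "(snd \<circ> s) (gen l) = id (gen l)" for l by (simp add: s_def lift_gen[OF E gen_E])
    qed
    then show ?thesis by simp
  qed
  define \<sigma> where "\<sigma> g = fst (s g)" for g
  have \<sigma>_closed: "\<sigma> g \<in> carrier A" if "g \<in> carrier F" for g
    using hom_in_carrier[OF s that] by (auto simp: \<sigma>_def E_def cocycle_extension_def)
  have \<sigma>_mult: "\<sigma> (g \<otimes>\<^bsub>F\<^esub> h) = \<sigma> g \<otimes>\<^bsub>A\<^esub> \<sigma> h \<otimes>\<^bsub>A\<^esub> \<kappa> g h" if "g \<in> carrier F" "h \<in> carrier F" for g h
    using hom_mult[OF s that] snd_s[OF that(1)] snd_s[OF that(2)]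
    by (simp add: \<sigma>_def E_def cocycle_extension_def case_prod_beta)
  have "(\<lambda>xs. \<sigma> (hd xs)) ` bar_cells F 1 \<subseteq> carrier A"
    unfolding bar_cells_1 using \<sigma>_closed by auto
  then obtain h where h: "h \<in> hom (bar_chains F 1) A" and h_cell: "\<And>xs. xs \<in> bar_cells F 1 \<Longrightarrow> h (frag_of xs) = \<sigma> (hd xs)"
    using A.free_Abelian_group_universal[of _ "bar_cells F 1"] unfolding bar_chains_def by blast
  note h_diff = hom_bar_chains_diff[OF A.is_group h]
  have cell1: "frag_of [g] \<in> carrier (bar_chains F 1)" "h (frag_of [g]) = \<sigma> g" if "g \<in> carrier F" for g
    using that h_cell[of "[g]"] unfolding bar_chains_closed bar_cells_1 by auto
  have Suc1: "Suc 1 = 2" by simp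
  have h_boundary: "h (bar_boundary F c) = inv\<^bsub>A\<^esub> \<pi> c" if "c \<in> carrier (bar_chains F 2)" for c
    using that
  proof (induction rule: bar_chains_induct)
    case zero
    show ?case
      using hom_one[OF h comm_group.axioms(2)[OF comm_group_bar_chains] A.is_group]
        hom_one[OF \<pi> C2.is_group A.is_group] by simp
  next
    case (cell xs)
    then obtain x y where xs: "xs = [x, y]" and x: "x \<in> carrier F" and y: "y \<in> carrier F"
      unfolding bar_cells_2 by blast
    have "h (bar_boundary F (frag_of xs)) = h ((frag_of [x] + frag_of [y]) - frag_of [x \<otimes>\<^bsub>F\<^esub> y])"
      by (simp add: xs bar_boundary_cell_2 algebra_simps)
    also have "\<dots> = h (frag_of [x] + frag_of [y]) \<otimes>\<^bsub>A\<^esub> inv\<^bsub>A\<^esub> h (frag_of [x \<otimes>\<^bsub>F\<^esub> y])"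
      by (intro h_diff bar_chains_closed(2) cell1(1) x y F.m_closed)
    also have "h (frag_of [x] + frag_of [y]) = \<sigma> x \<otimes>\<^bsub>A\<^esub> \<sigma> y"
      using hom_mult[OF h cell1(1)[OF x] cell1(1)[OF y]] cell1(2)[OF x] cell1(2)[OF y] by simp
    also have "h (frag_of [x \<otimes>\<^bsub>F\<^esub> y]) = \<sigma> x \<otimes>\<^bsub>A\<^esub> \<sigma> y \<otimes>\<^bsub>A\<^esub> \<kappa> x y"
      using cell1(2)[OF F.m_closed[OF x y]] \<sigma>_mult[OF x y] by simp
    also have "\<sigma> x \<otimes>\<^bsub>A\<^esub> \<sigma> y \<otimes>\<^bsub>A\<^esub> inv\<^bsub>A\<^esub> (\<sigma> x \<otimes>\<^bsub>A\<^esub> \<sigma> y \<otimes>\<^bsub>A\<^esub> \<kappa> x y) = inv\<^bsub>A\<^esub> \<kappa> x y"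
    proof -
      define u where "u = \<sigma> x \<otimes>\<^bsub>A\<^esub> \<sigma> y"
      have "u \<in> carrier A" "\<kappa> x y \<in> carrier A" using \<sigma>_closed x y \<kappa> by (simp_all add: u_def)
      then show ?thesis unfolding u_def[symmetric] by (simp add: A.inv_mult A.r_inv flip: A.m_assoc)
    qed
    finally show ?case by (simp add: \<kappa>_def xs)
  next
    case (diff a b)
    have ab: "bar_boundary F a \<in> carrier (bar_chains F 1)" "bar_boundary F b \<in> carrier (bar_chains F 1)"
      using diff(1,2) by (auto intro!: bar_boundary_in_bar_chains[OF group_F] simp: Suc1 simp del: One_nat_def)
    show ?case
      using hom_in_carrier[OF \<pi>] diff(1,2)
      by (simp only: bar_boundary_simps h_diff[OF ab] diff(3,4) \<pi>_diff[OF diff(1,2)])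
         (simp add: A.inv_mult)
  qed
  have c2: "c \<in> carrier (bar_chains F 2)" and "bar_boundary F c = 0"
    using c by (simp_all add: bar_cycles_def)
  then have "inv\<^bsub>A\<^esub> \<pi> c = h 0" using h_boundary[OF c2] by simp
  also have "h 0 = \<one>\<^bsub>A\<^esub>"
    using hom_one[OF h comm_group.axioms(2)[OF comm_group_bar_chains] A.is_group] by simp
  finally have "\<pi> c = \<one>\<^bsub>A\<^esub>" using hom_in_carrier[OF \<pi> c2] by (metis A.inv_inv A.inv_one)
  then show ?thesis using \<pi>_one[OF c2] by blast
qed

end

section \<open>An equation that is solvable in local groups\<close>

context free_group_code
begin

text \<open>
  The equation to be solved in local groups, as an endomorphism: it sends the first generator \<open>y\<close> to
  \<open>y y b y\<^sup>-\<^sup>1 b\<^sup>-\<^sup>1\<close> and fixes the second generator \<open>b\<close>.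
\<close>

definition \<theta> :: "'u \<Rightarrow> 'u" where
  "\<theta> = lift F (\<lambda>l. if l then gen True \<otimes>\<^bsub>F\<^esub> gen True \<otimes>\<^bsub>F\<^esub> gen False \<otimes>\<^bsub>F\<^esub> inv\<^bsub>F\<^esub> gen True \<otimes>\<^bsub>F\<^esub> inv\<^bsub>F\<^esub> gen False
     else gen False)"

lemma \<theta>_hom: "\<theta> \<in> hom F F"
  unfolding \<theta>_def by (rule lift_hom[OF group_F]) (simp add: gen_closed)

lemma \<theta>_gen:
  "\<theta> (gen True) = gen True \<otimes>\<^bsub>F\<^esub> gen True \<otimes>\<^bsub>F\<^esub> gen False \<otimes>\<^bsub>F\<^esub> inv\<^bsub>F\<^esub> gen True \<otimes>\<^bsub>F\<^esub> inv\<^bsub>F\<^esub> gen False"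
  "\<theta> (gen False) = gen False"
  unfolding \<theta>_def by (subst lift_gen[OF group_F]; simp add: gen_closed)+

definition expo :: "bool \<Rightarrow> 'u \<Rightarrow> int" where
  "expo l = lift integer_group (\<lambda>l'. if l' = l then 1 else 0)"

lemma expo_hom: "expo l \<in> hom F integer_group"
  unfolding expo_def by (rule lift_hom) simp_all

lemma expo_simps:
  "expo l (gen l') = (if l' = l then 1 else 0)"
  "x \<in> carrier F \<Longrightarrow> y \<in> carrier F \<Longrightarrow> expo l (x \<otimes>\<^bsub>F\<^esub> y) = expo l x + expo l y"
  "x \<in> carrier F \<Longrightarrow> expo l (inv\<^bsub>F\<^esub> x) = - expo l x"
  "expo l \<one>\<^bsub>F\<^esub> = 0"
proof -
  interpret h: group_hom F integer_group "expo l"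
    using expo_hom by (simp add: group_hom_def group_hom_axioms_def group_F)
  show "expo l (gen l') = (if l' = l then 1 else 0)"
    unfolding expo_def by (subst lift_gen) simp_all
  show "expo l (x \<otimes>\<^bsub>F\<^esub> y) = expo l x + expo l y" if "x \<in> carrier F" "y \<in> carrier F"
    using h.hom_mult[OF that] by simp
  show "expo l (inv\<^bsub>F\<^esub> x) = - expo l x" if "x \<in> carrier F"
    using h.hom_inv[OF that] by simp
  show "expo l \<one>\<^bsub>F\<^esub> = 0" using h.hom_one by simp
qed

lemma expo_\<theta>:
  assumes "x \<in> carrier F"
  shows "expo l (\<theta> x) = expo l x"
proof -
  have "(expo l \<circ> \<theta>) x = expo l x"
  proof (rule hom_F_eqI[OF _ _ _ _ assms])
    show "expo l \<circ> \<theta> \<in> hom F integer_group" by (rule hom_compose[OF \<theta>_hom expo_hom])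
    show "(expo l \<circ> \<theta>) (gen l') = expo l (gen l')" for l'
      by (cases l') (simp_all add: \<theta>_gen expo_simps gen_closed)
  qed (use expo_hom in simp_all)
  then show ?thesis by simp
qed

definition homologous :: "('u list \<Rightarrow>\<^sub>0 int) \<Rightarrow> ('u list \<Rightarrow>\<^sub>0 int) \<Rightarrow> bool" where
  "homologous c d \<longleftrightarrow> c - d \<in> bar_boundaries F 1"

lemma homologous_mult:
  assumes "homologous (frag_of [x]) c" "homologous (frag_of [y]) d" "x \<in> carrier F" "y \<in> carrier F"
  shows "homologous (frag_of [x \<otimes>\<^bsub>F\<^esub> y]) (c + d)"
proof -
  have "bar_boundary F (frag_of [x, y]) \<in> bar_boundaries F 1"
    unfolding bar_boundaries_def using assms(3,4)
    by (intro imageI) (simp add: bar_chains_closed bar_cells_def)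
  then have "(frag_of [x] - c) + (frag_of [y] - d) - bar_boundary F (frag_of [x, y]) \<in> bar_boundaries F 1"
    using assms(1,2) unfolding homologous_def by (blast intro: bar_boundaries_closed(2,3))
  then show ?thesis by (simp add: homologous_def bar_boundary_cell_2 algebra_simps)
qed

lemma homologous_one: "homologous (frag_of [\<one>\<^bsub>F\<^esub>]) 0"
proof -
  have "bar_boundary F (frag_of [\<one>\<^bsub>F\<^esub>, \<one>\<^bsub>F\<^esub>]) \<in> bar_boundaries F 1"
    unfolding bar_boundaries_def
    by (intro imageI) (simp add: bar_chains_closed bar_cells_def)
  then show ?thesis by (simp add: homologous_def bar_boundary_cell_2)
qed

lemma homologous_inv:
  assumes "homologous (frag_of [x]) c" "x \<in> carrier F"
  shows "homologous (frag_of [inv\<^bsub>F\<^esub> x]) (- c)"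
proof -
  have "bar_boundary F (frag_of [x, inv\<^bsub>F\<^esub> x]) \<in> bar_boundaries F 1"
    unfolding bar_boundaries_def using assms(2)
    by (intro imageI) (simp add: bar_chains_closed bar_cells_def)
  then have "bar_boundary F (frag_of [x, inv\<^bsub>F\<^esub> x]) - (frag_of [x] - c) + (frag_of [\<one>\<^bsub>F\<^esub>] - 0) \<in> bar_boundaries F 1"
    using assms(1) homologous_one unfolding homologous_def by (blast intro: bar_boundaries_closed(2,3))
  then show ?thesis using assms(2) by (simp add: homologous_def bar_boundary_cell_2 algebra_simps)
qed

lemma homologous_refl: "homologous c c"
  by (simp add: homologous_def bar_boundaries_closed)

text \<open>
  The normal form of a 1-cell modulo boundaries.
\<close>

definition \<nu> :: "'u list \<Rightarrow> ('u list \<Rightarrow>\<^sub>0 int)" where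
  "\<nu> xs = frag_cmul (expo True (hd xs)) (frag_of [gen True]) + frag_cmul (expo False (hd xs)) (frag_of [gen False])"

lemma homologous_\<nu>: "x \<in> carrier F \<Longrightarrow> homologous (frag_of [x]) (\<nu> [x])"
proof (induction rule: F_induct)
  case one
  then show ?case using homologous_one by (simp add: \<nu>_def expo_simps)
next
  case (gen l)
  then show ?case using homologous_refl by (cases l) (simp_all add: \<nu>_def expo_simps)
next
  case (inv l)
  have "homologous (frag_of [inv\<^bsub>F\<^esub> gen l]) (- frag_of [gen l])"
    by (rule homologous_inv[OF homologous_refl gen_closed])
  then show ?case by (cases l) (simp_all add: \<nu>_def expo_simps gen_closed)
next
  case (mult x y)
  then show ?case
    using homologous_mult[OF mult(3,4,1,2)] by (simp add: \<nu>_def expo_simps frag_cmul_distrib algebra_simps)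
qed

lemma homologous_\<nu>_chain:
  assumes "d \<in> carrier (bar_chains F 1)"
  shows "homologous d (frag_extend \<nu> d)"
  using assms
proof (induction rule: bar_chains_induct)
  case (cell xs)
  then show ?case unfolding bar_cells_1 using homologous_\<nu> by auto
next
  case (diff a b)
  then have "(a - frag_extend \<nu> a) - (b - frag_extend \<nu> b) \<in> bar_boundaries F 1"
    unfolding homologous_def by (blast intro: bar_boundaries_closed(3))
  then show ?case by (simp add: homologous_def frag_extend_diff algebra_simps)
qed (simp add: homologous_refl)

lemma \<nu>_boundary:
  assumes "b \<in> bar_boundaries F 1"
  shows "frag_extend \<nu> b = 0"
proof -
  obtain c where c: "c \<in> carrier (bar_chains F 2)" "b = bar_boundary F c"
    using assms unfolding bar_boundaries_def by (auto simp: numeral_2_eq_2)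
  show ?thesis
    unfolding c(2) using c(1)
  proof (induction rule: bar_chains_induct)
    case (cell xs)
    then show ?case
      unfolding bar_cells_2
      by (auto simp: bar_boundary_cell_2 frag_extend_diff frag_extend_add \<nu>_def expo_simps frag_cmul_distrib
          simp flip: minus_frag_cmul)
  qed (simp_all add: frag_extend_diff)
qed

lemma \<nu>_\<theta>:
  assumes "d \<in> carrier (bar_chains F 1)"
  shows "frag_extend \<nu> (chain_map \<theta> d) = frag_extend \<nu> d"
  using assms
proof (induction rule: bar_chains_induct)
  case (cell xs)
  then show ?case unfolding bar_cells_1 by (auto simp: \<nu>_def expo_\<theta>)
qed (simp_all add: frag_extend_diff)

text \<open>
  On \<open>H\<^sub>1\<close>, which is free on the two generators, \<open>\<theta>\<close> induces the identity: the exponent sums of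
  \<open>y y b y\<^sup>-\<^sup>1 b\<^sup>-\<^sup>1\<close> are \<open>1\<close> and \<open>0\<close>.  On \<open>H\<^sub>2 = 0\<close> there is nothing to check.
\<close>

lemma HZ_map_\<theta>: "HZ_map F F \<theta>"
proof (rule HZ_mapI[OF group_F group_F \<theta>_hom])
  fix d assume d: "d \<in> carrier (bar_chains F 1)" and b: "chain_map \<theta> d \<in> bar_boundaries F 1"
  have "frag_extend \<nu> d = 0" using \<nu>_\<theta>[OF d] \<nu>_boundary[OF b] by simp
  then show "d \<in> bar_boundaries F 1" using homologous_\<nu>_chain[OF d] by (simp add: homologous_def)
next
  fix c assume c: "c \<in> carrier (bar_chains F 1)"
  have \<theta>c: "chain_map \<theta> c \<in> carrier (bar_chains F 1)"
    by (rule chain_map_in_bar_chains[OF \<theta>_hom c])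
  have "(c - frag_extend \<nu> c) - (chain_map \<theta> c - frag_extend \<nu> (chain_map \<theta> c)) \<in> bar_boundaries F 1"
    using homologous_\<nu>_chain[OF c] homologous_\<nu>_chain[OF \<theta>c]
    unfolding homologous_def by (rule bar_boundaries_closed)
  then have "c - chain_map \<theta> c \<in> bar_boundaries F 1" unfolding \<nu>_\<theta>[OF c] by simp
  then show "\<exists>d\<in>carrier (bar_chains F 1). c - chain_map \<theta> d \<in> bar_boundaries F 1"
    using c by blast
next
  fix c assume "c \<in> bar_cycles F 2"
  then have "c \<in> bar_boundaries F 2" by (rule H2_trivial)
  then show "\<exists>d\<in>bar_cycles F 2. c - chain_map \<theta> d \<in> bar_boundaries F 2"
    using zero_in_bar_cycles by (intro bexI[of _ 0]) simp_all
qed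

end

text \<open>
  Extend the homomorphism that sends the generators to \<open>a\<close> and \<open>b\<close> along \<open>\<theta>\<close>.
\<close>

lemma (in free_group_code) local_solution:
  fixes E :: "'u monoid"
  assumes E: "HZ_local E" and a: "a \<in> carrier E" and b: "b \<in> carrier E"
  obtains y where "y \<in> carrier E"
    "y \<otimes>\<^bsub>E\<^esub> y \<otimes>\<^bsub>E\<^esub> b \<otimes>\<^bsub>E\<^esub> inv\<^bsub>E\<^esub> y \<otimes>\<^bsub>E\<^esub> inv\<^bsub>E\<^esub> b = a"
proof -
  interpret E: group E using E unfolding HZ_local_def by blast
  define \<xi> where "\<xi> = restrict (lift E (\<lambda>l. if l then a else b)) (carrier F)"
  have \<phi>: "(if l then a else b) \<in> carrier E" for l using a b by simp
  have "\<xi> \<in> Hom_set F E"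
    unfolding \<xi>_def Hom_set_def using lift_hom[OF E.is_group \<phi>] F.m_closed
    by (auto simp: hom_def Pi_def)
  moreover have "(\<lambda>\<psi>. compose (carrier F) \<psi> \<theta>) ` Hom_set F E = Hom_set F E"
    using E HZ_map_\<theta> unfolding HZ_local_def bij_betw_def by blast
  ultimately obtain \<psi> where \<psi>: "\<psi> \<in> Hom_set F E" "\<xi> = compose (carrier F) \<psi> \<theta>" by blast
  interpret \<psi>: group_hom F E \<psi>
    using \<psi>(1) by (simp add: Hom_set_def group_hom_def group_hom_axioms_def group_F)
  have \<psi>\<theta>: "\<psi> (\<theta> (gen l)) = (if l then a else b)" for l
  proof -
    have "\<psi> (\<theta> (gen l)) = \<xi> (gen l)" by (simp add: \<psi>(2) compose_eq gen_closed)
    also have "\<dots> = (if l then a else b)" by (simp add: \<xi>_def gen_closed lift_gen[OF E.is_group \<phi>])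
    finally show ?thesis .
  qed
  have "\<psi> (gen False) = b" using \<psi>\<theta>[of False] by (simp add: \<theta>_gen)
  then show thesis
    using \<psi>\<theta>[of True] by (intro that[of "\<psi> (gen True)"]) (simp_all add: \<theta>_gen gen_closed)
qed

section \<open>The lower central series of the target of an HZ-map\<close>

text \<open>
  The indices agree with those of the transfinite series, including the dummy value at \<open>0\<close>.
\<close>

fun lower_central :: "('a, 'b) monoid_scheme \<Rightarrow> nat \<Rightarrow> 'a set" where
  "lower_central G 0 = carrier G"
| "lower_central G (Suc 0) = carrier G"
| "lower_central G (Suc (Suc n)) = commutator_subgroup G (lower_central G (Suc n)) (carrier G)"

lemma commutator_subgroup_carrier: "commutator_subgroup G (carrier G) (carrier G) = derived G (carrier G)"
  unfolding commutator_subgroup_def derived_def by (rule arg_cong[of _ _ "generate G"]) blast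

context group
begin

lemma commutator_subgroup_mono:
  assumes "H \<subseteq> H'" "K \<subseteq> K'"
  shows "commutator_subgroup G H K \<subseteq> commutator_subgroup G H' K'"
  unfolding commutator_subgroup_def by (rule mono_generate) (use assms in blast)

lemma commutator_conjugate:
  assumes "g \<in> carrier G" "h \<in> carrier G" "k \<in> carrier G"
  shows "g \<otimes> (h \<otimes> k \<otimes> inv h \<otimes> inv k) \<otimes> inv g
    = (g \<otimes> h \<otimes> inv g) \<otimes> (g \<otimes> k \<otimes> inv g) \<otimes> inv (g \<otimes> h \<otimes> inv g) \<otimes> inv (g \<otimes> k \<otimes> inv g)"
proof -
  have *: "inv g \<otimes> (g \<otimes> x) = x" if "x \<in> carrier G" for x
    using assms(1) that by (simp flip: m_assoc)
  show ?thesis using assms by (simp add: inv_mult_group m_assoc *)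
qed

lemma commutator_subgroup_normal:
  assumes "K \<lhd> G"
  shows "commutator_subgroup G K (carrier G) \<lhd> G"
  unfolding commutator_subgroup_def
proof (rule normal_generateI)
  interpret K: normal K G by fact
  show "{h \<otimes> k \<otimes> inv h \<otimes> inv k |h k. h \<in> K \<and> k \<in> carrier G} \<subseteq> carrier G"
    using K.subset by auto
  fix c g assume "c \<in> {h \<otimes> k \<otimes> inv h \<otimes> inv k |h k. h \<in> K \<and> k \<in> carrier G}" and g: "g \<in> carrier G"
  then obtain h k where c: "c = h \<otimes> k \<otimes> inv h \<otimes> inv k" and h: "h \<in> K" and k: "k \<in> carrier G" by blast
  have "g \<otimes> h \<otimes> inv g \<in> K" "g \<otimes> k \<otimes> inv g \<in> carrier G"
    using K.inv_op_closed2[OF g h] g k by simp_all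
  then show "g \<otimes> c \<otimes> inv g \<in> {h \<otimes> k \<otimes> inv h \<otimes> inv k |h k. h \<in> K \<and> k \<in> carrier G}"
    unfolding c commutator_conjugate[OF g subsetD[OF K.subset h] k] by blast
qed

lemma lower_central_normal: "lower_central G n \<lhd> G"
proof (induction n)
  case (Suc n)
  then show ?case using normal_self commutator_subgroup_normal by (cases n) auto
qed (simp add: normal_self)

lemma lower_central_mono: "lower_central G (Suc n) \<subseteq> lower_central G n"
proof (induction n)
  case (Suc n)
  show ?case
  proof (cases n)
    case 0
    then show ?thesis using normal_imp_subgroup[OF lower_central_normal[of "Suc (Suc 0)"]] subgroup.subset by auto
  next
    case (Suc m)
    then show ?thesis using Suc.IH commutator_subgroup_mono by (simp del: lower_central.simps add: lower_central.simps(3))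
  qed
qed simp

lemma lower_central_antimono: "m \<le> n \<Longrightarrow> lower_central G n \<subseteq> lower_central G m"
  by (rule lift_Suc_antimono_le[of "lower_central G"]) (rule lower_central_mono)

lemma commutator_in_commutator_subgroup:
  "h \<in> H \<Longrightarrow> k \<in> K \<Longrightarrow> h \<otimes> k \<otimes> inv h \<otimes> inv k \<in> commutator_subgroup G H K"
  unfolding commutator_subgroup_def by (intro generate.incl) blast

lemma commutator_central_factors:
  assumes "c \<in> carrier G" "d \<in> carrier G" "a \<in> carrier G" "b \<in> carrier G"
    and c: "\<And>x. x \<in> carrier G \<Longrightarrow> c \<otimes> x = x \<otimes> c" and d: "\<And>x. x \<in> carrier G \<Longrightarrow> d \<otimes> x = x \<otimes> d"
  shows "(c \<otimes> a) \<otimes> (d \<otimes> b) \<otimes> inv (c \<otimes> a) \<otimes> inv (d \<otimes> b) = a \<otimes> b \<otimes> inv a \<otimes> inv b"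
proof -
  let ?w = "a \<otimes> b \<otimes> inv a \<otimes> inv b"
  have w: "?w \<in> carrier G" "?w \<otimes> (b \<otimes> a) = a \<otimes> b"
    using assms(1-4) by (simp_all add: m_assoc inv_solve_left')
  have "(c \<otimes> a) \<otimes> (d \<otimes> b) = c \<otimes> (a \<otimes> d) \<otimes> b" using assms(1-4) by (simp add: m_assoc)
  also have "\<dots> = c \<otimes> (d \<otimes> a) \<otimes> b" using d assms(3) by simp
  also have "\<dots> = (c \<otimes> d) \<otimes> (?w \<otimes> (b \<otimes> a))" unfolding w(2) using assms(1-4) by (simp add: m_assoc)
  also have "\<dots> = ((c \<otimes> d) \<otimes> ?w) \<otimes> (b \<otimes> a)" using assms(1-4) by (simp add: m_assoc)
  also have "(c \<otimes> d) \<otimes> ?w = ?w \<otimes> (c \<otimes> d)"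
    using c[OF w(1)] d[OF w(1)] assms(1,2) w(1) by (metis m_assoc)
  also have "?w \<otimes> (c \<otimes> d) \<otimes> (b \<otimes> a) = ?w \<otimes> ((d \<otimes> b) \<otimes> (c \<otimes> a))"
  proof -
    have "(c \<otimes> d) \<otimes> (b \<otimes> a) = (d \<otimes> b) \<otimes> (c \<otimes> a)"
      using c[of "d \<otimes> b"] assms(1-4) by (simp flip: m_assoc)
    then show ?thesis using assms(1-4) w(1) by (simp add: m_assoc)
  qed
  finally have *: "(c \<otimes> a) \<otimes> (d \<otimes> b) = ?w \<otimes> ((d \<otimes> b) \<otimes> (c \<otimes> a))" .
  have "inv (d \<otimes> b \<otimes> (c \<otimes> a)) = inv (c \<otimes> a) \<otimes> inv (d \<otimes> b)"
    using assms(1-4) by (simp add: inv_mult_group)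
  then have "(c \<otimes> a) \<otimes> (d \<otimes> b) \<otimes> inv (c \<otimes> a) \<otimes> inv (d \<otimes> b)
      = (c \<otimes> a) \<otimes> (d \<otimes> b) \<otimes> inv (d \<otimes> b \<otimes> (c \<otimes> a))"
    using assms(1-4) by (simp add: m_assoc)
  also have "\<dots> = ?w" unfolding * using assms(1-4) w(1) by (simp add: m_assoc)
  finally show ?thesis .
qed

lemma quotient_central:
  assumes K: "K \<lhd> G" and k: "k \<in> K"
    and X: "X \<in> carrier (G Mod commutator_subgroup G K (carrier G))"
  shows "(commutator_subgroup G K (carrier G) #> k) \<otimes>\<^bsub>G Mod commutator_subgroup G K (carrier G)\<^esub> X
    = X \<otimes>\<^bsub>G Mod commutator_subgroup G K (carrier G)\<^esub> (commutator_subgroup G K (carrier G) #> k)"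
proof -
  let ?N = "commutator_subgroup G K (carrier G)"
  interpret N: normal ?N G by (rule commutator_subgroup_normal[OF K])
  have kG: "k \<in> carrier G" using K k normal_imp_subgroup subgroup.mem_carrier by metis
  obtain g where g: "g \<in> carrier G" "X = ?N #> g" using X by (auto simp: carrier_FactGroup)
  have "?N #> (k \<otimes> g) = ?N #> (g \<otimes> k)"
  proof (rule repr_independence[symmetric])
    show "k \<otimes> g \<in> ?N #> (g \<otimes> k)"
    proof -
      have "k \<otimes> g = (k \<otimes> g \<otimes> inv k \<otimes> inv g) \<otimes> (g \<otimes> k)"
        using kG g(1) by (simp add: m_assoc inv_solve_left')
      then show ?thesis
        using commutator_in_commutator_subgroup[OF k g(1)] unfolding r_coset_def by blast
    qed
  qed (use kG g N.is_subgroup in auto)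
  then show ?thesis
    unfolding mult_FactGroup g(2) using N.rcos_sum kG g(1) by simp
qed

end

text \<open>
  The cell \<open>[e]\<close> is homologous to the image of a 1-chain of \<open>G\<close>, and sending \<open>[g]\<close> to the class of \<open>g\<close>
  in the abelianization is well defined modulo boundaries.
\<close>

lemma HZ_map_dense_derived:
  assumes HZ: "HZ_map G E f" and e: "e \<in> carrier E"
  obtains x k where "x \<in> carrier G" "k \<in> derived E (carrier E)" "e = k \<otimes>\<^bsub>E\<^esub> f x"
proof -
  interpret G: group G by (rule HZ_mapD(1)[OF HZ])
  interpret E: group E by (rule HZ_mapD(2)[OF HZ])
  note f = HZ_mapD(3)[OF HZ]
  let ?D = "derived E (carrier E)"
  interpret D: normal ?D E by (rule E.derived_self_is_normal)
  define A where "A = E Mod ?D"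
  define \<pi> where "\<pi> = (\<lambda>e. ?D #>\<^bsub>E\<^esub> e)"
  interpret A: comm_group A unfolding A_def by (rule E.derived_quot_is_comm_group)
  have \<pi>: "\<pi> \<in> hom E A" unfolding \<pi>_def A_def by (rule D.r_coset_hom_Mod)
  have "(\<lambda>xs. \<pi> (hd xs)) ` bar_cells E 1 \<subseteq> carrier A"
    unfolding bar_cells_1 using hom_in_carrier[OF \<pi>] by auto
  then obtain h where h: "h \<in> hom (bar_chains E 1) A"
    and h_cell: "\<And>xs. xs \<in> bar_cells E 1 \<Longrightarrow> h (frag_of xs) = \<pi> (hd xs)"
    using A.free_Abelian_group_universal[of _ "bar_cells E 1"] unfolding bar_chains_def by blast
  note h_diff = hom_bar_chains_diff[OF A.is_group h]
  have cell1: "frag_of [g] \<in> carrier (bar_chains E 1)" "h (frag_of [g]) = \<pi> g" if "g \<in> carrier E" for g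
    using that h_cell[of "[g]"] unfolding bar_chains_closed bar_cells_1 by auto
  have h_zero: "h 0 = \<one>\<^bsub>A\<^esub>"
    using hom_one[OF h comm_group.axioms(2)[OF comm_group_bar_chains] A.is_group] by simp
  have Suc1: "Suc 1 = 2" by simp
  have h_boundary: "h (bar_boundary E c) = \<one>\<^bsub>A\<^esub>" if "c \<in> carrier (bar_chains E 2)" for c
    using that
  proof (induction rule: bar_chains_induct)
    case zero
    show ?case using h_zero by simp
  next
    case (cell xs)
    then obtain x y where xs: "xs = [x, y]" and x: "x \<in> carrier E" and y: "y \<in> carrier E"
      unfolding bar_cells_2 by blast
    have "h (bar_boundary E (frag_of xs)) = h ((frag_of [x] + frag_of [y]) - frag_of [x \<otimes>\<^bsub>E\<^esub> y])"
      by (simp add: xs bar_boundary_cell_2 algebra_simps)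
    also have "\<dots> = h (frag_of [x] + frag_of [y]) \<otimes>\<^bsub>A\<^esub> inv\<^bsub>A\<^esub> h (frag_of [x \<otimes>\<^bsub>E\<^esub> y])"
      by (intro h_diff bar_chains_closed(2) cell1(1) x y E.m_closed)
    also have "h (frag_of [x] + frag_of [y]) = \<pi> (x \<otimes>\<^bsub>E\<^esub> y)"
      using hom_mult[OF h cell1(1)[OF x] cell1(1)[OF y]] cell1(2)[OF x] cell1(2)[OF y] hom_mult[OF \<pi> x y] by simp
    finally show ?case
      using cell1(2)[OF E.m_closed[OF x y]] hom_in_carrier[OF \<pi> E.m_closed[OF x y]] by simp
  next
    case (diff a b)
    have ab: "bar_boundary E a \<in> carrier (bar_chains E 1)" "bar_boundary E b \<in> carrier (bar_chains E 1)"
      using diff(1,2) by (auto intro!: bar_boundary_in_bar_chains[OF E.is_group] simp: Suc1 simp del: One_nat_def)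
    show ?case by (simp add: h_diff[OF ab] diff(3,4))
  qed
  have h_f: "\<exists>x\<in>carrier G. h (chain_map f d) = \<pi> (f x)" if "d \<in> carrier (bar_chains G 1)" for d
    using that
  proof (induction rule: bar_chains_induct)
    case zero
    have "h (chain_map f 0) = \<pi> (f \<one>\<^bsub>G\<^esub>)"
      using h_zero hom_one[OF f G.is_group E.is_group] hom_one[OF \<pi> E.is_group A.is_group] by simp
    then show ?case using G.one_closed by blast
  next
    case (cell xs)
    then obtain x where x: "xs = [x]" "x \<in> carrier G" unfolding bar_cells_1 by blast
    then have "h (chain_map f (frag_of xs)) = \<pi> (f x)"
      using cell1(2)[OF hom_in_carrier[OF f x(2)]] by simp
    then show ?case using x(2) by blast
  next
    case (diff a b)
    then obtain x y where x: "x \<in> carrier G" "h (chain_map f a) = \<pi> (f x)"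
      and y: "y \<in> carrier G" "h (chain_map f b) = \<pi> (f y)" by blast
    interpret \<pi>f: group_hom G A "\<pi> \<circ> f"
      using hom_compose[OF f \<pi>] by (simp add: group_hom_def group_hom_axioms_def)
    have "h (chain_map f (a - b)) = \<pi> (f x) \<otimes>\<^bsub>A\<^esub> inv\<^bsub>A\<^esub> \<pi> (f y)"
      unfolding frag_extend_diff x(2)[symmetric] y(2)[symmetric]
      by (rule h_diff[OF chain_map_in_bar_chains[OF f diff(1)] chain_map_in_bar_chains[OF f diff(2)]])
    also have "\<dots> = \<pi> (f (x \<otimes>\<^bsub>G\<^esub> inv\<^bsub>G\<^esub> y))"
      using \<pi>f.hom_mult[OF x(1) G.inv_closed[OF y(1)]] \<pi>f.hom_inv[OF y(1)] by simp
    finally show ?case using x(1) y(1) by blast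
  qed
  obtain d where d: "d \<in> carrier (bar_chains G 1)" "frag_of [e] - chain_map f d \<in> bar_boundaries E 1"
    using HZ_map_H1_surj[OF HZ cell1(1)[OF e]] .
  obtain x where x: "x \<in> carrier G" "h (chain_map f d) = \<pi> (f x)" using h_f[OF d(1)] by blast
  have fx: "f x \<in> carrier E" by (rule hom_in_carrier[OF f x(1)])
  have "h (frag_of [e] - chain_map f d) = \<one>\<^bsub>A\<^esub>"
    using d(2) unfolding bar_boundaries_def Suc1 by (elim imageE) (simp only: h_boundary)
  then have "\<pi> e \<otimes>\<^bsub>A\<^esub> inv\<^bsub>A\<^esub> \<pi> (f x) = \<one>\<^bsub>A\<^esub>"
    using h_diff[OF cell1(1)[OF e] chain_map_in_bar_chains[OF f d(1)]] cell1(2)[OF e] x(2) by simp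
  then have "\<pi> e = \<pi> (f x)"
    using hom_in_carrier[OF \<pi> e] hom_in_carrier[OF \<pi> fx] by (metis A.inv_equality A.inv_closed A.inv_inv)
  then have "e \<in> ?D #>\<^bsub>E\<^esub> f x"
    unfolding \<pi>_def using E.rcos_self[OF e D.is_subgroup] by simp
  then obtain k where "k \<in> ?D" "e = k \<otimes>\<^bsub>E\<^esub> f x" unfolding r_coset_def by blast
  then show thesis using x(1) that by blast
qed

text \<open>
  Modulo \<open>[K, E]\<close> the subgroup \<open>K\<close> is central.  Every element of \<open>E\<close> is a product of an element
  of \<open>K\<close> and one of \<open>f(G)\<close>, so a commutator of elements of \<open>E\<close> is congruent to a commutator of elements
  of \<open>f(G)\<close>.  As \<open>K\<close> consists of products of commutators, \<open>K\<close> lies in \<open>f(G)\<close> modulo \<open>[K, E]\<close>.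
\<close>

lemma dense_commutator_step:
  assumes "group G" "group E" and f: "f \<in> hom G E"
    and K: "K \<lhd> E" and K_derived: "K \<subseteq> derived E (carrier E)"
    and dense: "\<And>e. e \<in> carrier E \<Longrightarrow> \<exists>x\<in>carrier G. \<exists>k\<in>K. e = k \<otimes>\<^bsub>E\<^esub> f x"
    and e: "e \<in> carrier E"
  shows "\<exists>x\<in>carrier G. \<exists>k\<in>commutator_subgroup E K (carrier E). e = k \<otimes>\<^bsub>E\<^esub> f x"
proof -
  interpret G: group G by fact
  interpret E: group E by fact
  let ?N = "commutator_subgroup E K (carrier E)"
  interpret N: normal ?N E by (rule E.commutator_subgroup_normal[OF K])
  define Q where "Q = E Mod ?N"
  define \<pi> where "\<pi> = (\<lambda>e. ?N #>\<^bsub>E\<^esub> e)"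
  interpret Q: group Q unfolding Q_def by (rule N.factorgroup_is_group)
  interpret \<pi>: group_hom E Q \<pi>
    using N.r_coset_hom_Mod by (simp add: group_hom_def group_hom_axioms_def Q_def \<pi>_def Q.is_group[unfolded Q_def])
  have K_sub: "K \<subseteq> carrier E" using normal_imp_subgroup[OF K] subgroup.subset by blast
  have central: "\<pi> k \<otimes>\<^bsub>Q\<^esub> X = X \<otimes>\<^bsub>Q\<^esub> \<pi> k" if "k \<in> K" "X \<in> carrier Q" for k X
    using E.quotient_central[OF K that(1)] that(2) unfolding Q_def \<pi>_def by blast
  have fc: "f x \<in> carrier E" if "x \<in> carrier G" for x using hom_in_carrier[OF f that] .
  interpret \<pi>f: group_hom G Q "\<pi> \<circ> f"
    using hom_compose[OF f \<pi>.homh] by (simp add: group_hom_def group_hom_axioms_def)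
  let ?D = "(\<pi> \<circ> f) ` carrier G"
  have D: "subgroup ?D Q" by (rule \<pi>f.img_is_subgroup)
  have "subgroup {e \<in> carrier E. \<pi> e \<in> ?D} E"
  proof (rule E.subgroupI)
    have "\<one>\<^bsub>E\<^esub> \<in> {e \<in> carrier E. \<pi> e \<in> ?D}"
      using subgroup.one_closed[OF D] by (simp only: mem_Collect_eq E.one_closed \<pi>.hom_one simp_thms)
    then show "{e \<in> carrier E. \<pi> e \<in> ?D} \<noteq> {}" by blast
  next
    fix a b assume a: "a \<in> {e \<in> carrier E. \<pi> e \<in> ?D}" and b: "b \<in> {e \<in> carrier E. \<pi> e \<in> ?D}"
    then show "a \<otimes>\<^bsub>E\<^esub> b \<in> {e \<in> carrier E. \<pi> e \<in> ?D}"
      using subgroup.m_closed[OF D] by (simp only: mem_Collect_eq E.m_closed \<pi>.hom_mult simp_thms)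
  next
    fix a assume a: "a \<in> {e \<in> carrier E. \<pi> e \<in> ?D}"
    then show "inv\<^bsub>E\<^esub> a \<in> {e \<in> carrier E. \<pi> e \<in> ?D}"
      using subgroup.m_inv_closed[OF D] by (simp only: mem_Collect_eq E.inv_closed \<pi>.hom_inv simp_thms)
  qed blast
  moreover have "derived_set E (carrier E) \<subseteq> {e \<in> carrier E. \<pi> e \<in> ?D}"
  proof
    fix c assume "c \<in> derived_set E (carrier E)"
    then obtain u v where u: "u \<in> carrier E" and v: "v \<in> carrier E"
      and c: "c = u \<otimes>\<^bsub>E\<^esub> v \<otimes>\<^bsub>E\<^esub> inv\<^bsub>E\<^esub> u \<otimes>\<^bsub>E\<^esub> inv\<^bsub>E\<^esub> v" by blast
    obtain x k where x: "x \<in> carrier G" "k \<in> K" "u = k \<otimes>\<^bsub>E\<^esub> f x" using dense[OF u] by blast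
    obtain y l where y: "y \<in> carrier G" "l \<in> K" "v = l \<otimes>\<^bsub>E\<^esub> f y" using dense[OF v] by blast
    have kl: "k \<in> carrier E" "l \<in> carrier E" using x(2) y(2) K_sub by auto
    have pu: "\<pi> u = \<pi> k \<otimes>\<^bsub>Q\<^esub> \<pi> (f x)" "\<pi> v = \<pi> l \<otimes>\<^bsub>Q\<^esub> \<pi> (f y)"
      using x y kl fc by simp_all
    have "\<pi> c = \<pi> u \<otimes>\<^bsub>Q\<^esub> \<pi> v \<otimes>\<^bsub>Q\<^esub> inv\<^bsub>Q\<^esub> \<pi> u \<otimes>\<^bsub>Q\<^esub> inv\<^bsub>Q\<^esub> \<pi> v" unfolding c using u v by simp
    also have "\<dots> = \<pi> (f x) \<otimes>\<^bsub>Q\<^esub> \<pi> (f y) \<otimes>\<^bsub>Q\<^esub> inv\<^bsub>Q\<^esub> \<pi> (f x) \<otimes>\<^bsub>Q\<^esub> inv\<^bsub>Q\<^esub> \<pi> (f y)"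
      unfolding pu
      by (rule Q.commutator_central_factors[OF \<pi>.hom_closed[OF kl(1)] \<pi>.hom_closed[OF kl(2)]
            \<pi>.hom_closed[OF fc[OF x(1)]] \<pi>.hom_closed[OF fc[OF y(1)]] central[OF x(2)] central[OF y(2)]])
    also have "\<dots> = (\<pi> \<circ> f) (x \<otimes>\<^bsub>G\<^esub> y \<otimes>\<^bsub>G\<^esub> inv\<^bsub>G\<^esub> x \<otimes>\<^bsub>G\<^esub> inv\<^bsub>G\<^esub> y)"
      using x(1) y(1) \<pi>f.hom_mult \<pi>f.hom_inv by simp
    finally have "\<pi> c \<in> ?D" using x(1) y(1) by (simp only:) (intro imageI; simp)
    moreover have "c \<in> carrier E" unfolding c using u v by simp
    ultimately show "c \<in> {e \<in> carrier E. \<pi> e \<in> ?D}" by blast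
  qed
  ultimately have K_D: "K \<subseteq> {e \<in> carrier E. \<pi> e \<in> ?D}"
    using K_derived E.generate_subgroup_incl unfolding derived_def by blast
  obtain x k where x: "x \<in> carrier G" "k \<in> K" "e = k \<otimes>\<^bsub>E\<^esub> f x" using dense[OF e] by blast
  obtain y where y: "y \<in> carrier G" "\<pi> k = \<pi> (f y)" using K_D x(2) by auto
  have "\<pi> e = \<pi> (f (y \<otimes>\<^bsub>G\<^esub> x))"
    using x y K_sub fc hom_mult[OF f y(1) x(1)] by auto
  then have "e \<in> ?N #>\<^bsub>E\<^esub> f (y \<otimes>\<^bsub>G\<^esub> x)"
    unfolding \<pi>_def using E.rcos_self[OF e N.is_subgroup] by simp
  then show ?thesis unfolding r_coset_def using x(1) y(1) by blast
qed

text \<open>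
  The step is applied to \<open>K = \<gamma>\<^sub>2(E), \<gamma>\<^sub>3(E), \<dots>\<close> in turn; the start \<open>n = 0\<close> is surjectivity on
  \<open>H\<^sub>1\<close>.
\<close>

lemma HZ_map_dense:
  assumes HZ: "HZ_map G E f" and e: "e \<in> carrier E"
  shows "\<exists>x\<in>carrier G. \<exists>k\<in>lower_central E (Suc (Suc n)). e = k \<otimes>\<^bsub>E\<^esub> f x"
  using e
proof (induction n arbitrary: e)
  case 0
  then show ?case using HZ_map_dense_derived[OF HZ 0] by (metis commutator_subgroup_carrier lower_central.simps(2,3))
next
  case (Suc n)
  interpret E: group E by (rule HZ_mapD(2)[OF HZ])
  have "lower_central E (Suc (Suc n)) \<subseteq> derived E (carrier E)"
    using E.lower_central_antimono[of "Suc (Suc 0)" "Suc (Suc n)"] by (simp add: commutator_subgroup_carrier)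
  then show ?case
    unfolding lower_central.simps(3)[of E "Suc n"]
    by (intro dense_commutator_step[OF HZ_mapD(1-3)[OF HZ] E.lower_central_normal _ Suc.IH Suc.prems])
qed

text \<open>
  Since \<open>x\<close> and \<open>a\<close> commute, \<open>[k x, a] = [k, a]\<close>.
\<close>

lemma (in group) commutator_in_next_lower_central:
  assumes k: "k \<in> lower_central G (Suc n)" and x: "x \<in> carrier G" and a: "a \<in> carrier G"
    and comm: "x \<otimes> a = a \<otimes> x"
  shows "(k \<otimes> x) \<otimes> a \<otimes> inv (k \<otimes> x) \<otimes> inv a \<in> lower_central G (Suc (Suc n))"
proof -
  let ?N = "lower_central G (Suc (Suc n))"
  interpret N: normal ?N G by (rule lower_central_normal)
  have kG: "k \<in> carrier G" using k normal_imp_subgroup[OF lower_central_normal] subgroup.mem_carrier by metis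
  have c: "k \<otimes> a \<otimes> inv k \<otimes> inv a \<in> ?N"
    using commutator_in_commutator_subgroup[OF k a] by simp
  have "(k \<otimes> x) \<otimes> a \<otimes> inv (k \<otimes> x) \<otimes> inv a = k \<otimes> (x \<otimes> a \<otimes> inv x) \<otimes> inv k \<otimes> inv a"
    using kG x a by (simp add: inv_mult_group m_assoc)
  also have "x \<otimes> a \<otimes> inv x = a" unfolding comm using x a by (simp add: m_assoc)
  finally show ?thesis using c by simp
qed

section \<open>The transfinite lower central series up to omega plus one\<close>

lemma ord_succ_simps [simp]:
  "(Some x, Some y) \<in> ord_succ r \<longleftrightarrow> (x, y) \<in> r"
  "(None, Some y) \<notin> ord_succ r"
  "(w, None) \<in> ord_succ r \<longleftrightarrow> w \<in> insert None (Some ` Field r)"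
  by (auto simp: ord_succ_def)

lemma Field_ord_succ: "Field (ord_succ r) = insert None (Some ` Field r)"
proof
  show "Field (ord_succ r) \<subseteq> insert None (Some ` Field r)"
  proof
    fix x assume "x \<in> Field (ord_succ r)"
    then obtain y where "(x, y) \<in> ord_succ r \<or> (y, x) \<in> ord_succ r" by (auto simp: Field_def)
    then show "x \<in> insert None (Some ` Field r)"
      by (cases x; cases y) (auto intro: FieldI1 FieldI2)
  qed
  show "insert None (Some ` Field r) \<subseteq> Field (ord_succ r)"
    using FieldI1[of _ None "ord_succ r"] by auto
qed

text \<open>
  Well-foundedness is inherited from the lexicographic product that puts the new element, tagged \<open>1\<close>,
  above the old ones, tagged \<open>0\<close>.
\<close>

lemma Well_order_ord_succ:
  assumes "Well_order r"
  shows "Well_order (ord_succ r)"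
proof -
  have r: "refl_on (Field r) r" "trans r" "antisym r" "total_on (Field r) r" "wf (r - Id)"
    using assms by (simp_all add: order_on_defs)
  have "refl_on (Field (ord_succ r)) (ord_succ r)"
    using r(1) unfolding refl_on_def Field_ord_succ by auto
  moreover have "trans (ord_succ r)"
  proof (rule transI)
    fix x y z assume "(x, y) \<in> ord_succ r" "(y, z) \<in> ord_succ r"
    then show "(x, z) \<in> ord_succ r"
      using transD[OF r(2)] by (cases x; cases y; cases z) (auto intro: FieldI1)
  qed
  moreover have "antisym (ord_succ r)"
  proof (rule antisymI)
    fix x y assume "(x, y) \<in> ord_succ r" "(y, x) \<in> ord_succ r"
    then show "x = y" using antisymD[OF r(3)] by (cases x; cases y) auto
  qed
  moreover have "total_on (Field (ord_succ r)) (ord_succ r)"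
    using r(4) unfolding total_on_def Field_ord_succ by auto
  moreover have "wf (ord_succ r - Id)"
  proof (rule wf_subset)
    let ?f = "\<lambda>x. case x of None \<Rightarrow> (1::nat, undefined) | Some y \<Rightarrow> (0, y)"
    show "wf (inv_image (less_than <*lex*> (r - Id)) ?f)"
      using r(5) by (intro wf_inv_image wf_lex_prod) auto
    show "ord_succ r - Id \<subseteq> inv_image (less_than <*lex*> (r - Id)) ?f"
    proof
      fix p assume p: "p \<in> ord_succ r - Id"
      obtain x y where "p = (x, y)" by (cases p)
      then show "p \<in> inv_image (less_than <*lex*> (r - Id)) ?f"
        using p by (cases x; cases y) auto
    qed
  qed
  moreover have "ord_succ r \<subseteq> Field (ord_succ r) \<times> Field (ord_succ r)"
    by (auto intro: FieldI1 FieldI2)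
  ultimately show ?thesis by (simp add: order_on_defs)
qed

lemma Well_order_omega_plus_2: "Well_order omega_plus_2"
  by (intro Well_order_ord_succ natLeq_Well_order)

lemma omega_plus_2_iff:
  "(x, y) \<in> omega_plus_2 \<longleftrightarrow>
     (case y of None \<Rightarrow> True | Some None \<Rightarrow> x \<noteq> None | Some (Some n) \<Rightarrow> \<exists>m\<le>n. x = Some (Some m))"
  by (cases x rule: option.exhaust[case_product option.exhaust[of "the x"]];
      cases y rule: option.exhaust[case_product option.exhaust[of "the y"]])
     (auto simp: Field_ord_succ Field_natLeq[unfolded natLeq_def] natLeq_def image_iff)

text \<open>
  The terms of the series indexed by the elements of \<open>\<omega> + 2\<close>: an element stands for the ordinal of its
  strict predecessors, so the top element \<open>None\<close> stands for \<open>\<omega> + 1\<close>.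
\<close>

fun lcs_omega_plus_1 :: "('a, 'b) monoid_scheme \<Rightarrow> nat option option \<Rightarrow> 'a set" where
  "lcs_omega_plus_1 G (Some (Some n)) = lower_central G n"
| "lcs_omega_plus_1 G (Some None) = (\<Inter>n. lower_central G n)"
| "lcs_omega_plus_1 G None = commutator_subgroup G (\<Inter>n. lower_central G n) (carrier G)"

context group
begin

lemma lower_central_carrier: "lower_central G n \<subseteq> carrier G"
  using normal_imp_subgroup[OF lower_central_normal] subgroup.subset by blast

lemma lcs_omega_plus_1_antimono:
  assumes "(x, y) \<in> omega_plus_2"
  shows "lcs_omega_plus_1 G y \<subseteq> lcs_omega_plus_1 G x"
proof -
  have "commutator_subgroup G (\<Inter>n. lower_central G n) (carrier G) \<subseteq> lower_central G (Suc (Suc n))" for n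
    by (simp, rule commutator_subgroup_mono) auto
  then have top: "commutator_subgroup G (\<Inter>n. lower_central G n) (carrier G) \<subseteq> lower_central G n" for n
    using lower_central_antimono[of n "Suc (Suc n)"] by (meson le_SucI order.trans order_refl)
  consider "y = None" | "y = Some None" "x \<noteq> None" | m n where "y = Some (Some n)" "x = Some (Some m)" "m \<le> n"
    using assms unfolding omega_plus_2_iff by (auto split: option.splits)
  then show ?thesis
  proof cases
    case 1
    then show ?thesis
      using top by (cases "(G, x)" rule: lcs_omega_plus_1.cases) auto
  next
    case 2
    then show ?thesis by (cases "(G, x)" rule: lcs_omega_plus_1.cases) auto
  next
    case 3
    then show ?thesis using lower_central_antimono by simp
  qed
qed

lemma lcs_omega_plus_1_carrier: "lcs_omega_plus_1 G x \<subseteq> carrier G"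
  using lcs_omega_plus_1_antimono[of "Some (Some 0)" x]
  by (cases x rule: option.exhaust[case_product option.exhaust[of "the x"]]) (auto simp: omega_plus_2_iff)

text \<open>
  An order isomorphism \<open>f\<close> from the initial segment \<open>A\<close> of \<open>\<tau>\<close> onto the predecessors of \<open>a\<close> in
  \<open>\<omega> + 2\<close> transports a lower bound for the terms below to a lower bound for the next term.  A greatest
  element \<open>m\<close> of \<open>A\<close> corresponds to a greatest predecessor of \<open>a\<close>; it exists if \<open>a\<close> stands for a
  positive finite number or for \<open>\<omega> + 1\<close>, but not for \<open>\<omega>\<close>.
\<close>

lemma lcs_step_lower_bound:
  assumes \<tau>: "Well_order \<tau>" and A: "A \<subseteq> Field \<tau>"
    and inj: "inj_on f A" and img: "f ` A = underS omega_plus_2 a"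
    and mono: "\<And>i j. i \<in> A \<Longrightarrow> j \<in> A \<Longrightarrow> (i, j) \<in> \<tau> \<Longrightarrow> (f i, f j) \<in> omega_plus_2"
    and g: "\<And>j. j \<in> A \<Longrightarrow> lcs_omega_plus_1 G (f j) \<subseteq> g j"
  shows "lcs_omega_plus_1 G a \<subseteq> lcs_step G \<tau> A g"
proof -
  have below: "(f j, a) \<in> omega_plus_2" if "j \<in> A" for j
    using that img by (auto simp: underS_def)
  consider "\<exists>x. A \<subseteq> {x}" | m where "\<nexists>x. A \<subseteq> {x}" "m \<in> A" "\<forall>j\<in>A. (j, m) \<in> \<tau>"
    | "\<nexists>x. A \<subseteq> {x}" "\<not> (\<exists>m\<in>A. \<forall>j\<in>A. (j, m) \<in> \<tau>)" by blast
  then show ?thesis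
  proof cases
    case 1
    then show ?thesis using lcs_omega_plus_1_carrier by (simp add: lcs_step_def)
  next
    case (2 m)
    have "(THE m. m \<in> A \<and> (\<forall>j\<in>A. (j, m) \<in> \<tau>)) = m"
      using 2(2,3) \<tau> by (intro the_equality) (auto simp: order_on_defs antisym_def)
    then have step: "lcs_step G \<tau> A g = commutator_subgroup G (g m) (carrier G)"
      using 2 unfolding lcs_step_def by auto
    have max: "(b, f m) \<in> omega_plus_2" if "b \<in> underS omega_plus_2 a" for b
      using that 2(2,3) mono unfolding img[symmetric] by auto
    have fm: "f m \<in> underS omega_plus_2 a" using 2(2) img by blast
    have "lcs_omega_plus_1 G a \<subseteq> commutator_subgroup G (lcs_omega_plus_1 G (f m)) (carrier G)"
    proof (cases a rule: option.exhaust[case_product option.exhaust[of "the a"]])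
      case None_None
      then have "(Some None, f m) \<in> omega_plus_2" "f m \<noteq> None"
        using max[of "Some None"] fm by (auto simp: underS_def omega_plus_2_iff)
      then have "f m = Some None" by (cases "f m") (auto simp: omega_plus_2_iff split: option.splits)
      then show ?thesis using None_None by simp
    next
      case (None_Some x)
      then have "(Some None, f m) \<in> omega_plus_2" "f m \<noteq> None"
        using max[of "Some None"] fm by (auto simp: underS_def omega_plus_2_iff)
      then have "f m = Some None" by (cases "f m") (auto simp: omega_plus_2_iff split: option.splits)
      then show ?thesis using None_Some by simp
    next
      case (Some_None x)
      then have a: "a = Some None" by simp
      then obtain k where k: "f m = Some (Some k)"
        using fm by (cases "f m" rule: option.exhaust[case_product option.exhaust[of "the (f m)"]])
          (auto simp: underS_def omega_plus_2_iff)
      have "Some (Some (Suc k)) \<in> underS omega_plus_2 a"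
        by (simp add: a underS_def omega_plus_2_iff)
      from max[OF this] show ?thesis by (auto simp: k omega_plus_2_iff)
    next
      case (Some_Some x n)
      then have a: "a = Some (Some n)" by simp
      then obtain k where k: "f m = Some (Some k)" "k < n"
        using fm by (auto simp: underS_def omega_plus_2_iff)
      have "Some (Some (n - 1)) \<in> underS omega_plus_2 a"
        using k(2) by (auto simp: a underS_def omega_plus_2_iff)
      from max[OF this] have n: "n = Suc k" using k by (auto simp: omega_plus_2_iff)
      have "k \<noteq> 0"
      proof
        assume "k = 0"
        then have "f ` A \<subseteq> {f m}" using k n by (auto simp: img a underS_def omega_plus_2_iff)
        then have "A \<subseteq> {m}" using inj 2(2) by (auto dest: inj_onD)
        then show False using 2(1) by blast
      qed
      then obtain l where "k = Suc l" by (cases k) auto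
      then show ?thesis by (simp add: a n k)
    qed
    also have "\<dots> \<subseteq> commutator_subgroup G (g m) (carrier G)"
      using g[OF 2(2)] by (rule commutator_subgroup_mono) simp
    finally show ?thesis by (simp add: step)
  next
    case 3
    then have "lcs_step G \<tau> A g = (\<Inter>j\<in>A. g j)" unfolding lcs_step_def by auto
    moreover have "lcs_omega_plus_1 G a \<subseteq> g j" if "j \<in> A" for j
      using lcs_omega_plus_1_antimono[OF below[OF that]] g[OF that] by blast
    ultimately show ?thesis by blast
  qed
qed

lemma lcs_below_unfold:
  assumes "Well_order \<tau>"
  shows "lcs_below G \<tau> i = lcs_step G \<tau> (underS \<tau> i) (lcs_below G \<tau>)"
proof -
  have wo: "wo_rel \<tau>" using assms by (simp add: wo_rel_def)
  have "wo_rel.adm_wo \<tau> (\<lambda>g i. lcs_step G \<tau> (underS \<tau> i) g)"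
    unfolding wo_rel.adm_wo_def[OF wo]
  proof (intro allI impI)
    fix f g :: "'c \<Rightarrow> 'a set" and x assume eq: "\<forall>y\<in>underS \<tau> x. f y = g y"
    let ?A = "underS \<tau> x"
    show "lcs_step G \<tau> ?A f = lcs_step G \<tau> ?A g"
    proof (cases "\<exists>m\<in>?A. \<forall>j\<in>?A. (j, m) \<in> \<tau>")
      case True
      then obtain m where m: "m \<in> ?A" "\<forall>j\<in>?A. (j, m) \<in> \<tau>" by blast
      have "(THE m. m \<in> ?A \<and> (\<forall>j\<in>?A. (j, m) \<in> \<tau>)) = m"
        using m assms by (intro the_equality) (auto simp: order_on_defs antisym_def)
      then show ?thesis using True eq m(1) by (simp add: lcs_step_def)
    next
      case False
      then show ?thesis using eq by (auto simp: lcs_step_def)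
    qed
  qed
  from wo_rel.worec_fixpoint[OF wo this] show ?thesis
    unfolding lcs_below_def by (rule fun_cong)
qed

text \<open>
  A well-order that is not at least \<open>\<omega> + 2\<close> is isomorphic to a proper initial segment of it, and the
  series decreases.
\<close>

theorem transfinite_lcs_lower_bound:
  assumes \<tau>: "Well_order \<tau>" and small: "\<not> omega_plus_2 \<le>o \<tau>"
  shows "commutator_subgroup G (\<Inter>n. lower_central G n) (carrier G) \<subseteq> transfinite_lcs G \<tau>"
proof -
  have "\<tau> <o omega_plus_2"
    using small not_ordLeq_iff_ordLess[OF \<tau> Well_order_omega_plus_2] by blast
  then obtain a where a: "\<tau> =o Restr omega_plus_2 (underS omega_plus_2 a)"
    using ordLess_iff_ordIso_Restr[OF Well_order_omega_plus_2 \<tau>] by blast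
  have wo: "wo_rel omega_plus_2" using Well_order_omega_plus_2 by (simp add: wo_rel_def)
  let ?U = "underS omega_plus_2 a"
  have Field: "Field (Restr omega_plus_2 ?U) = ?U"
    by (rule Refl_Field_Restr2[OF wo_rel.REFL[OF wo]]) (auto simp: underS_def Field_def)
  obtain f where "BNF_Wellorder_Embedding.iso \<tau> (Restr omega_plus_2 ?U) f" using a unfolding ordIso_def by blast
  then have bij: "bij_betw f (Field \<tau>) ?U"
    and ord: "\<And>i j. i \<in> Field \<tau> \<Longrightarrow> j \<in> Field \<tau> \<Longrightarrow> (i, j) \<in> \<tau> \<longleftrightarrow> (f i, f j) \<in> Restr omega_plus_2 ?U"
    unfolding BNF_Wellorder_Embedding.iso_iff2 Field by auto
  have inj: "inj_on f (Field \<tau>)" using bij by (rule bij_betw_imp_inj_on)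
  have mono: "(f i, f j) \<in> omega_plus_2" if "(i, j) \<in> \<tau>" for i j
    using ord[of i j] that by (auto intro: FieldI1 FieldI2)
  have img: "f ` underS \<tau> i = underS omega_plus_2 (f i)" if i: "i \<in> Field \<tau>" for i
  proof
    show "f ` underS \<tau> i \<subseteq> underS omega_plus_2 (f i)"
    proof
      fix b assume "b \<in> f ` underS \<tau> i"
      then obtain j where j: "b = f j" "j \<noteq> i" "(j, i) \<in> \<tau>" by (auto simp: underS_def)
      then have "f j \<noteq> f i" using inj_onD[OF inj] i by (metis FieldI1)
      then show "b \<in> underS omega_plus_2 (f i)" using mono[OF j(3)] j(1) by (simp add: underS_def)
    qed
    show "underS omega_plus_2 (f i) \<subseteq> f ` underS \<tau> i"
    proof
      fix b assume b: "b \<in> underS omega_plus_2 (f i)"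
      have fi: "f i \<in> ?U" using bij i by (auto simp: bij_betw_def)
      have "b \<in> ?U"
        using b fi wo_rel.TRANS[OF wo] wo_rel.ANTISYM[OF wo] unfolding underS_def trans_def antisym_def by blast
      then obtain j where j: "j \<in> Field \<tau>" "b = f j" using bij by (auto simp: bij_betw_def)
      then have "(j, i) \<in> \<tau>" using ord[OF j(1) i] b fi \<open>b \<in> ?U\<close> by (simp add: underS_def)
      moreover have "j \<noteq> i" using b j by (auto simp: underS_def)
      ultimately show "b \<in> f ` underS \<tau> i" using j(2) by (auto simp: underS_def)
    qed
  qed
  have below: "lcs_omega_plus_1 G (f i) \<subseteq> lcs_below G \<tau> i" if "i \<in> Field \<tau>" for i
    using that
  proof (induction i rule: wf_induct[OF wo_rel.WF[of \<tau>, unfolded wo_rel_def, OF \<tau>]])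
    case (1 i)
    have sub: "underS \<tau> i \<subseteq> Field \<tau>" by (auto simp: underS_def Field_def)
    show ?case
      unfolding lcs_below_unfold[OF \<tau>, of i]
    proof (rule lcs_step_lower_bound[OF \<tau> sub inj_on_subset[OF inj sub] img[OF 1(2)] mono])
      fix j assume j: "j \<in> underS \<tau> i"
      then show "lcs_omega_plus_1 G (f j) \<subseteq> lcs_below G \<tau> j"
        using 1(1) sub by (auto simp: underS_def)
    qed
  qed
  have "lcs_omega_plus_1 G a \<subseteq> transfinite_lcs G \<tau>"
    unfolding transfinite_lcs_def
    by (rule lcs_step_lower_bound[OF \<tau> subset_refl inj _ mono below])
       (use bij in \<open>auto simp: bij_betw_def\<close>)
  moreover have "lcs_omega_plus_1 G None \<subseteq> lcs_omega_plus_1 G a"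
    by (rule lcs_omega_plus_1_antimono) (simp add: omega_plus_2_iff)
  ultimately show ?thesis by simp
qed

end

section \<open>Exponential power series\<close>

text \<open>
  The substitution \<open>u \<mapsto> -u\<close>; under \<open>t = e\<^sup>u\<close> it is the involution \<open>t \<mapsto> t\<^sup>-\<^sup>1\<close> of the group ring.
\<close>

definition fps_reflect :: "rat fps \<Rightarrow> rat fps" where
  "fps_reflect f = Abs_fps (\<lambda>n. (-1) ^ n * fps_nth f n)"

lemma fps_reflect_simps [simp]:
  "fps_reflect 0 = 0" "fps_reflect 1 = 1"
  "fps_reflect (f + g) = fps_reflect f + fps_reflect g"
  "fps_reflect (f - g) = fps_reflect f - fps_reflect g"
  "fps_reflect (fps_const c) = fps_const c"
  by (auto simp: fps_reflect_def fps_eq_iff algebra_simps)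

lemma fps_reflect_mult [simp]: "fps_reflect (f * g) = fps_reflect f * fps_reflect g"
proof (rule fps_ext)
  fix n
  have "(-1) ^ n * (f $ i * g $ (n - i)) = (-1) ^ i * f $ i * ((-1) ^ (n - i) * g $ (n - i))" if "i \<le> n" for i
  proof -
    have "(-1 :: rat) ^ n = (-1) ^ i * (-1) ^ (n - i)" using that by (simp flip: power_add)
    then show ?thesis by simp
  qed
  then have "(\<Sum>i=0..n. (-1) ^ n * (f $ i * g $ (n - i))) = (\<Sum>i=0..n. (-1) ^ i * f $ i * ((-1) ^ (n - i) * g $ (n - i)))"
    by (intro sum.cong) auto
  then show "fps_reflect (f * g) $ n = (fps_reflect f * fps_reflect g) $ n"
    by (simp add: fps_reflect_def fps_mult_nth sum_distrib_left)
qed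

lemma fps_reflect_exp [simp]: "fps_reflect (fps_exp c) = fps_exp (- c)"
  by (auto simp: fps_reflect_def fps_eq_iff power_minus[of c])

lemma fps_reflect_numeral [simp]: "fps_reflect (numeral k) = numeral k"
  unfolding numeral_fps_const by (rule fps_reflect_simps)

definition fps_scale :: "rat \<Rightarrow> rat fps \<Rightarrow> rat fps" where
  "fps_scale c f = fps_const c * f"

lemma vector_space_fps_scale: "vector_space fps_scale"
  by unfold_locales (simp_all add: fps_scale_def algebra_simps flip: fps_const_add fps_const_mult)

lemma vector_space_rat: "vector_space ((*) :: rat \<Rightarrow> rat \<Rightarrow> rat)"
  by unfold_locales (simp_all add: algebra_simps)

interpretation fps: vector_space fps_scale by (rule vector_space_fps_scale)

text \<open>
  Applying \<open>d/du - n\<close> to a relation between exponentials removes \<open>e\<^bsup>n u\<^esup>\<close> and multiplies the other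
  coefficients \<open>c\<^sub>k\<close> by \<open>k - n \<noteq> 0\<close>.
\<close>

lemma fps_exp_sum_eq_0:
  assumes "finite K" "(\<Sum>k\<in>K. fps_const (c k) * fps_exp (of_int k :: rat)) = 0" "k \<in> K"
  shows "c k = 0"
  using assms
proof (induction K arbitrary: c k rule: finite_induct)
  case (insert n K)
  let ?e = "\<lambda>k. fps_exp (of_int k :: rat)"
  let ?S = "\<Sum>k\<in>insert n K. fps_const (c k) * ?e k"
  have "fps_deriv ?S - fps_const (of_int n) * ?S = (\<Sum>k\<in>insert n K. fps_const (c k * (of_int k - of_int n)) * ?e k)"
    unfolding fps_deriv_sum sum_distrib_left sum_subtractf[symmetric]
    by (intro sum.cong) (simp_all add: algebra_simps flip: fps_const_mult fps_const_sub)
  also have "\<dots> = (\<Sum>k\<in>K. fps_const (c k * (of_int k - of_int n)) * ?e k)"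
    using insert.hyps by simp
  finally have "(\<Sum>k\<in>K. fps_const (c k * (of_int k - of_int n)) * ?e k) = 0"
    using insert.prems(1) by simp
  then have "c k * (of_int k - of_int n) = 0" if "k \<in> K" for k
    using insert.IH[of "\<lambda>k. c k * (of_int k - of_int n)"] that by blast
  then have K: "c k = 0" if "k \<in> K" for k
    using that insert.hyps(2) by (metis diff_eq_diff_eq eq_iff_diff_eq_0 mult_eq_0_iff of_int_eq_iff)
  then have "fps_const (c n) * ?e n = 0"
    using insert.prems(1) insert.hyps by simp
  then have "c n = 0" by simp
  then show ?case using K insert.prems(2) by auto
qed simp

text \<open>
  The rational Laurent polynomials in \<open>t = e\<^sup>u\<close>.
\<close>

abbreviation laurent_span :: "rat fps set" where
  "laurent_span \<equiv> fps.span (range (\<lambda>k::int. fps_exp (of_int k)))"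

lemma independent_fps_exp: "fps.independent (range (\<lambda>k::int. fps_exp (of_int k :: rat)))"
  unfolding fps.independent_explicit_finite_subsets
proof (intro allI impI ballI)
  let ?e = "\<lambda>k::int. fps_exp (of_int k :: rat)"
  fix S u v assume S: "S \<subseteq> range ?e" "finite S" and eq: "(\<Sum>v\<in>S. fps_scale (u v) v) = 0" and v: "v \<in> S"
  have inj: "inj ?e" by (simp add: inj_def)
  obtain K where K: "S = ?e ` K" "finite K" using S by (meson finite_subset_image)
  have "(\<Sum>k\<in>K. fps_const (u (?e k)) * ?e k) = 0"
    using eq unfolding K(1) by (subst (asm) sum.reindex) (auto simp: fps_scale_def inj_on_def)
  then show "u v = 0" using fps_exp_sum_eq_0[of K "\<lambda>k. u (?e k)"] K v by auto
qed

lemma fps_exp_mult: "fps_exp (of_int k) * fps_exp (of_int l) = (fps_exp (of_int (k + l)) :: rat fps)"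
  by (simp add: fps_exp_add_mult)

text \<open>
  The image of \<open>1/(2 - t)\<close>.
\<close>

definition pole_series :: "rat fps" where "pole_series = inverse (2 - fps_exp 1)"

lemma pole_series: "(2 - fps_exp 1) * pole_series = 1"
  unfolding pole_series_def by (rule inverse_mult_eq_1') simp

lemma pole_series_reflect: "(2 - fps_exp (- 1)) * fps_reflect pole_series = 1"
  using arg_cong[OF pole_series, of fps_reflect] by simp

text \<open>
  By independence of the exponentials, Laurent polynomials can be evaluated at \<open>t = 2\<close>.  If \<open>r\<close> is one,
  then \<open>r (2 - t) (2 - t\<^sup>-\<^sup>1)\<close> vanishes at \<open>t = 2\<close>.  For \<open>r = 1/(2 - t) - 1/(2 - t\<^sup>-\<^sup>1)\<close> this product
  is \<open>t - t\<^sup>-\<^sup>1\<close>, whose value is \<open>3/2\<close>.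
\<close>

lemma pole_series_notin_span: "pole_series - fps_reflect pole_series \<notin> laurent_span"
proof
  let ?e = "\<lambda>k::int. fps_exp (of_int k :: rat)"
  interpret Q: vector_space "(*) :: rat \<Rightarrow> rat \<Rightarrow> rat" by (rule vector_space_rat)
  interpret VP: vector_space_pair fps_scale "(*) :: rat \<Rightarrow> rat \<Rightarrow> rat" ..
  have inj: "inj ?e" by (simp add: inj_def)
  obtain ev where lin: "Vector_Spaces.linear fps_scale (*) ev"
    and ev: "\<And>x. x \<in> range ?e \<Longrightarrow> ev x = 2 powi (inv_into UNIV ?e x)"
    using VP.linear_independent_extend[OF independent_fps_exp, of "\<lambda>x. 2 powi (inv_into UNIV ?e x)"] by blast
  interpret ev: Vector_Spaces.linear fps_scale "(*)" ev by (fact lin)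
  have ev_exp: "ev (fps_exp (of_int k)) = 2 powi k" for k
    using ev[of "?e k"] inv_f_f[OF inj, of k] by simp
  let ?q = "(2 - fps_exp 1) * (2 - fps_exp (- 1)) :: rat fps"
  have q: "?q = fps_const 5 - fps_const 2 * ?e 1 - fps_const 2 * ?e (- 1)"
  proof -
    have "?e 1 * ?e (- 1) = 1" using fps_exp_mult[of 1 "- 1"] by simp
    moreover have "fps_const 5 = (5 :: rat fps)" "fps_const 2 = (2 :: rat fps)"
      by (simp_all add: numeral_fps_const)
    ultimately show ?thesis by (simp add: algebra_simps)
  qed
  have "ev (r * ?q) = 0" if "r \<in> laurent_span" for r
    using that
  proof (induction rule: fps.span_induct_alt)
    case base
    then show ?case using ev.zero by simp
  next
    case (step c x y)
    then obtain k where x: "x = ?e k" by blast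
    have "?e k * ?q = fps_scale 5 (?e k) - fps_scale 2 (?e (k + 1)) - fps_scale 2 (?e (k - 1))"
    proof -
      have "?e k * ?q = fps_const 5 * ?e k - fps_const 2 * (?e k * ?e 1) - fps_const 2 * (?e k * ?e (- 1))"
        unfolding q by (simp add: algebra_simps)
      then show ?thesis unfolding fps_exp_mult fps_scale_def by simp
    qed
    then have "ev (?e k * ?q) = 5 * 2 powi k - 2 * 2 powi (k + 1) - 2 * 2 powi (k - 1)"
      by (simp only: ev.diff ev.scale ev_exp)
    also have "\<dots> = 0" by (simp add: power_int_add power_int_diff)
    finally have "ev (?e k * ?q) = 0" .
    moreover have "(fps_scale c x + y) * ?q = fps_scale c (?e k * ?q) + y * ?q"
      by (simp add: x fps_scale_def algebra_simps)
    ultimately show ?case using step by (simp only: ev.add ev.scale)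
  qed
  moreover assume "pole_series - fps_reflect pole_series \<in> laurent_span"
  moreover have "(pole_series - fps_reflect pole_series) * ?q = ?e 1 - ?e (- 1)"
  proof -
    have "(pole_series - fps_reflect pole_series) * ?q
        = (2 - fps_exp 1) * pole_series * (2 - fps_exp (- 1)) - (2 - fps_exp 1) * ((2 - fps_exp (- 1)) * fps_reflect pole_series)"
      by (simp add: algebra_simps)
    also have "\<dots> = (2 - fps_exp (- 1)) - (2 - fps_exp 1)"
      by (simp only: pole_series pole_series_reflect mult_1 mult_1_right)
    finally show ?thesis by simp
  qed
  ultimately have "ev (?e 1 - ?e (- 1)) = 0" by metis
  then show False by (simp only: ev.diff ev_exp) simp
qed

lemma exists_laurent_killing_functional:
  obtains L :: "rat fps \<Rightarrow> rat" where "\<And>f g. L (f + g) = L f + L g" "\<And>c f. L (fps_const c * f) = c * L f"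
    "\<And>f. f \<in> laurent_span \<Longrightarrow> L f = 0" "L (pole_series - fps_reflect pole_series) = 1"
  using separating_functional[OF vector_space_fps_scale fps.span_zero fps.span_add fps.span_scale
      pole_series_notin_span] that unfolding fps_scale_def by blast

text \<open>
  The embedding \<open>t \<mapsto> e\<^sup>u\<close> of the integral group ring.
\<close>

definition to_fps :: "(int \<Rightarrow>\<^sub>0 int) \<Rightarrow> rat fps" where
  "to_fps q = (\<Sum>k\<in>Poly_Mapping.keys q. fps_const (of_int (Poly_Mapping.lookup q k)) * fps_exp (of_int k))"

lemma to_fps_superset:
  assumes "finite A" "Poly_Mapping.keys q \<subseteq> A"
  shows "to_fps q = (\<Sum>k\<in>A. fps_const (of_int (Poly_Mapping.lookup q k)) * fps_exp (of_int k))"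
  unfolding to_fps_def using assms by (intro sum.mono_neutral_left) (auto simp: in_keys_iff)

lemma to_fps_add: "to_fps (p + q) = to_fps p + to_fps q"
proof -
  have "to_fps r = (\<Sum>k\<in>Poly_Mapping.keys p \<union> Poly_Mapping.keys q. fps_const (of_int (Poly_Mapping.lookup r k)) * fps_exp (of_int k))"
    if "r \<in> {p, q, p + q}" for r
    using that keys_add[of p q] by (intro to_fps_superset) auto
  then show ?thesis
    by (simp add: lookup_add sum.distrib algebra_simps flip: fps_const_add)
qed

lemma to_fps_single: "to_fps (Poly_Mapping.single k 1) = fps_exp (of_int k)"
  by (simp add: to_fps_def)

lemma to_fps_shift: "to_fps (Poly_Mapping.single m 1 * q) = fps_exp (of_int m) * to_fps q"
proof (induction q rule: frag_induction[OF subset_UNIV, case_names zero one diff])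
  case zero
  show ?case by (simp add: to_fps_def)
next
  case (one k)
  then show ?case by (simp add: mult_single to_fps_single fps_exp_add_mult)
next
  case (diff a b)
  have minus: "to_fps (p - q) = to_fps p - to_fps q" for p q
    using to_fps_add[of "p - q" q] by (simp add: algebra_simps)
  show ?case using diff by (simp add: right_diff_distrib minus)
qed

lemma fps_exp_in_laurent_span: "fps_exp (of_int k) \<in> laurent_span"
  by (rule fps.span_base) simp

lemma to_fps_in_laurent_span: "to_fps q \<in> laurent_span"
  unfolding to_fps_def
  using fps.span_scale[OF fps_exp_in_laurent_span] by (intro fps.span_sum) (simp add: fps_scale_def)

lemma laurent_span_mult:
  assumes "f \<in> laurent_span" "g \<in> laurent_span"
  shows "f * g \<in> laurent_span"
  using assms(1)
proof (induction rule: fps.span_induct_alt)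
  case base
  then show ?case by (simp add: fps.span_zero)
next
  case (step c x y)
  then obtain k where x: "x = fps_exp (of_int k)" by blast
  have "fps_exp (of_int k) * g \<in> laurent_span"
    using assms(2)
  proof (induction rule: fps.span_induct_alt)
    case base
    then show ?case by (simp add: fps.span_zero)
  next
    case (step c x y)
    then obtain l where x: "x = fps_exp (of_int l)" by blast
    have "fps_exp (of_int k) * (fps_scale c x + y) = fps_scale c (fps_exp (of_int (k + l))) + fps_exp (of_int k) * y"
      by (simp add: x fps_scale_def algebra_simps fps_exp_add_mult)
    then show ?case
      using step(2) fps.span_add[OF fps.span_scale[OF fps_exp_in_laurent_span]] by metis
  qed
  moreover have "(fps_scale c x + y) * g = fps_scale c (fps_exp (of_int k) * g) + y * g"
    by (simp add: x fps_scale_def algebra_simps)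
  ultimately show ?case using step(2) fps.span_add fps.span_scale by metis
qed

lemma laurent_span_reflect:
  assumes "f \<in> laurent_span"
  shows "fps_reflect f \<in> laurent_span"
  using assms
proof (induction rule: fps.span_induct_alt)
  case base
  then show ?case by (simp add: fps.span_zero)
next
  case (step c x y)
  then obtain k where x: "x = fps_exp (of_int k)" by blast
  have "fps_reflect (fps_scale c x + y) = fps_scale c (fps_exp (of_int (- k))) + fps_reflect y"
    by (simp add: x fps_scale_def)
  then show ?case
    using step(2) fps.span_add[OF fps.span_scale[OF fps_exp_in_laurent_span]] by metis
qed

lemma laurent_span_deriv:
  assumes "f \<in> laurent_span"
  shows "fps_deriv f \<in> laurent_span"
  using assms
proof (induction rule: fps.span_induct_alt)
  case base
  then show ?case by (simp add: fps.span_zero)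
next
  case (step c x y)
  then obtain k where x: "x = fps_exp (of_int k)" by blast
  have "fps_deriv (fps_scale c x + y) = fps_scale (c * of_int k) (fps_exp (of_int k)) + fps_deriv y"
    by (simp add: x fps_scale_def mult.assoc flip: fps_const_mult)
  then show ?case
    using step(2) fps.span_add[OF fps.span_scale[OF fps_exp_in_laurent_span]] by metis
qed

section \<open>A Heisenberg group over the completed module\<close>

text \<open>
  The pairing \<open>q(u) r(-u)\<close> is invariant, since \<open>e\<^bsup>c u\<^esup>\<close> becomes \<open>e\<^bsup>- c u\<^esup>\<close> in the second factor.  Its
  variant with a derivative is invariant only up to a multiple of the first pairing; this term makes
  the action on the central subgroup \<open>\<rat>\<^sup>2\<close> of the Heisenberg group nontrivial.
\<close>

lemma fps_exp_pairing:
  "(fps_exp c * q) * fps_reflect (fps_exp c * r) = q * fps_reflect r"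
proof -
  have "fps_exp c * fps_exp (- c) = (1 :: rat fps)" by (simp flip: fps_exp_add_mult)
  moreover have "(fps_exp c * q) * fps_reflect (fps_exp c * r) = (fps_exp c * fps_exp (- c)) * (q * fps_reflect r)"
    by (simp add: mult_ac)
  ultimately show ?thesis by simp
qed

lemma fps_exp_deriv_pairing:
  "(fps_exp c * q) * fps_reflect (fps_deriv (fps_exp c * r))
    = fps_const c * (q * fps_reflect r) + q * fps_reflect (fps_deriv r)"
proof -
  have "fps_deriv (fps_exp c * r) = fps_const c * (fps_exp c * r) + fps_exp c * fps_deriv r"
    by (simp add: algebra_simps)
  then have "(fps_exp c * q) * fps_reflect (fps_deriv (fps_exp c * r))
      = fps_const c * ((fps_exp c * q) * fps_reflect (fps_exp c * r)) + (fps_exp c * q) * fps_reflect (fps_exp c * fps_deriv r)"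
    by (simp add: distrib_left mult_ac)
  then show ?thesis by (simp only: fps_exp_pairing)
qed

text \<open>
  The four equations say that \<open>g \<mapsto> (\<beta>(g), \<alpha>(g), p(g), \<chi>(g))\<close> is a homomorphism to the group of
  quadruples with the multiplication
  \<open>(\<beta>, \<alpha>, p, \<chi>) (\<beta>', \<alpha>', p', \<chi>') =
  (\<beta> + \<beta>' + \<chi> \<alpha>' + L\<langle>p, dq/du\<rangle>, \<alpha> + \<alpha>' + L\<langle>p, q\<rangle>, p + q, \<chi> + \<chi>')\<close>,
  where \<open>q = e\<^bsup>\<chi> u\<^esup> p'\<close> and \<open>\<langle>f, g\<rangle> = f(u) g(-u)\<close>.
\<close>

locale heisenberg_coordinates = group E for E :: "('u, 'v) monoid_scheme" (structure) +
  fixes L :: "rat fps \<Rightarrow> rat" and \<chi> :: "'u \<Rightarrow> rat" and p :: "'u \<Rightarrow> rat fps" and \<alpha> \<beta> :: "'u \<Rightarrow> rat"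
  assumes L_add: "L (q + r) = L q + L r"
    and \<chi>: "g \<in> carrier E \<Longrightarrow> h \<in> carrier E \<Longrightarrow> \<chi> (g \<otimes> h) = \<chi> g + \<chi> h"
    and p: "g \<in> carrier E \<Longrightarrow> h \<in> carrier E \<Longrightarrow> p (g \<otimes> h) = p g + fps_exp (\<chi> g) * p h"
    and \<alpha>: "g \<in> carrier E \<Longrightarrow> h \<in> carrier E \<Longrightarrow>
      \<alpha> (g \<otimes> h) = \<alpha> g + \<alpha> h + L (p g * fps_reflect (fps_exp (\<chi> g) * p h))"
    and \<beta>: "g \<in> carrier E \<Longrightarrow> h \<in> carrier E \<Longrightarrow>
      \<beta> (g \<otimes> h) = \<beta> g + \<beta> h + (\<chi> g * \<alpha> h + L (p g * fps_reflect (fps_deriv (fps_exp (\<chi> g) * p h))))"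
begin

lemma L_simps: "L 0 = 0" "L (f - g) = L f - L g"
  using L_add[of 0 0] L_add[of "f - g" g] by simp_all

lemma commutator_eq: "g \<in> carrier E \<Longrightarrow> h \<in> carrier E \<Longrightarrow> (g \<otimes> h \<otimes> inv g \<otimes> inv h) \<otimes> (h \<otimes> g) = g \<otimes> h"
  by (simp add: m_assoc inv_solve_left')

text \<open>
  Comparing coordinates in \<open>w a y = y a\<close> shows that \<open>w\<close> has \<open>\<chi> = p = 0\<close> and \<open>\<alpha>(w) = 1\<close>.  The same
  comparison in \<open>v b w = w b\<close>, where \<open>v = [w, b]\<close>, leaves only \<open>\<beta>(v) = - \<chi>(b) \<alpha>(w) = -1\<close>.
\<close>

lemma double_commutator_nontrivial:
  assumes y: "y \<in> carrier E" "\<chi> y = 0" and a: "a \<in> carrier E" "\<chi> a = 0" "p a = 1"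
    and b: "b \<in> carrier E" "\<chi> b = 1" "p b = 0" and L: "L (p y - fps_reflect (p y)) = 1"
    and w: "w = y \<otimes> a \<otimes> inv y \<otimes> inv a"
  shows "w \<otimes> b \<otimes> inv w \<otimes> inv b \<noteq> \<one>"
proof -
  have wc: "w \<in> carrier E" using y a by (simp add: w)
  have ay: "a \<otimes> y \<in> carrier E" using y a by simp
  have eq: "w \<otimes> (a \<otimes> y) = y \<otimes> a" unfolding w by (rule commutator_eq[OF y(1) a(1)])
  have \<chi>w: "\<chi> w = 0" using arg_cong[OF eq, of \<chi>] wc ay y a by (simp add: \<chi>)
  have pw: "p w = 0" using arg_cong[OF eq, of p] wc ay y a \<chi>w by (simp add: p \<chi>)
  have \<alpha>w: "\<alpha> w = 1"
    using arg_cong[OF eq, of \<alpha>] wc ay y a \<chi>w pw L by (simp add: \<alpha> \<chi> p L_simps)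
  define v where "v = w \<otimes> b \<otimes> inv w \<otimes> inv b"
  have vc: "v \<in> carrier E" using wc b by (simp add: v_def)
  have bw: "b \<otimes> w \<in> carrier E" using wc b by simp
  have eq: "v \<otimes> (b \<otimes> w) = w \<otimes> b" unfolding v_def by (rule commutator_eq[OF wc b(1)])
  have \<chi>v: "\<chi> v = 0" using arg_cong[OF eq, of \<chi>] wc bw vc b by (simp add: \<chi>)
  have pv: "p v = 0" using arg_cong[OF eq, of p] wc bw vc b \<chi>v \<chi>w pw by (simp add: p \<chi>)
  have "\<beta> v = - 1"
    using arg_cong[OF eq, of \<beta>] wc bw vc b \<chi>v pv \<chi>w pw \<alpha>w by (simp add: \<beta> \<chi> p L_simps)
  moreover have "\<beta> \<one> = 0"
  proof -
    have "\<chi> \<one> = 0" using \<chi>[of \<one> \<one>] by simp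
    then have "p \<one> = 0" using p[of \<one> \<one>] by simp
    then show ?thesis using \<beta>[of \<one> \<one>] \<open>\<chi> \<one> = 0\<close> by (simp add: L_simps)
  qed
  ultimately show ?thesis unfolding v_def[symmetric] by auto
qed

text \<open>
  In the coordinate \<open>p\<close> the equation reads \<open>2 p(y) = 1 + e\<^sup>u p(y)\<close>.
\<close>

lemma pole_series_solution:
  assumes y: "y \<in> carrier E" and a: "a \<in> carrier E" "\<chi> a = 0" "p a = 1"
    and b: "b \<in> carrier E" "\<chi> b = 1" "p b = 0"
    and eq: "y \<otimes> y \<otimes> b \<otimes> inv y \<otimes> inv b = a"
  shows "\<chi> y = 0" "p y = pole_series"
proof -
  have c: "y \<otimes> y \<in> carrier E" "a \<otimes> b \<in> carrier E" "a \<otimes> (b \<otimes> y) \<in> carrier E" "b \<otimes> y \<in> carrier E"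
    using y a b by simp_all
  have eq': "y \<otimes> y \<otimes> b = a \<otimes> (b \<otimes> y)"
    unfolding eq[symmetric] using y b(1) by (simp add: m_assoc inv_solve_left')
  show \<chi>y: "\<chi> y = 0" using arg_cong[OF eq', of \<chi>] y a b c by (simp add: \<chi>)
  have "p y + p y = 1 + fps_exp 1 * p y"
    using arg_cong[OF eq', of p] y a b c \<chi>y by (simp add: p \<chi>)
  then have "(2 - fps_exp 1) * p y = 1" by (simp add: algebra_simps)
  then have "(2 - fps_exp 1) * p y = (2 - fps_exp 1) * pole_series" by (simp only: pole_series)
  moreover have "(2 - fps_exp 1 :: rat fps) \<noteq> 0" using pole_series by auto
  ultimately show "p y = pole_series" by simp
qed

end

section \<open>The double commutator\<close>

lemma (in group) additive_derived:
  fixes \<chi> :: "'a \<Rightarrow> rat"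
  assumes \<chi>: "\<And>g h. g \<in> carrier G \<Longrightarrow> h \<in> carrier G \<Longrightarrow> \<chi> (g \<otimes> h) = \<chi> g + \<chi> h"
    and k: "k \<in> derived G (carrier G)"
  shows "\<chi> k = 0"
proof -
  have one: "\<chi> \<one> = 0" using \<chi>[of \<one> \<one>] by simp
  have inv: "\<chi> (inv g) = - \<chi> g" if "g \<in> carrier G" for g
    using \<chi>[of g "inv g"] that one by simp
  have "subgroup {g \<in> carrier G. \<chi> g = 0} G"
    by (rule subgroupI) (use one in \<open>auto simp: \<chi> inv\<close>)
  moreover have "derived_set G (carrier G) \<subseteq> {g \<in> carrier G. \<chi> g = 0}"
    by (auto simp: \<chi> inv)
  ultimately have "derived G (carrier G) \<subseteq> {g \<in> carrier G. \<chi> g = 0}"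
    unfolding derived_def using generate_subgroup_incl by blast
  then show ?thesis using k by blast
qed

theorem theorem8p2:
  fixes E :: "'u monoid"
    and \<eta> :: "(int \<Rightarrow>\<^sub>0 int) \<times> int \<Rightarrow> 'u"
    and \<tau> :: "'i rel"
  assumes "is_HZ_length wreath_Z_Z E \<eta> \<tau>"
  shows "omega_plus_2 \<le>o \<tau>"
proof (rule ccontr)
  let ?W = "wreath_Z_Z"
  assume small: "\<not> omega_plus_2 \<le>o \<tau>"
  have HZ: "HZ_map ?W E \<eta>" and local: "HZ_local E" and \<tau>: "Well_order \<tau>"
    and trivial: "transfinite_lcs E \<tau> = {\<one>\<^bsub>E\<^esub>}"
    using assms by (simp_all add: is_HZ_length_def HZ_localization_def is_nilpotency_length_def)
  interpret E: group E by (rule HZ_mapD(2)[OF HZ])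
  note \<eta> = HZ_mapD(3)[OF HZ]
  have W: "x \<in> carrier ?W" "(q, m) \<otimes>\<^bsub>?W\<^esub> (q', m') = (q + Poly_Mapping.single m 1 * q', m + m')" for x q m q' m'
    by (simp_all add: wreath_Z_Z_def)
  have \<eta>c: "\<eta> x \<in> carrier E" for x using hom_in_carrier[OF \<eta> W(1)] .
  obtain L :: "rat fps \<Rightarrow> rat" where L: "\<And>f g. L (f + g) = L f + L g" "\<And>c f. L (fps_const c * f) = c * L f"
    "\<And>f. f \<in> laurent_span \<Longrightarrow> L f = 0" "L (pole_series - fps_reflect pole_series) = 1"
    using exists_laurent_killing_functional by blast
  obtain \<chi> :: "'u \<Rightarrow> rat" where \<chi>: "\<And>g h. g \<in> carrier E \<Longrightarrow> h \<in> carrier E \<Longrightarrow> \<chi> (g \<otimes>\<^bsub>E\<^esub> h) = \<chi> g + \<chi> h"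
    and \<chi>\<eta>: "\<And>q m. \<chi> (\<eta> (q, m)) = of_int m"
  proof (rule HZ_map_extends_cocycle_splitting[OF HZ, of "\<lambda>g h. 0" "\<lambda>x. of_int (snd x)"])
    show "of_int (snd (x \<otimes>\<^bsub>?W\<^esub> y)) = of_int (snd x) + of_int (snd y) + (0 :: rat)" for x y
      by (cases x; cases y) (simp add: W)
  next
    fix s :: "'u \<Rightarrow> rat" assume s: "\<And>g h. g \<in> carrier E \<Longrightarrow> h \<in> carrier E \<Longrightarrow> s (g \<otimes>\<^bsub>E\<^esub> h) = s g + s h + 0"
      "\<And>x. x \<in> carrier ?W \<Longrightarrow> s (\<eta> x) = of_int (snd x)"
    show thesis by (rule that[of s]) (use s W(1) in auto)
  qed simp_all
  obtain p where p: "\<And>g h. g \<in> carrier E \<Longrightarrow> h \<in> carrier E \<Longrightarrow> p (g \<otimes>\<^bsub>E\<^esub> h) = p g + fps_exp (\<chi> g) * p h"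
    and p\<eta>: "\<And>q m. p (\<eta> (q, m)) = to_fps q"
  proof (rule HZ_map_extends_crossed_hom[OF HZ \<chi>, of "\<lambda>x. to_fps (fst x)"])
    show "to_fps (fst (x \<otimes>\<^bsub>?W\<^esub> y)) = to_fps (fst x) + fps_exp (\<chi> (\<eta> x)) * to_fps (fst y)" for x y
      by (cases x; cases y) (simp add: W \<chi>\<eta> to_fps_add to_fps_shift)
  next
    fix s assume s: "\<And>g h. g \<in> carrier E \<Longrightarrow> h \<in> carrier E \<Longrightarrow> s (g \<otimes>\<^bsub>E\<^esub> h) = s g + fps_exp (\<chi> g) * s h"
      "\<And>x. x \<in> carrier ?W \<Longrightarrow> s (\<eta> x) = to_fps (fst x)"
    show thesis by (rule that[of s]) (use s W(1) in auto)
  qed simp_all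
  \<comment> \<open>The cocycles of the two central coordinates.  Both vanish on \<open>G\<close>, as \<open>L\<close> kills Laurent polynomials.\<close>
  define z\<^sub>1 where "z\<^sub>1 g h = L (p g * fps_reflect (fps_exp (\<chi> g) * p h))" for g h
  have span: "p (\<eta> x) \<in> laurent_span" "fps_exp (\<chi> (\<eta> x)) * p (\<eta> y) \<in> laurent_span" for x y
    by (cases x; cases y; simp add: p\<eta> \<chi>\<eta> to_fps_in_laurent_span fps_exp_in_laurent_span laurent_span_mult)+
  obtain \<alpha> where \<alpha>: "\<And>g h. g \<in> carrier E \<Longrightarrow> h \<in> carrier E \<Longrightarrow> \<alpha> (g \<otimes>\<^bsub>E\<^esub> h) = \<alpha> g + \<alpha> h + z\<^sub>1 g h"
    and \<alpha>\<eta>: "\<And>x. \<alpha> (\<eta> x) = 0"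
  proof (rule HZ_map_extends_cocycle_splitting[OF HZ, of z\<^sub>1 "\<lambda>x. 0"])
    fix g h k assume ghk: "g \<in> carrier E" "h \<in> carrier E" "k \<in> carrier E"
    define r where "r = fps_exp (\<chi> h) * p k"
    have "z\<^sub>1 (g \<otimes>\<^bsub>E\<^esub> h) k = L ((p g + fps_exp (\<chi> g) * p h) * fps_reflect (fps_exp (\<chi> g) * r))"
      using ghk by (simp add: z\<^sub>1_def \<chi> p r_def fps_exp_add_mult mult.assoc)
    also have "\<dots> = L (p g * fps_reflect (fps_exp (\<chi> g) * r)) + L (p h * fps_reflect r)"
      by (simp only: distrib_right fps_exp_pairing L(1))
    moreover have "z\<^sub>1 g (h \<otimes>\<^bsub>E\<^esub> k) = L (p g * fps_reflect (fps_exp (\<chi> g) * (p h + r)))"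
      using ghk by (simp only: z\<^sub>1_def p r_def)
    moreover have "\<dots> = z\<^sub>1 g h + L (p g * fps_reflect (fps_exp (\<chi> g) * r))"
      by (simp only: z\<^sub>1_def distrib_left fps_reflect_simps L(1))
    moreover have "z\<^sub>1 h k = L (p h * fps_reflect r)" by (simp add: z\<^sub>1_def r_def)
    ultimately show "z\<^sub>1 h k + z\<^sub>1 g (h \<otimes>\<^bsub>E\<^esub> k) = z\<^sub>1 (g \<otimes>\<^bsub>E\<^esub> h) k + z\<^sub>1 g h"
      by simp
  next
    show "0 = 0 + 0 + z\<^sub>1 (\<eta> x) (\<eta> y)" for x y
      using L(3)[OF laurent_span_mult[OF span(1) laurent_span_reflect[OF span(2)]]] by (simp add: z\<^sub>1_def del: fps_reflect_mult)
  next
    fix s assume s: "\<And>g h. g \<in> carrier E \<Longrightarrow> h \<in> carrier E \<Longrightarrow> s (g \<otimes>\<^bsub>E\<^esub> h) = s g + s h + z\<^sub>1 g h"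
      "\<And>x. x \<in> carrier ?W \<Longrightarrow> s (\<eta> x) = 0"
    show thesis by (rule that[of s]) (use s W(1) in auto)
  qed
  define z\<^sub>2 where "z\<^sub>2 g h = \<chi> g * \<alpha> h + L (p g * fps_reflect (fps_deriv (fps_exp (\<chi> g) * p h)))" for g h
  obtain \<beta> where \<beta>: "\<And>g h. g \<in> carrier E \<Longrightarrow> h \<in> carrier E \<Longrightarrow> \<beta> (g \<otimes>\<^bsub>E\<^esub> h) = \<beta> g + \<beta> h + z\<^sub>2 g h"
  proof (rule HZ_map_extends_cocycle_splitting[OF HZ, of z\<^sub>2 "\<lambda>x. 0"])
    fix g h k assume ghk: "g \<in> carrier E" "h \<in> carrier E" "k \<in> carrier E"
    define r where "r = fps_exp (\<chi> h) * p k"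
    let ?A = "L (p g * fps_reflect (fps_deriv (fps_exp (\<chi> g) * r)))"
    have z\<^sub>1: "z\<^sub>1 h k = L (p h * fps_reflect r)" by (simp add: z\<^sub>1_def r_def)
    have "z\<^sub>2 (g \<otimes>\<^bsub>E\<^esub> h) k = (\<chi> g + \<chi> h) * \<alpha> k
        + L ((p g + fps_exp (\<chi> g) * p h) * fps_reflect (fps_deriv (fps_exp (\<chi> g) * r)))"
      using ghk by (simp add: z\<^sub>2_def \<chi> p r_def fps_exp_add_mult mult.assoc)
    also have "\<dots> = (\<chi> g + \<chi> h) * \<alpha> k + (?A + (\<chi> g * z\<^sub>1 h k + L (p h * fps_reflect (fps_deriv r))))"
      by (simp only: distrib_right[of "p g"] fps_exp_deriv_pairing L(1,2) z\<^sub>1)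
    moreover have "z\<^sub>2 g (h \<otimes>\<^bsub>E\<^esub> k) = \<chi> g * (\<alpha> h + \<alpha> k + z\<^sub>1 h k)
        + L (p g * fps_reflect (fps_deriv (fps_exp (\<chi> g) * (p h + r))))"
      using ghk by (simp only: z\<^sub>2_def p r_def \<alpha>)
    moreover have "L (p g * fps_reflect (fps_deriv (fps_exp (\<chi> g) * (p h + r))))
        = L (p g * fps_reflect (fps_deriv (fps_exp (\<chi> g) * p h))) + ?A"
      by (simp only: distrib_left fps_deriv_add fps_reflect_simps L(1))
    moreover have "z\<^sub>2 h k = \<chi> h * \<alpha> k + L (p h * fps_reflect (fps_deriv r))" by (simp add: z\<^sub>2_def r_def)
    ultimately show "z\<^sub>2 h k + z\<^sub>2 g (h \<otimes>\<^bsub>E\<^esub> k) = z\<^sub>2 (g \<otimes>\<^bsub>E\<^esub> h) k + z\<^sub>2 g h"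
      by (simp add: z\<^sub>2_def[of g h] algebra_simps)
  next
    show "0 = 0 + 0 + z\<^sub>2 (\<eta> x) (\<eta> y)" for x y
      using L(3)[OF laurent_span_mult[OF span(1) laurent_span_reflect[OF laurent_span_deriv[OF span(2)]]]]
      by (simp add: z\<^sub>2_def \<alpha>\<eta> del: fps_reflect_mult fps_deriv_mult)
  next
    fix s assume s: "\<And>g h. g \<in> carrier E \<Longrightarrow> h \<in> carrier E \<Longrightarrow> s (g \<otimes>\<^bsub>E\<^esub> h) = s g + s h + z\<^sub>2 g h"
      "\<And>x. x \<in> carrier ?W \<Longrightarrow> s (\<eta> x) = 0"
    show thesis by (rule that[of s]) (use s W(1) in auto)
  qed
  interpret heisenberg_coordinates E L \<chi> p \<alpha> \<beta>
    by unfold_locales (use L(1) \<chi> p \<alpha> \<beta> in \<open>auto simp: z\<^sub>1_def z\<^sub>2_def\<close>)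
  define a where "a = \<eta> (Poly_Mapping.single 0 1, 0)"
  define b where "b = \<eta> (0, 1)"
  have a: "a \<in> carrier E" "\<chi> a = 0" "p a = 1" and b: "b \<in> carrier E" "\<chi> b = 1" "p b = 0"
    using \<eta>c \<chi>\<eta> p\<eta> to_fps_single[of 0] by (simp_all add: a_def b_def to_fps_def)
  \<comment> \<open>The free group has to fit into the type \<open>'u\<close>, which is infinite because \<open>\<chi>\<close> separates the powers of \<open>b\<close>.\<close>
  have "inj (\<lambda>m. \<eta> (0, m))"
    by (rule injI) (metis \<chi>\<eta> of_int_eq_iff)
  then have "infinite (UNIV :: 'u set)"
    using infinite_UNIV_int finite_imageD rev_finite_subset subset_UNIV by metis
  then obtain enc :: "word \<Rightarrow> 'u" where "free_group_code enc" by (rule exists_free_group_code)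
  then interpret free_group_code enc .
  obtain y where y: "y \<in> carrier E"
    and y_eq: "y \<otimes>\<^bsub>E\<^esub> y \<otimes>\<^bsub>E\<^esub> b \<otimes>\<^bsub>E\<^esub> inv\<^bsub>E\<^esub> y \<otimes>\<^bsub>E\<^esub> inv\<^bsub>E\<^esub> b = a"
    by (rule local_solution[OF local a(1) b(1)])
  note py = pole_series_solution[OF y a b y_eq]
  define w where "w = y \<otimes>\<^bsub>E\<^esub> a \<otimes>\<^bsub>E\<^esub> inv\<^bsub>E\<^esub> y \<otimes>\<^bsub>E\<^esub> inv\<^bsub>E\<^esub> a"
  have "w \<in> lower_central E (Suc (Suc (Suc n)))" for n
  proof -
    obtain x k where k: "k \<in> lower_central E (Suc (Suc n))" and yk: "y = k \<otimes>\<^bsub>E\<^esub> \<eta> x"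
      using HZ_map_dense[OF HZ y] by blast
    obtain q m where x: "x = (q, m)" by (cases x)
    \<comment> \<open>As \<open>\<chi>\<close> vanishes on commutators and on \<open>y\<close>, the approximation of \<open>y\<close> lies in \<open>M\<close>.\<close>
    have "lower_central E (Suc (Suc n)) \<subseteq> derived E (carrier E)"
      using E.lower_central_antimono[of "Suc (Suc 0)" "Suc (Suc n)"] by (simp add: commutator_subgroup_carrier)
    then have "\<chi> k = 0" using k E.additive_derived[of \<chi>, OF \<chi>] by blast
    moreover have "k \<in> carrier E" using k E.lower_central_carrier by blast
    ultimately have "m = 0" using py(1) \<eta>c \<chi>\<eta> unfolding yk x by (simp add: \<chi>)
    then have "\<eta> x \<otimes>\<^bsub>E\<^esub> a = a \<otimes>\<^bsub>E\<^esub> \<eta> x"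
      unfolding a_def x using hom_mult[OF \<eta> W(1) W(1)] by (simp add: W add.commute flip: hom_mult[OF \<eta> W(1) W(1)])
    then show ?thesis
      unfolding w_def yk by (rule E.commutator_in_next_lower_central[OF k \<eta>c a(1)])
  qed
  moreover have "lower_central E (Suc (Suc (Suc n))) \<subseteq> lower_central E n" for n
    by (rule E.lower_central_antimono) simp
  ultimately have "w \<in> (\<Inter>n. lower_central E n)" by blast
  then have "w \<otimes>\<^bsub>E\<^esub> b \<otimes>\<^bsub>E\<^esub> inv\<^bsub>E\<^esub> w \<otimes>\<^bsub>E\<^esub> inv\<^bsub>E\<^esub> b \<in> commutator_subgroup E (\<Inter>n. lower_central E n) (carrier E)"
    using b(1) by (rule E.commutator_in_commutator_subgroup)
  also have "\<dots> \<subseteq> {\<one>\<^bsub>E\<^esub>}"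
    using E.transfinite_lcs_lower_bound[OF \<tau> small] unfolding trivial .
  finally show False
    using double_commutator_nontrivial[OF y py(1) a b _ w_def] L(4) py(2) by simp
qed

end
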